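(* For a simple polygon $P$ with $n$ vertices, the number of distinct gluing trees with $\lambda$ leaves arising from Aleksandrov gluings of $P$ is $O(n^{2\lambda-2})$.
   Context: A gluing of $P$ is a length-preserving identification of $\partial P$ with itself (finitely many open intervals glued isometrically in pairs, endpoints identified, transitively). An Aleksandrov gluing is one where at most $2\pi$ total face angle is glued at any point and the result is homeomorphic to a sphere. The gluing tree of a gluing is the labeled tree that is the image of $\partial P$ after identification: its nodes are the images of points of $\partial P$ identified with more or fewer than one other distinct point, together with images of points to which a vertex of $P$ is glued; each node is labeled by the set of vertices and edges of $P$ glued there (a point interior to an edge glued only to itself is a leaf labeled by its edge). Gluing trees are counted as labeled combinatorial trees. *)

theory Defs
  imports "HOL-Analysis.Analysis"
begin

text \<open>A polygon with n vertices is given by its vertex sequence v 0, ..., v (n-1)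
  in the plane (complex numbers); indices are taken modulo n.\<close>

definition nxt :: "nat \<Rightarrow> nat \<Rightarrow> nat" where
  "nxt n i = Suc i mod n"

definition prv :: "nat \<Rightarrow> nat \<Rightarrow> nat" where
  "prv n i = (i + n - 1) mod n"

definition pedge :: "(nat \<Rightarrow> complex) \<Rightarrow> nat \<Rightarrow> nat \<Rightarrow> complex set" where
  "pedge v n i = closed_segment (v i) (v (nxt n i))"

definition simple_polygon :: "(nat \<Rightarrow> complex) \<Rightarrow> nat \<Rightarrow> bool" where
  "simple_polygon v n \<longleftrightarrow>
     n \<ge> 3 \<and> inj_on v {..<n} \<and>
     (\<forall>i<n. \<not> collinear {v (prv n i), v i, v (nxt n i)}) \<and>
     (\<forall>i<n. \<forall>j<n. i \<noteq> j \<longrightarrow>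
        pedge v n i \<inter> pedge v n j =
          (if j = nxt n i then {v j} else if i = nxt n j then {v i} else {}))"

definition pbdry :: "(nat \<Rightarrow> complex) \<Rightarrow> nat \<Rightarrow> complex set" where
  "pbdry v n = (\<Union>i<n. pedge v n i)"

definition pregion :: "(nat \<Rightarrow> complex) \<Rightarrow> nat \<Rightarrow> complex set" where
  "pregion v n = pbdry v n \<union> inside (pbdry v n)"

text \<open>Counterclockwise orientation: positive signed (shoelace) area.\<close>
definition ccw_polygon :: "(nat \<Rightarrow> complex) \<Rightarrow> nat \<Rightarrow> bool" where
  "ccw_polygon v n \<longleftrightarrow> (\<Sum>i<n. Im (cnj (v i) * v (nxt n i))) > 0"

definition ccw_angle :: "complex \<Rightarrow> complex \<Rightarrow> real" where
  "ccw_angle a b = Arg2pi (b / a)"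

definition int_angle :: "(nat \<Rightarrow> complex) \<Rightarrow> nat \<Rightarrow> nat \<Rightarrow> real" where
  "int_angle v n i =
     (if ccw_polygon v n
      then ccw_angle (v (nxt n i) - v i) (v (prv n i) - v i)
      else ccw_angle (v (prv n i) - v i) (v (nxt n i) - v i))"

definition face_angle :: "(nat \<Rightarrow> complex) \<Rightarrow> nat \<Rightarrow> complex \<Rightarrow> real" where
  "face_angle v n p =
     (if \<exists>i<n. v i = p then int_angle v n (THE i. i < n \<and> v i = p) else pi)"

definition elen :: "(nat \<Rightarrow> complex) \<Rightarrow> nat \<Rightarrow> nat \<Rightarrow> real" where
  "elen v n i = cmod (v (nxt n i) - v i)"

definition cumlen :: "(nat \<Rightarrow> complex) \<Rightarrow> nat \<Rightarrow> nat \<Rightarrow> real" where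
  "cumlen v n i = (\<Sum>j<i. elen v n j)"

definition perim :: "(nat \<Rightarrow> complex) \<Rightarrow> nat \<Rightarrow> real" where
  "perim v n = cumlen v n n"

definition wrap :: "(nat \<Rightarrow> complex) \<Rightarrow> nat \<Rightarrow> real \<Rightarrow> real" where
  "wrap v n s = perim v n * frac (s / perim v n)"

definition bpt :: "(nat \<Rightarrow> complex) \<Rightarrow> nat \<Rightarrow> real \<Rightarrow> complex" where
  "bpt v n s =
     (let u = wrap v n s;
          i = (THE i. i < n \<and> cumlen v n i \<le> u \<and> u < cumlen v n (Suc i))
      in v i + of_real ((u - cumlen v n i) / elen v n i) * (v (nxt n i) - v i))"

text \<open>A gluing is a finite list of glued pairs (s1, s2, l, r): the open boundary arc of
  length l starting at parameter s1 is glued isometrically to the open boundary arc of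
  length l starting at parameter s2; if r then orientation-reversing
  (s1 + t with s2 + l - t), else orientation-preserving (s1 + t with s2 + t).\<close>

type_synonym gluing = "(real \<times> real \<times> real \<times> bool) list"

definition oarc :: "(nat \<Rightarrow> complex) \<Rightarrow> nat \<Rightarrow> real \<Rightarrow> real \<Rightarrow> real set" where
  "oarc v n s l = {wrap v n (s + t) | t. 0 < t \<and> t < l}"

definition gluing_arcs :: "gluing \<Rightarrow> (real \<times> real) list" where
  "gluing_arcs G = concat (map (\<lambda>(s1, s2, l, r). [(s1, l), (s2, l)]) G)"

definition is_gluing :: "(nat \<Rightarrow> complex) \<Rightarrow> nat \<Rightarrow> gluing \<Rightarrow> bool" where
  "is_gluing v n G \<longleftrightarrow>
     (\<forall>(s1, s2, l, r) \<in> set G. 0 < l) \<and>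
     (\<forall>i j. i < j \<and> j < length (gluing_arcs G) \<longrightarrow>
        oarc v n (fst (gluing_arcs G ! i)) (snd (gluing_arcs G ! i)) \<inter>
        oarc v n (fst (gluing_arcs G ! j)) (snd (gluing_arcs G ! j)) = {}) \<and>
     finite ({0..<perim v n} -
             (\<Union>(s, l) \<in> set (gluing_arcs G). oarc v n s l))"

text \<open>Basic identifications (including the endpoints, by continuity).\<close>
definition glue_base :: "(nat \<Rightarrow> complex) \<Rightarrow> nat \<Rightarrow> gluing \<Rightarrow> (complex \<times> complex) set" where
  "glue_base v n G =
     {(bpt v n (s1 + t), bpt v n (if r then s2 + l - t else s2 + t)) | s1 s2 l r t.
        (s1, s2, l, r) \<in> set G \<and> 0 \<le> t \<and> t \<le> l}"

definition glue_eq :: "(nat \<Rightarrow> complex) \<Rightarrow> nat \<Rightarrow> gluing \<Rightarrow> (complex \<times> complex) set" where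
  "glue_eq v n G = (glue_base v n G \<union> (glue_base v n G)\<inverse>)\<^sup>*"

definition glue_class :: "(nat \<Rightarrow> complex) \<Rightarrow> nat \<Rightarrow> gluing \<Rightarrow> complex \<Rightarrow> complex set" where
  "glue_class v n G x = {y \<in> pbdry v n. (x, y) \<in> glue_eq v n G}"

text \<open>Aleksandrov gluing: at most 2 pi total face angle glued at any point, and the
  quotient P / ~ is homeomorphic to the 2-sphere.  Since P is compact and the sphere is
  Hausdorff, the latter is the same as a continuous surjection of P onto the sphere
  whose fibres are exactly the identification classes.\<close>
definition aleksandrov_gluing :: "(nat \<Rightarrow> complex) \<Rightarrow> nat \<Rightarrow> gluing \<Rightarrow> bool" where
  "aleksandrov_gluing v n G \<longleftrightarrow>
     is_gluing v n G \<and>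
     (\<forall>x \<in> pbdry v n. (\<Sum>p \<in> glue_class v n G x. face_angle v n p) \<le> 2 * pi) \<and>
     (\<exists>f :: complex \<Rightarrow> real^3.
        continuous_on (pregion v n) f \<and> f ` pregion v n = sphere 0 1 \<and>
        (\<forall>x \<in> pregion v n. \<forall>y \<in> pregion v n. f x = f y \<longleftrightarrow> (x, y) \<in> glue_eq v n G))"

datatype plabel = Vtx nat | Edg nat

definition gt_nodes :: "(nat \<Rightarrow> complex) \<Rightarrow> nat \<Rightarrow> gluing \<Rightarrow> complex set set" where
  "gt_nodes v n G =
     {C. \<exists>x \<in> pbdry v n. C = glue_class v n G x \<and>
          (card C \<noteq> 2 \<or> (\<exists>i<n. v i \<in> C))}"

definition gt_label :: "(nat \<Rightarrow> complex) \<Rightarrow> nat \<Rightarrow> gluing \<Rightarrow> complex set \<Rightarrow> plabel set" where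
  "gt_label v n G C =
     (if C \<in> gt_nodes v n G then
        {Vtx i | i. i < n \<and> v i \<in> C} \<union>
        {Edg i | i. i < n \<and> (\<exists>p \<in> C. p \<in> open_segment (v i) (v (nxt n i)))}
      else {})"

text \<open>Tree edges: the image of a boundary arc between two consecutive (along the
  boundary) points lying in nodes joins the nodes of its two endpoints.\<close>
definition gt_adj :: "(nat \<Rightarrow> complex) \<Rightarrow> nat \<Rightarrow> gluing \<Rightarrow> (complex set \<times> complex set) set" where
  "gt_adj v n G =
     {(A, B) | A B s d. A \<in> gt_nodes v n G \<and> B \<in> gt_nodes v n G \<and>
        0 < d \<and> d \<le> perim v n \<and>
        ((bpt v n s \<in> A \<and> bpt v n (s + d) \<in> B) \<or> (bpt v n s \<in> B \<and> bpt v n (s + d) \<in> A)) \<and>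
        (\<forall>t. 0 < t \<and> t < d \<longrightarrow> bpt v n (s + t) \<notin> \<Union>(gt_nodes v n G))}"

type_synonym ltree = "complex set set \<times> (complex set \<times> complex set) set \<times> (complex set \<Rightarrow> plabel set)"

definition gluing_tree :: "(nat \<Rightarrow> complex) \<Rightarrow> nat \<Rightarrow> gluing \<Rightarrow> ltree" where
  "gluing_tree v n G = (gt_nodes v n G, gt_adj v n G, gt_label v n G)"

definition num_leaves :: "ltree \<Rightarrow> nat" where
  "num_leaves T = (case T of (N, E, lab) \<Rightarrow>
     card {A \<in> N. card {B \<in> N. B \<noteq> A \<and> (A, B) \<in> E} = 1})"

definition ltree_iso :: "ltree rel" where
  "ltree_iso = {((N1, E1, l1), (N2, E2, l2)) | N1 E1 l1 N2 E2 l2.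
     \<exists>f. bij_betw f N1 N2 \<and>
         (\<forall>A \<in> N1. \<forall>B \<in> N1. (A, B) \<in> E1 \<longleftrightarrow> (f A, f B) \<in> E2) \<and>
         (\<forall>A \<in> N1. l2 (f A) = l1 A)}"

definition aleks_trees :: "(nat \<Rightarrow> complex) \<Rightarrow> nat \<Rightarrow> nat \<Rightarrow> ltree set" where
  "aleks_trees v n lam =
     {gluing_tree v n G | G. aleksandrov_gluing v n G \<and> num_leaves (gluing_tree v n G) = lam}"

definition num_aleks_trees :: "(nat \<Rightarrow> complex) \<Rightarrow> nat \<Rightarrow> nat \<Rightarrow> nat" where
  "num_aleks_trees v n lam = card (aleks_trees v n lam // ltree_iso)"

end

theory Submission
  imports Defs
begin

text \<open>
  Parametrise the boundary by arc length.  Since the quotient is a sphere, glued pairs do not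
  interleave, so every class \<open>p\<^sub>1 < \<dots> < p\<^sub>k\<close> is glued locally by \<open>p\<^sub>i + t \<sim> p\<^bsub>i+1\<^esub> - t\<close>; Euler's formula
  for such gluings of a circle reads \<open>\<Sum> (2 - |C|) = 2\<close> over all classes \<open>C\<close>.  The angle condition makes at
  most one point of a class with at least three points a non-vertex, and Gauss-Bonnet bounds the number
  of leaves interior to edges by four, with all other curvature zero in the case of equality.

  A leaf branch that can be recorded by two labels is cut out of the circle, which leaves a circle with
  at most \<open>n\<close> marked points and a gluing with one leaf less.  With two leaves left the gluing is a
  reflection, and the \<open>O(n\<^sup>2)\<close> positions at which two marks are glued separate the combinatorial types.
  So the count is \<open>O(n\<^bsup>2(\<lambda>-2)\<^esup> n\<^sup>2)\<close>.  If no leaf branch can be recorded by two labels, there are exactly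
  four leaves, all interior to edges and everything else is flat; then two of them lie on one edge of the
  polygon, and this edge is cut out at the cost of one label.
\<close>

section \<open>Periodic sets of reals\<close>

text \<open>Gluings of one polygon come in continuous families, so they are compared up to an
  increasing homeomorphism of the circle that fixes the vertices. The induction needs all gluings
  with one code to lose the same arc. Two labels fix a branch if they name two marked ends, or one
  marked end and a leaf at a mark or midway between consecutive marks. One end of a branch is always
  marked; the point where the gap is closed becomes a mark and replaces it, so n never grows. The
  obstacle is a branch with an unmarked end and no such leaf. A junction has at most one unmarked
  point, which ends at most one branch on each side; if every branch has an unmarked end, comparison
  with Euler's formula forces at least four leaves. A leaf at a vertex would give a code, so all
  leaves are interior to edges and Gauss-Bonnet allows no more than four. In that case two branches
  meet at an unmarked point whose position no label records; they are removed together, and the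
  homeomorphism absorbs the position.\<close>

definition periodic :: "real \<Rightarrow> real set \<Rightarrow> bool" where
  "periodic L S \<longleftrightarrow> (\<forall>x. x + L \<in> S \<longleftrightarrow> x \<in> S)"

definition cong_per :: "real \<Rightarrow> real \<Rightarrow> real \<Rightarrow> bool" where
  "cong_per L x y \<longleftrightarrow> (\<exists>k::int. y = x + of_int k * L)"

definition window :: "real \<Rightarrow> real \<Rightarrow> real \<Rightarrow> real" where
  "window L a x = x - of_int \<lfloor>(x - a) / L\<rfloor> * L"

text \<open>The interval is closed on the right so that a point which is alone in its period has
  itself, one period later, as successor.\<close>

definition next_in :: "real \<Rightarrow> real set \<Rightarrow> real \<Rightarrow> real" where
  "next_in L S x = Min (S \<inter> {x<..x + L})"

lemma periodic_int: "periodic L S \<Longrightarrow> x + of_int k * L \<in> S \<longleftrightarrow> x \<in> S"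
proof (induction k rule: int_induct[where k = 0])
  case base
  then show ?case by simp
next
  case (step1 i)
  have "(x + of_int i * L) + L \<in> S \<longleftrightarrow> x + of_int i * L \<in> S"
    using step1.prems unfolding periodic_def by blast
  then show ?case using step1 by (simp add: algebra_simps)
next
  case (step2 i)
  have "(x + of_int (i - 1) * L) + L \<in> S \<longleftrightarrow> x + of_int (i - 1) * L \<in> S"
    using step2.prems unfolding periodic_def by blast
  then show ?case using step2 by (simp add: algebra_simps)
qed

lemma periodic_cong_per: "periodic L S \<Longrightarrow> cong_per L x y \<Longrightarrow> x \<in> S \<longleftrightarrow> y \<in> S"
  unfolding cong_per_def using periodic_int by blast

lemma cong_per_refl [simp]: "cong_per L x x"
  unfolding cong_per_def by (rule exI[of _ 0]) simp

lemma cong_per_sym: "cong_per L x y \<Longrightarrow> cong_per L y x"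
  unfolding cong_per_def by (metis add.commute add_diff_cancel_left' diff_add_cancel mult_minus_left of_int_minus uminus_add_conv_diff)

lemma cong_per_trans: "cong_per L x y \<Longrightarrow> cong_per L y z \<Longrightarrow> cong_per L x z"
  unfolding cong_per_def by (metis add.assoc distrib_right of_int_add)

lemma cong_per_plus_period [simp]: "cong_per L x (x + L)"
  unfolding cong_per_def by (rule exI[of _ 1]) simp

lemma cong_per_minus_period [simp]: "cong_per L x (x - L)"
  unfolding cong_per_def by (rule exI[of _ "-1"]) simp

lemma cong_per_plus_int [simp]: "cong_per L x (x + of_int k * L)"
  unfolding cong_per_def by blast

lemma cong_per_add_right: "cong_per L x y \<Longrightarrow> cong_per L (x + t) (y + t)"
  unfolding cong_per_def by force

lemma cong_per_diff_left: "cong_per L x y \<Longrightarrow> cong_per L (c - x) (c - y)"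
  unfolding cong_per_def
proof -
  assume "\<exists>k. y = x + real_of_int k * L"
  then obtain k where "y = x + real_of_int k * L" by blast
  then have "c - y = c - x + of_int (- k) * L" by simp
  then show "\<exists>k. c - y = c - x + real_of_int k * L" by blast
qed

lemma cong_per_close_eq:
  assumes "L > 0" "cong_per L x y" "\<bar>x - y\<bar> < L"
  shows "x = y"
proof -
  obtain k where k: "y = x + of_int k * L" using assms cong_per_def by auto
  have "\<bar>of_int k\<bar> * L < 1 * L" using assms k by (simp add: abs_mult)
  then have "\<bar>of_int k :: real\<bar> < 1" using assms(1) mult_less_cancel_right_pos by blast
  then have "k = 0" by linarith
  then show ?thesis using k by simp
qed

lemma window_cong_per: "cong_per L x (window L a x)"
  unfolding cong_per_def window_def by (rule exI[of _ "- \<lfloor>(x - a) / L\<rfloor>"]) simp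

lemma window_in:
  assumes "L > 0" shows "window L a x \<in> {a..<a + L}"
proof -
  have "of_int \<lfloor>(x - a) / L\<rfloor> \<le> (x - a) / L" "(x - a) / L < of_int \<lfloor>(x - a) / L\<rfloor> + 1"
    by linarith+
  then have "of_int \<lfloor>(x - a) / L\<rfloor> * L \<le> x - a" "x - a < (of_int \<lfloor>(x - a) / L\<rfloor> + 1) * L"
    using pos_le_divide_eq[OF assms] pos_divide_less_eq[OF assms] by blast+
  then show ?thesis unfolding window_def by (auto simp: algebra_simps)
qed

lemma window_ge: "L > 0 \<Longrightarrow> a \<le> window L a x" and window_less: "L > 0 \<Longrightarrow> window L a x < a + L"
  using window_in[of L a x] by auto

lemma window_eq_iff: "L > 0 \<Longrightarrow> window L a x = window L a y \<longleftrightarrow> cong_per L x y"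
  by (smt (verit) cong_per_close_eq cong_per_sym cong_per_trans window_cong_per window_ge window_less)

lemma window_id: "L > 0 \<Longrightarrow> a \<le> x \<Longrightarrow> x < a + L \<Longrightarrow> window L a x = x"
  by (smt (verit) cong_per_close_eq window_cong_per window_ge window_less)

lemma window_window [simp]: "L > 0 \<Longrightarrow> window L a (window L b x) = window L a x"
  by (meson cong_per_sym window_cong_per window_eq_iff)

lemma window_mem: "periodic L S \<Longrightarrow> window L a x \<in> S \<longleftrightarrow> x \<in> S"
  using periodic_cong_per window_cong_per by blast

lemma cong_per_L_ge:
  assumes "L > 0" "cong_per L x y" "x < y" shows "x + L \<le> y"
  using cong_per_close_eq[OF assms(1,2)] assms(3) by linarith

lemma bij_betw_window:
  assumes "L > 0" "periodic L S"
  shows "bij_betw (window L b) (S \<inter> {a..<a + L}) (S \<inter> {b..<b + L})"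
  by (rule bij_betw_byWitness[where f' = "window L a"])
     (use assms window_in in \<open>auto simp: window_mem window_id window_ge window_less\<close>)

lemma finite_window:
  assumes "L > 0" "periodic L S" "finite (S \<inter> {a..<a + L})"
  shows "finite (S \<inter> {b..<b + L})" "finite (S \<inter> {b<..b + L})" "finite (S \<inter> {b..b + L})"
proof -
  show *: "finite (S \<inter> {b..<b + L})"
    using bij_betw_window[OF assms(1,2)] assms(3) bij_betw_finite by blast
  have "S \<inter> {b..b + L} \<subseteq> insert (b + L) (S \<inter> {b..<b + L})" by auto
  then show "finite (S \<inter> {b..b + L})" using * finite_subset by blast
  then show "finite (S \<inter> {b<..b + L})" by (rule rev_finite_subset) auto
qed

lemma card_window:
  "L > 0 \<Longrightarrow> periodic L S \<Longrightarrow> card (S \<inter> {a..<a + L}) = card (S \<inter> {b..<b + L})"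
  using bij_betw_window bij_betw_same_card by blast

lemma next_in:
  assumes "L > 0" "periodic L S" "finite (S \<inter> {a..<a + L})" "S \<noteq> {}"
  shows "next_in L S x \<in> S" "x < next_in L S x" "next_in L S x \<le> x + L" "\<And>y. x < y \<Longrightarrow> y < next_in L S x \<Longrightarrow> y \<notin> S"
proof -
  obtain s where s: "s \<in> S" using assms by blast
  have f: "finite (S \<inter> {x<..x + L})" using finite_window[OF assms(1-3)] by blast
  have "window L x s \<in> S \<inter> {x..<x + L}" using window_in[OF assms(1)] window_mem[OF assms(2)] s by blast
  moreover from this have "x + L \<in> S" if "window L x s = x"
    using that assms(2) unfolding periodic_def by auto
  ultimately have "window L x s \<in> S \<inter> {x<..x + L} \<or> x + L \<in> S \<inter> {x<..x + L}"
    using assms(1) by force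
  then have "S \<inter> {x<..x + L} \<noteq> {}" by blast
  then have m: "next_in L S x \<in> S \<inter> {x<..x + L}" unfolding next_in_def using f Min_in by blast
  then show "next_in L S x \<in> S" "x < next_in L S x" "next_in L S x \<le> x + L" by auto
  show "y \<notin> S" if "x < y" "y < next_in L S x" for y
  proof
    assume "y \<in> S"
    then have "y \<in> S \<inter> {x<..x + L}" using that m by auto
    then have "next_in L S x \<le> y" unfolding next_in_def using f Min_le by blast
    then show False using that by simp
  qed
qed

lemma next_in_unique:
  assumes "L > 0" "periodic L S" "finite (S \<inter> {a..<a + L})"
    and "y \<in> S" "x < y" "\<And>z. x < z \<Longrightarrow> z < y \<Longrightarrow> z \<notin> S"
  shows "next_in L S x = y"
  using next_in[OF assms(1-3), of x] assms(4-6) by (metis empty_iff linorder_neqE_linordered_idom)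

lemma next_in_period:
  assumes "L > 0" "periodic L S" "finite (S \<inter> {a..<a + L})" "S \<noteq> {}"
  shows "next_in L S (x + L) = next_in L S x + L"
proof (rule next_in_unique[OF assms(1-3)])
  show "next_in L S x + L \<in> S" using next_in(1)[OF assms] assms(2) unfolding periodic_def by blast
  show "x + L < next_in L S x + L" using next_in(2)[OF assms] by simp
  fix z assume "x + L < z" "z < next_in L S x + L"
  then have "z - L \<notin> S" using next_in(4)[OF assms, of x "z - L"] by simp
  then show "z \<notin> S" using assms(2) unfolding periodic_def by (metis diff_add_cancel)
qed

text \<open>Taking successors permutes the points of one window, except that the last point goes to
  the first one plus L. So the sum of the successors exceeds the sum of the points by L.\<close>

lemma sum_gaps:
  assumes "L > 0" "periodic L S" "finite (S \<inter> {a..<a + L})" "S \<noteq> {}"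
  shows "(\<Sum>x\<in>S \<inter> {a..<a + L}. next_in L S x - x) = L"
proof -
  let ?S = "S \<inter> {a..<a + L}"
  obtain s where s: "s \<in> S" using assms by blast
  have ne: "?S \<noteq> {}" using window_in[OF assms(1), of a s] window_mem[OF assms(2), of a s] s by blast
  define m where "m = Min ?S"
  define M where "M = Max ?S"
  have m: "m \<in> ?S" "\<And>x. x \<in> ?S \<Longrightarrow> m \<le> x" using Min_in[OF assms(3) ne] Min_le[OF assms(3)] unfolding m_def by blast+
  have M: "M \<in> ?S" "\<And>x. x \<in> ?S \<Longrightarrow> x \<le> M" using Max_in[OF assms(3) ne] Max_ge[OF assms(3)] unfolding M_def by blast+
  note next_in' = next_in[OF assms]
  have nM: "next_in L S M = m + L"
  proof (rule next_in_unique[OF assms(1-3)])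
    show "m + L \<in> S" using m(1) assms(2) unfolding periodic_def by blast
    show "M < m + L" using m(1) M(1) by auto
    fix z assume z: "M < z" "z < m + L"
    show "z \<notin> S"
    proof
      assume zS: "z \<in> S"
      show False
      proof (cases "z < a + L")
        case True
        then have "z \<in> ?S" using z M(1) zS by auto
        then show False using M(2) z by force
      next
        case False
        have "z - L \<in> S" using zS assms(2) unfolding periodic_def by (metis diff_add_cancel)
        then have "z - L \<in> ?S" using False z m(1) by auto
        then show False using m(2) z by force
      qed
    qed
  qed
  define g where "g x = (if x = M then m else next_in L S x)" for x
  have gin: "g x \<in> ?S" if x: "x \<in> ?S" for x
  proof (cases "x = M")
    case True then show ?thesis using m by (simp add: g_def)
  next
    case False
    then have "x < M" using M(2)[OF x] by simp
    then have "next_in L S x \<le> M" using next_in'(4)[of x M] M(1) by force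
    then show ?thesis using False next_in'(1,2)[of x] x M(1) by (auto simp: g_def)
  qed
  have mono: "next_in L S x < next_in L S y" if "x < y" "y \<in> S" for x y
    using next_in'(4)[of x y] next_in'(2)[of y] that by force
  have "inj_on g ?S"
  proof (rule linorder_inj_onI')
    fix x y assume xy: "x \<in> ?S" "y \<in> ?S" "x < y"
    then have "x \<noteq> M" using M(2)[OF xy(2)] by auto
    then show "g x \<noteq> g y" using xy mono[of x y] m(2)[OF xy(1)] next_in'(2)[of x] by (auto simp: g_def)
  qed
  then have "bij_betw g ?S ?S" using gin assms(3)
    by (simp add: bij_betw_def endo_inj_surj image_subset_iff)
  then have "sum g ?S = sum (\<lambda>x. x) ?S" by (rule sum.reindex_bij_betw)
  moreover have "sum (next_in L S) ?S = sum g ?S + L"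
    using M(1) assms(3) nM by (simp add: sum.remove[of _ M] g_def)
  ultimately show ?thesis by (simp add: sum_subtractf)
qed

section \<open>Gluings of a circle\<close>

definition class_size :: "real \<Rightarrow> (real \<Rightarrow> real \<Rightarrow> bool) \<Rightarrow> real \<Rightarrow> nat" where
  "class_size L R x = card ({y. R x y} \<inter> {0..<L})"

text \<open>\<open>R\<close> lives on the real line, the universal cover of the circle, so that the
  next point of a class has a meaning. The axiom \<open>germ\<close> is the trace of planarity: a
  class is visited in cyclic order, and the side after one of its points is glued, reversed, to the
  side before the next one. A class with one point has q = x + L. The counting argument sees the
  sphere only through this axiom.\<close>

locale circle_gluing =
  fixes L :: real and R :: "real \<Rightarrow> real \<Rightarrow> bool"
  assumes L_pos: "0 < L"
    and R_refl: "R x x"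
    and R_sym: "R x y \<Longrightarrow> R y x"
    and R_trans: "R x y \<Longrightarrow> R y z \<Longrightarrow> R x z"
    and R_period: "R x (x + L)"
    and fin_class: "finite ({y. R x y} \<inter> {0..<L})"
    and germ: "\<exists>q e. x < q \<and> q \<le> x + L \<and> R x q \<and> (\<forall>r. x < r \<and> r < q \<longrightarrow> \<not> R x r) \<and>
                 0 < e \<and> (\<forall>t. 0 \<le> t \<and> t \<le> e \<longrightarrow> R (x + t) (q - t))"
    and fin_special: "finite ({x. class_size L R x \<noteq> 2} \<inter> {0..<L})"
begin

abbreviation "size_of \<equiv> class_size L R"
abbreviation "sc x \<equiv> next_in L {y. R x y} x"
abbreviation "cg \<equiv> cong_per L"

lemma class_eq: "R x y \<Longrightarrow> {z. R x z} = {z. R y z}"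
  using R_sym R_trans by blast

lemma periodic_class: "periodic L {y. R x y}"
  unfolding periodic_def using R_period R_sym R_trans by blast

lemma cg_R: "cg x y \<Longrightarrow> R x y"
  using periodic_cong_per[OF periodic_class, of x y x] R_refl by simp

lemma R_cg: "R x y \<Longrightarrow> cg x x' \<Longrightarrow> cg y y' \<Longrightarrow> R x' y'"
  using cg_R R_sym R_trans by blast

lemma class_size_R: assumes "R x y" shows "size_of x = size_of y"
  unfolding class_size_def class_eq[OF assms] ..

lemma class_size_window: "size_of x = card ({y. R x y} \<inter> {a..<a + L})"
  using card_window[OF L_pos periodic_class, of x 0 a] by (simp add: class_size_def)

lemma fin_window: "finite ({y. R x y} \<inter> {a..<a + L})"
  using finite_window(1)[OF L_pos periodic_class, of x 0 a] fin_class[of x] by simp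

lemma class_ne: "{y. R x y} \<noteq> {}" using R_refl by blast

lemmas sc' = next_in[OF L_pos periodic_class fin_window class_ne]

lemma sc_R: "R x (sc x)" using sc'(1)[of x x] by simp
lemma sc_gt: "x < sc x" using sc'(2) .
lemma sc_le: "sc x \<le> x + L" using sc'(3) .
lemma sc_min: "x < y \<Longrightarrow> y < sc x \<Longrightarrow> \<not> R x y" using sc'(4)[of x y x] by simp

lemma sc_eqI: "R x y \<Longrightarrow> x < y \<Longrightarrow> (\<And>z. x < z \<Longrightarrow> z < y \<Longrightarrow> \<not> R x z) \<Longrightarrow> sc x = y"
  using next_in_unique[OF L_pos periodic_class fin_window, of y x x] by simp

lemma sc_period: "sc (x + L) = sc x + L"
  using next_in_period[OF L_pos periodic_class fin_window class_ne, of x x]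
  unfolding class_eq[OF R_period[of x], symmetric] .

lemma sc_int: "sc (x + of_int k * L) = sc x + of_int k * L"
proof (induction k rule: int_induct[where k = 0])
  case base then show ?case by simp
next
  case (step1 i) then show ?case using sc_period[of "x + of_int i * L"] by (simp add: algebra_simps)
next
  case (step2 i) then show ?case using sc_period[of "x + of_int (i - 1) * L"] by (simp add: algebra_simps)
qed

lemma sc_cg: "cg x y \<Longrightarrow> cg (sc x) (sc y)"
  using sc_int cong_per_def by auto

lemma germ_sc: "\<exists>e>0. \<forall>t. 0 \<le> t \<and> t \<le> e \<longrightarrow> R (x + t) (sc x - t)"
proof -
  obtain q e where q: "x < q" "q \<le> x + L" "R x q" "\<And>r. x < r \<Longrightarrow> r < q \<Longrightarrow> \<not> R x r"
    "0 < e" "\<And>t. 0 \<le> t \<Longrightarrow> t \<le> e \<Longrightarrow> R (x + t) (q - t)" using germ[of x] by blast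
  have "sc x = q" by (rule sc_eqI[OF q(3,1)]) (rule q(4))
  then show ?thesis using q by blast
qed

lemma germ_sc': "0 < c \<Longrightarrow> \<exists>e>0. e \<le> c \<and> (\<forall>t. 0 \<le> t \<and> t \<le> e \<longrightarrow> R (x + t) (sc x - t))"
proof -
  assume c: "0 < c"
  obtain e where e: "e > 0" "\<And>t. 0 \<le> t \<Longrightarrow> t \<le> e \<Longrightarrow> R (x + t) (sc x - t)" using germ_sc[of x] by blast
  show ?thesis by (rule exI[of _ "min e c"]) (use c e in auto)
qed

lemma pred_exists: obtains z where "sc z = x"
proof -
  let ?C = "{y. R x y} \<inter> {x - L..<x - L + L}"
  have fin: "finite ?C" by (rule fin_window)
  have "x - L \<in> ?C" using cg_R[of x "x - L"] L_pos by simp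
  then have ne: "?C \<noteq> {}" by blast
  define z where "z = Max ?C"
  have z: "z \<in> ?C" unfolding z_def using fin ne Max_in by blast
  have "sc z = x"
  proof (rule sc_eqI)
    have "R x z" using z by simp
    then show "R z x" by (rule R_sym)
    show "z < x" using z by simp
    fix w assume w: "z < w" "w < x"
    show "\<not> R z w"
    proof
      assume "R z w"
      then have "R x w" using z R_trans[of x z w] by blast
      then have "w \<in> ?C" using z w by auto
      then have "w \<le> z" unfolding z_def using fin by (rule Max_ge[rotated])
      then show False using w by simp
    qed
  qed
  then show thesis using that by blast
qed

lemma class_size_pos: "size_of x \<ge> 1"
proof -
  have "x \<in> {y. R x y} \<inter> {x..<x + L}" using R_refl L_pos by simp
  then have "card ({y. R x y} \<inter> {x..<x + L}) \<noteq> 0"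
    unfolding card_eq_0_iff using fin_window[of x x] by blast
  then show ?thesis using class_size_window[of x x] by simp
qed

lemma window_class: "R x y \<Longrightarrow> window L a y \<in> {y. R x y} \<inter> {a..<a + L}"
  using window_in[OF L_pos, of a y] window_mem[OF periodic_class, of a y x] by simp

lemma class_size_1: assumes "size_of x = 1" "R x y" shows "cg x y"
proof -
  have "card ({y. R x y} \<inter> {0..<L}) = 1" using assms class_size_def by simp
  then obtain w where w: "{y. R x y} \<inter> {0..<L} = {w}" using card_1_singletonE by blast
  have "window L 0 x = window L 0 y"
    using window_class[OF R_refl, of 0 x] window_class[OF assms(2), of 0] w by simp
  then show ?thesis using window_eq_iff[OF L_pos] by blast
qed

lemma class_size_1I: assumes "\<And>y. R x y \<Longrightarrow> cg x y" shows "size_of x = 1"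
proof -
  have "{y. R x y} \<inter> {x..<x + L} = {x}"
  proof (intro subset_antisym subsetI)
    fix y assume y: "y \<in> {y. R x y} \<inter> {x..<x + L}"
    then have "x = y" using cong_per_close_eq[OF L_pos assms, of y] by auto
    then show "y \<in> {x}" by simp
  qed (use R_refl L_pos in auto)
  then show ?thesis using class_size_window[of x x] by simp
qed

lemma class_size_2: assumes "size_of x = 2" "R x y" "\<not> cg x y" "R x z" shows "cg x z \<or> cg y z"
proof (rule ccontr)
  assume n: "\<not> (cg x z \<or> cg y z)"
  have "{window L 0 x, window L 0 y, window L 0 z} \<subseteq> {y. R x y} \<inter> {0..<L}"
    using window_class[OF R_refl, of 0 x] window_class[OF assms(2), of 0] window_class[OF assms(4), of 0] by simp
  then have "card {window L 0 x, window L 0 y, window L 0 z} \<le> 2"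
    using card_mono[OF fin_class] assms(1) unfolding class_size_def by metis
  moreover have "window L 0 x \<noteq> window L 0 y" "window L 0 x \<noteq> window L 0 z" "window L 0 y \<noteq> window L 0 z"
    using window_eq_iff[OF L_pos] n assms(3) by blast+
  ultimately show False by simp
qed

lemma class_size_ge2I: assumes "R x y" "\<not> cg x y" shows "size_of x \<ge> 2"
  using class_size_1[OF _ assms(1)] class_size_pos[of x] assms(2) by (cases "size_of x = 1") auto

lemma sc_self: "cg x (sc x) \<longleftrightarrow> size_of x = 1"
proof
  assume "cg x (sc x)"
  then have e: "sc x = x + L" using cong_per_L_ge[OF L_pos _ sc_gt, of x] sc_le[of x] by force
  show "size_of x = 1"
  proof (rule class_size_1I)
    fix y assume y: "R x y"
    have "R x (window L x y)" using y window_mem[OF periodic_class] by auto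
    then have "\<not> (x < window L x y)" using sc_min[of x "window L x y"] e window_less[OF L_pos, of x y] by auto
    then have "window L x y = x" using window_ge[OF L_pos, of x y] by simp
    then show "cg x y" using cong_per_sym[OF window_cong_per[of L y x]] by simp
  qed
next
  assume "size_of x = 1" then show "cg x (sc x)" using class_size_1 sc_R by blast
qed

lemma sc_leaf: "size_of x = 1 \<Longrightarrow> sc x = x + L"
  using sc_self[of x] cong_per_L_ge[OF L_pos _ sc_gt, of x] sc_le[of x] by force

lemma sc_sc2: assumes "size_of x = 2" shows "cg (sc (sc x)) x"
proof -
  have n1: "\<not> cg x (sc x)" using sc_self assms by simp
  have n2: "\<not> cg (sc x) (sc (sc x))" using sc_self class_size_R[OF sc_R, of x] assms by simp
  have "R x (sc (sc x))" by (rule R_trans[OF sc_R sc_R])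
  from class_size_2[OF assms sc_R n1 this] show ?thesis using n2 cong_per_sym by blast
qed

text \<open>The side to the left of \<open>x + t\<close> stays glued to the side to the right of \<open>sc x - t\<close>
  until the first point whose class is not a pair.\<close>

lemma propagate_pred:
  assumes "\<And>t. 0 < t \<Longrightarrow> t < d \<Longrightarrow> size_of (x + t) = 2" "0 < t" "t \<le> d"
  shows "cg (sc (sc x - t)) (x + t)"
proof (rule ccontr)
  \<comment> \<open>\<open>P t\<close> says that the gluing has kept pace up to t: the successor of
    the point at distance t before \<open>sc x\<close> is the point at distance t after x.\<close>
  define P where "P t \<longleftrightarrow> cg (sc (sc x - t)) (x + t)" for t
  assume neg: "\<not> ?thesis"
  define B where "B = {t. 0 < t \<and> t \<le> d \<and> \<not> P t}"
  have tB: "t \<in> B" using assms neg by (simp add: B_def P_def)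
  have bdd: "bdd_below B" unfolding B_def by (rule bdd_belowI[of _ 0]) auto
  define T where "T = Inf B"
  have Tt: "T \<le> t" unfolding T_def using cInf_lower[OF tB bdd] .
  have below: "P s" if "0 < s" "s < T" for s
  proof (rule ccontr)
    assume "\<not> P s"
    then have "s \<in> B" using that Tt assms(3) by (simp add: B_def)
    then show False using cInf_lower[OF _ bdd, of s] that unfolding T_def by simp
  qed
  \<comment> \<open>Openness: if \<open>sc x - u\<close> is the successor of x + u, the germ at x +
    u carries \<open>P\<close> a little beyond u. For u = 0 the premise is trivial, so the class of
    x itself may be special.\<close>
  have step: "\<exists>e>0. \<forall>s. u < s \<and> s < u + e \<and> s < d \<longrightarrow> P s"
    if u: "0 \<le> u" "u < d" "cg (sc x - u) (sc (x + u))" for u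
  proof -
    have ne: "sc (x + u) - (x + u) > 0" using sc_gt by simp
    obtain e where e: "e > 0" "e \<le> (sc (x + u) - (x + u)) / 4"
        "\<And>t. 0 \<le> t \<Longrightarrow> t \<le> e \<Longrightarrow> R (x + u + t) (sc (x + u) - t)"
      using germ_sc'[of "(sc (x + u) - (x + u)) / 4" "x + u"] ne by auto
    have "P s" if s: "u < s" "s < u + e" "s < d" for s
    proof -
      define t where "t = s - u"
      have t: "0 < t" "t \<le> e" using s by (auto simp: t_def)
      have s2: "size_of (x + s) = 2" using assms(1)[of s] s u by simp
      have Rt: "R (x + s) (sc (x + u) - t)" using e(3)[of t] t by (simp add: t_def)
      have nc: "\<not> cg (x + s) (sc (x + u) - t)"
      proof
        assume c: "cg (x + s) (sc (x + u) - t)"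
        have "x + s < sc (x + u) - t" using t e(2) ne by (simp add: t_def)
        moreover have "sc (x + u) - t < x + s + L" using sc_le[of "x + u"] t s by (simp add: t_def)
        ultimately show False using cong_per_L_ge[OF L_pos c] by simp
      qed
      define w where "w = sc (x + u) - t"
      have sw: "size_of w = 2" using class_size_R[OF Rt] s2 by (simp add: w_def)
      have Rt': "R w (x + s)" using R_sym[OF Rt] by (simp add: w_def)
      have "\<not> cg w (x + s)" using nc cong_per_sym unfolding w_def by blast
      then have "cg w (sc w) \<or> cg (x + s) (sc w)" using class_size_2[OF sw Rt' _ sc_R] by blast
      then have "cg (sc w) (x + s)" using sc_self[of w] sw cong_per_sym[of L "x + s" "sc w"] cong_per_sym[of L "sc w" "x + s"] by auto
      moreover have "cg w (sc x - s)"
        using cong_per_add_right[OF cong_per_sym[OF u(3)], of "-t"] by (simp add: w_def t_def algebra_simps)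
      ultimately have "cg (sc (sc x - s)) (x + s)"
        using sc_cg[of w "sc x - s"] cong_per_sym cong_per_trans by blast
      then show ?thesis by (simp add: P_def)
    qed
    then show ?thesis using e(1) by blast
  qed
  have d: "d > 0" using assms by simp
  have Tpos: "T > 0"
  proof -
    obtain e where e: "e > 0" "\<And>s. 0 < s \<Longrightarrow> s < e \<Longrightarrow> s < d \<Longrightarrow> P s"
      using step[of 0] d by auto
    have "min e d \<le> T" unfolding T_def
    proof (rule cInf_greatest)
      show "B \<noteq> {}" using tB by blast
      fix s assume "s \<in> B"
      then show "min e d \<le> s" using e(2)[of s] unfolding B_def by force
    qed
    then show ?thesis using e(1) d by linarith
  qed
  \<comment> \<open>Closedness: let z be the predecessor of x + T. For small t the germ at z glues x
    + T - t to z + t, and \<open>P (T - t)\<close> glues it to \<open>sc x - (T - t)\<close>. The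
    class is a pair, so the two partners agree.\<close>
  have PT: "P T"
  proof -
    obtain z where z: "sc z = x + T" using pred_exists by blast
    have ne: "x + T - z > 0" using z sc_gt[of z] by simp
    obtain e where e: "e > 0" "e \<le> min T ((x + T - z) / 4)"
        "\<And>t. 0 \<le> t \<Longrightarrow> t \<le> e \<Longrightarrow> R (z + t) (x + T - t)"
      using germ_sc'[of "min T ((x + T - z) / 4)" z] ne Tpos z by auto
    define t where "t = e / 2"
    have t: "0 < t" "t \<le> e" "t < T" "t \<le> (x + T - z) / 4" using e by (auto simp: t_def)
    have pt: "cg (sc (sc x - (T - t))) (x + (T - t))" using below[of "T - t"] t by (simp add: P_def)
    have s2: "size_of (x + T - t) = 2" using assms(1)[of "T - t"] t Tt assms(3) by (simp add: algebra_simps)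
    define w where "w = sc x - (T - t)"
    have pt': "cg (sc w) (x + T - t)" using pt by (simp add: w_def algebra_simps)
    have Rw: "R (x + T - t) w" using R_sym[OF R_trans[OF sc_R[of w] cg_R[OF pt']]] .
    have "\<not> cg w (x + T - t)"
    proof
      assume "cg w (x + T - t)"
      then have "cg w (sc w)" using cong_per_trans[OF _ cong_per_sym[OF pt']] by blast
      then show False using sc_self[of w] class_size_R[OF Rw] s2 by simp
    qed
    moreover have "\<not> cg (x + T - t) (z + t)"
    proof
      assume "cg (x + T - t) (z + t)"
      then have c: "cg (z + t) (x + T - t)" by (rule cong_per_sym)
      have "z + t < x + T - t" using t ne by simp
      moreover have "x + T - t < z + t + L" using z sc_le[of z] t by simp
      ultimately show False using cong_per_L_ge[OF L_pos c] by simp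
    qed
    ultimately have "cg w (z + t)"
      using class_size_2[OF s2 Rw _ R_sym[OF e(3)[of t]]] t cong_per_sym[of L "x + T - t" w] by auto
    then have "cg (sc x - T) z" using cong_per_add_right[of L w "z + t" "-t"] by (simp add: w_def)
    then show ?thesis using sc_cg[of "sc x - T" z] z by (simp add: P_def)
  qed
  show False
  proof (cases "T < d")
    case False
    then have "T = t" using Tt assms(3) by simp
    then show False using PT tB by (simp add: B_def)
  next
    case True
    have s2: "size_of (x + T) = 2" using assms(1) Tpos True by simp
    have "R (sc x - T) (x + T)" using PT sc_R[of "sc x - T"] cg_R R_trans unfolding P_def by blast
    then have s2': "size_of (sc x - T) = 2" using class_size_R s2 by metis
    \<comment> \<open>On pairs \<open>sc\<close> is an involution modulo L; this turns
      \<open>P T\<close> into the premise of \<open>step\<close> at T.\<close>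
    have "cg (sc (x + T)) (sc (sc (sc x - T)))" using PT sc_cg cong_per_sym unfolding P_def by blast
    then have "cg (sc x - T) (sc (x + T))" using sc_sc2[OF s2'] cong_per_sym cong_per_trans by blast
    then obtain e where e: "e > 0" "\<And>s. T < s \<Longrightarrow> s < T + e \<Longrightarrow> s < d \<Longrightarrow> P s"
      using step[of T] True Tpos by auto
    have "min (T + e) d \<le> Inf B"
    proof (rule cInf_greatest)
      show "B \<noteq> {}" using tB by blast
      fix s assume s: "s \<in> B"
      then have "s \<ge> T" using cInf_lower[OF _ bdd, of s] unfolding T_def by simp
      moreover have "s \<noteq> T" using s PT by (auto simp: B_def)
      ultimately have "T < s" by simp
      moreover have "s \<le> d" "\<not> P s" using s by (auto simp: B_def)
      ultimately have "T + e \<le> s \<or> s = d" using e(2)[of s] by linarith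
      then show "min (T + e) d \<le> s" by auto
    qed
    then show False using e(1) True T_def by linarith
  qed
qed

lemma propagate:
  assumes "\<And>t. 0 < t \<Longrightarrow> t < d \<Longrightarrow> size_of (x + t) = 2" "0 \<le> t" "t \<le> d"
  shows "R (x + t) (sc x - t)"
proof (cases "t = 0")
  case True then show ?thesis using sc_R[of x] by simp
next
  case False
  then have t: "0 < t" using assms(2) by simp
  have "cg (sc (sc x - t)) (x + t)" by (rule propagate_pred[OF assms(1) t assms(3)])
  then have "R (sc (sc x - t)) (x + t)" by (rule cg_R)
  then show ?thesis using R_sym[OF R_trans[OF sc_R[of "sc x - t"]]] by blast
qed

end

section \<open>Euler's formula for circle gluings\<close>

context circle_gluing begin

text \<open>Passes from sums over points to sums over classes without choosing representatives: a
  class C is met |C| times, each time with weight 1 / |C|.\<close>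

lemma sum_class_average:
  assumes "\<And>x y. x \<in> X \<Longrightarrow> R x y \<Longrightarrow> y \<in> X" "finite (X \<inter> {0..<L})"
  shows "(\<Sum>x\<in>X \<inter> {0..<L}. (\<Sum>y\<in>{y. R x y} \<inter> {0..<L}. g y) / real (size_of x)) = sum g (X \<inter> {0..<L})"
proof -
  let ?X = "X \<inter> {0..<L}"
  have "(\<Sum>x\<in>?X. (\<Sum>y\<in>{y. R x y} \<inter> {0..<L}. g y) / real (size_of x)) =
        (\<Sum>x\<in>?X. \<Sum>y\<in>?X. if R x y then g y / real (size_of y) else 0)"
  proof (rule sum.cong[OF refl])
    fix x assume x: "x \<in> ?X"
    have eq: "{y. R x y} \<inter> {0..<L} = {y \<in> ?X. R x y}" using x assms(1) by blast
    have "(\<Sum>y\<in>{y. R x y} \<inter> {0..<L}. g y) / real (size_of x) = (\<Sum>y\<in>{y\<in>?X. R x y}. g y / real (size_of x))"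
      unfolding eq by (rule sum_divide_distrib)
    also have "\<dots> = (\<Sum>y\<in>{y\<in>?X. R x y}. g y / real (size_of y))"
      by (rule sum.cong[OF refl]) (auto dest: class_size_R)
    also have "\<dots> = (\<Sum>y\<in>?X. if R x y then g y / real (size_of y) else 0)"
      using assms(2) by (rule sum.inter_filter)
    finally show "(\<Sum>y\<in>{y. R x y} \<inter> {0..<L}. g y) / real (size_of x) =
        (\<Sum>y\<in>?X. if R x y then g y / real (size_of y) else 0)" .
  qed
  also have "\<dots> = (\<Sum>y\<in>?X. \<Sum>x\<in>?X. if R x y then g y / real (size_of y) else 0)"
    by (rule sum.swap)
  also have "\<dots> = sum g ?X"
  proof (rule sum.cong[OF refl])
    fix y assume y: "y \<in> ?X"
    have eq: "{x \<in> ?X. R x y} = {z. R y z} \<inter> {0..<L}" using y assms(1) R_sym by blast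
    have "(\<Sum>x\<in>?X. if R x y then g y / real (size_of y) else 0) = (\<Sum>x\<in>{x\<in>?X. R x y}. g y / real (size_of y))"
      using assms(2) by (rule sum.inter_filter[symmetric])
    also have "\<dots> = real (size_of y) * (g y / real (size_of y))" unfolding eq by (simp add: class_size_def)
    also have "\<dots> = g y" using class_size_pos[of y] by simp
    finally show "(\<Sum>x\<in>?X. if R x y then g y / real (size_of y) else 0) = g y" .
  qed
  finally show ?thesis .
qed

lemma sum_class_gaps: "(\<Sum>y\<in>{y. R x y} \<inter> {0..<L}. sc y - y) = L"
proof -
  have "(\<Sum>y\<in>{y. R x y} \<inter> {0..<L}. sc y - y) = (\<Sum>y\<in>{y. R x y} \<inter> {0..<0 + L}. next_in L {y. R x y} y - y)"
  proof (rule sum.cong)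
    fix y assume "y \<in> {y. R x y} \<inter> {0..<0 + L}"
    then have "{z. R y z} = {z. R x z}" using class_eq[of x y] by simp
    then show "sc y - y = next_in L {y. R x y} y - y" by simp
  qed simp
  then show ?thesis using sum_gaps[OF L_pos periodic_class fin_window class_ne, of x 0] by simp
qed

text \<open>Write \<open>g x\<close> for the gap \<open>sc x - x\<close> and \<open>d x\<close> for the distance from \<open>x\<close> to the next
  point of \<open>X\<close>.  The side after \<open>x\<close> is glued to the side after \<open>z = sc x - d x\<close>, the map
  \<open>x \<mapsto> z\<close> is an involution modulo \<open>L\<close>, and \<open>g x + g z = L + 2 d x\<close>.\<close>

lemma euler:
  assumes X: "periodic L X" "\<And>x y. x \<in> X \<Longrightarrow> R x y \<Longrightarrow> y \<in> X" "\<And>x. size_of x \<noteq> 2 \<Longrightarrow> x \<in> X"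
    "finite (X \<inter> {0..<L})" "X \<noteq> {}"
  shows "(\<Sum>x\<in>X \<inter> {0..<L}. 2 / real (size_of x) - 1) = 2"
proof -
  let ?X = "X \<inter> {0..<L}"
  have fX: "finite (X \<inter> {0..<0 + L})" using X(4) by simp
  note n = next_in[OF L_pos X(1) fX X(5)]
  define d where "d x = next_in L X x - x" for x
  define z where "z x = sc x - d x" for x
  have dpos: "d x > 0" for x using n(2) by (simp add: d_def)
  have pair: "size_of (x + t) = 2" if "0 < t" "t < d x" for x t
  proof (rule ccontr)
    assume "size_of (x + t) \<noteq> 2"
    then have "x + t \<in> X" by (rule X(3))
    then show False using n(4)[of x "x + t"] that by (simp add: d_def)
  qed
  have glue: "R (x + t) (sc x - t)" if "0 \<le> t" "t \<le> d x" for x t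
    by (rule propagate[of "d x"], rule pair) (use that in simp_all)
  have key: "z x \<in> X \<and> sc (z x) = x + d x + L \<and> d (z x) = d x" if x: "x \<in> X" for x
  proof -
    have nX: "x + d x \<in> X" using n(1) by (simp add: d_def)
    have zX: "z x \<in> X" using X(2)[OF nX] glue[of "d x" x] dpos[of x] by (simp add: z_def)
    have "sc x \<in> X" using X(2)[OF x sc_R] .
    then have "\<not> sc x < x + d x" using n(4)[of x "sc x"] sc_gt[of x] by (auto simp: d_def)
    then have zx: "z x \<ge> x" by (simp add: z_def)
    \<comment> \<open>Otherwise the free interval after x would be folded at its midpoint, and the
      midpoint would be a leaf although its class is a pair.\<close>
    have "z x \<noteq> x"
    proof
      assume "z x = x"
      then have e: "sc x - d x / 2 = x + d x / 2" by (simp add: z_def algebra_simps)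
      have "cg (sc (sc x - d x / 2)) (x + d x / 2)"
        by (rule propagate_pred[of "d x" x "d x / 2"], rule pair) (use dpos[of x] in simp_all)
      then have "cg (x + d x / 2) (sc (x + d x / 2))" unfolding e by (rule cong_per_sym)
      then have "size_of (x + d x / 2) = 1" by (simp only: sc_self)
      then show False using pair[of "d x / 2" x] dpos[of x] by simp
    qed
    then have "x < z x" using zx by simp
    then have "\<not> z x < x + d x" using zX n(4)[of x "z x"] by (auto simp: d_def)
    then have "z x \<ge> x + d x" by simp
    moreover have "z x < x + d x + L" using sc_le[of x] dpos[of x] by (simp add: z_def)
    moreover have c: "cg (sc (z x)) (x + d x + L)"
    proof -
      have "cg (sc (z x)) (x + d x)" unfolding z_def
        by (rule propagate_pred[of "d x" x "d x"], rule pair) (use dpos[of x] in simp_all)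
      then show ?thesis by (rule cong_per_trans[OF _ cong_per_plus_period])
    qed
    moreover have "sc (z x) = x + d x + L"
    proof (rule cong_per_close_eq[OF L_pos c])
      show "\<bar>sc (z x) - (x + d x + L)\<bar> < L"
        using \<open>z x \<ge> x + d x\<close> \<open>z x < x + d x + L\<close> sc_gt[of "z x"] sc_le[of "z x"] by linarith
    qed
    ultimately have class_size: "sc (z x) = x + d x + L" by blast
    have "next_in L X (z x) = sc x"
    proof (rule next_in_unique[OF L_pos X(1) fX])
      show "sc x \<in> X" by fact
      show "z x < sc x" using dpos[of x] by (simp add: z_def)
      fix w assume w: "z x < w" "w < sc x"
      show "w \<notin> X"
      proof
        assume wX: "w \<in> X"
        have t: "0 < sc x - w" "sc x - w < d x" using w by (auto simp: z_def)
        have "R w (x + (sc x - w))" by (rule R_sym) (use glue[of "sc x - w" x] t in simp)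
        then have "x + (sc x - w) \<in> X" using X(2)[OF wX] by blast
        then show False using n(4)[of x "x + (sc x - w)"] t by (simp add: d_def)
      qed
    qed
    then show ?thesis using zX class_size by (simp add: d_def z_def)
  qed
  define h where "h x = window L 0 (z x)" for x
  have z_int: "z (x + of_int k * L) = z x + of_int k * L" for x k
  proof -
    have "next_in L X (x + of_int k * L) = next_in L X x + of_int k * L" for k
    proof (induction k rule: int_induct[where k = 0])
      case base then show ?case by simp
    next
      case (step1 i)
      then show ?case using next_in_period[OF L_pos X(1) fX X(5), of "x + of_int i * L"] by (simp add: algebra_simps)
    next
      case (step2 i)
      then show ?case using next_in_period[OF L_pos X(1) fX X(5), of "x + of_int (i - 1) * L"] by (simp add: algebra_simps)
    qed
    then show ?thesis using sc_int[of x k] by (simp add: z_def d_def)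
  qed
  have zcg: "cg (z x) (z y)" if c: "cg x y" for x y
  proof -
    obtain k where "y = x + of_int k * L" using c unfolding cong_per_def by blast
    then show ?thesis using z_int[of x k] unfolding cong_per_def by blast
  qed
  have gcg: "sc x - x = sc y - y" if c: "cg x y" for x y
  proof -
    obtain k where "y = x + of_int k * L" using c unfolding cong_per_def by blast
    then show ?thesis using sc_int[of x k] by simp
  qed
  have hX: "h x \<in> ?X" if "x \<in> ?X" for x
    using key[of x] that window_mem[OF X(1), of 0 "z x"] window_in[OF L_pos, of 0 "z x"] by (auto simp: h_def)
  have hh: "h (h x) = x" if x: "x \<in> ?X" for x
  proof -
    have "z (z x) = x + L" using key[of x] x by (simp add: z_def[of "z x"])
    then have "cg (z (z x)) x" using cong_per_sym[OF cong_per_plus_period] by simp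
    moreover have "cg (z (h x)) (z (z x))" unfolding h_def by (rule zcg[OF cong_per_sym[OF window_cong_per]])
    ultimately have "cg (z (h x)) x" using cong_per_trans by blast
    then have "h (h x) = window L 0 x" unfolding h_def[of "h x"] using window_eq_iff[OF L_pos] by blast
    then show ?thesis using window_id[OF L_pos, of 0 x] x by simp
  qed
  define g where "g x = sc x - x" for x
  have gh: "g x + g (h x) = L + 2 * d x" if x: "x \<in> ?X" for x
  proof -
    have "g (h x) = g (z x)" unfolding g_def h_def by (rule gcg[OF cong_per_sym[OF window_cong_per]])
    then show ?thesis using key[of x] x by (simp add: g_def) (simp add: z_def)
  qed
  have sgh: "(\<Sum>x\<in>?X. g (h x)) = sum g ?X"
    by (rule sum.reindex_bij_witness[where i = h and j = h]) (simp_all only: hX hh)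
  \<comment> \<open>The gaps are summed in two ways: along the involution here, and class by class
    below, where the gaps of one class go once around the circle.\<close>
  have "2 * sum g ?X = (\<Sum>x\<in>?X. g x + g (h x))" using sgh by (simp add: sum.distrib)
  also have "\<dots> = (\<Sum>x\<in>?X. L + 2 * d x)" using gh by (intro sum.cong) auto
  also have "\<dots> = real (card ?X) * L + 2 * sum d ?X" by (simp add: sum.distrib sum_distrib_left)
  also have "sum d ?X = L" using sum_gaps[OF L_pos X(1) fX X(5)] by (simp add: d_def)
  finally have 1: "2 * sum g ?X = real (card ?X) * L + 2 * L" .
  have "sum g ?X = (\<Sum>x\<in>?X. (\<Sum>y\<in>{y. R x y} \<inter> {0..<L}. g y) / real (size_of x))"
    by (rule sum_class_average[OF X(2,4), symmetric])
  also have "\<dots> = (\<Sum>x\<in>?X. L / real (size_of x))" unfolding g_def sum_class_gaps ..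
  finally have "2 * sum g ?X = L * (\<Sum>x\<in>?X. 2 / real (size_of x))"
    by (simp add: sum_distrib_left mult.commute)
  then have "L * (\<Sum>x\<in>?X. 2 / real (size_of x)) = L * (real (card ?X) + 2)" using 1 by (simp add: algebra_simps)
  then have "(\<Sum>x\<in>?X. 2 / real (size_of x)) = real (card ?X) + 2" using L_pos by simp
  then show ?thesis by (simp add: sum_subtractf)
qed

end

section \<open>Leaves, junctions and branches\<close>

definition leaves :: "real \<Rightarrow> (real \<Rightarrow> real \<Rightarrow> bool) \<Rightarrow> real set" where
  "leaves L R = {x. class_size L R x = 1} \<inter> {0..<L}"

text \<open>A pendant edge of the tree, seen on the circle: the arc [a, b] folds at its midpoint,
  the leaf, and its ends are two points of one junction. The condition b < a + L keeps the ends
  distinct on the circle.\<close>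

definition branch :: "real \<Rightarrow> (real \<Rightarrow> real \<Rightarrow> bool) \<Rightarrow> real \<Rightarrow> real \<Rightarrow> bool" where
  "branch L R a b \<longleftrightarrow> a < b \<and> b < a + L \<and> class_size L R a \<ge> 3 \<and> class_size L R ((a + b) / 2) = 1 \<and>
     (\<forall>x. a < x \<and> x < b \<and> x \<noteq> (a + b) / 2 \<longrightarrow> class_size L R x = 2) \<and>
     (\<forall>x. a \<le> x \<and> x \<le> b \<longrightarrow> R x (a + b - x))"

context circle_gluing begin

lemma class_size_cg: "cg x y \<Longrightarrow> size_of x = size_of y"
  using class_size_R cg_R by blast

lemma periodic_size: "periodic L {x. P (size_of x)}"
  unfolding periodic_def using class_size_cg[OF cong_per_plus_period] by simp

lemma finite_leaves [simp]: "finite (leaves L R)"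
  unfolding leaves_def by (rule finite_subset[OF _ fin_special]) auto

lemma finite_junctions: "finite ({x. size_of x \<ge> 3} \<inter> {0..<L})"
  by (rule finite_subset[OF _ fin_special]) auto

text \<open>In Euler's formula pairs contribute 0 and leaves 1 each. The terms of one junction C add
  up to |C| - 2, so the junctions pay for all leaves beyond the second.\<close>

lemma junction_sum:
  "(\<Sum>x\<in>{x. size_of x \<ge> 3} \<inter> {0..<L}. 1 - 2 / real (size_of x)) = real (card (leaves L R)) - 2"
proof -
  \<comment> \<open>The class of 0 makes the set nonempty, as \<open>euler\<close> requires; if that
    class is a pair, it contributes 0.\<close>
  define X where "X = {x. size_of x \<noteq> 2} \<union> {y. R 0 y}"
  define J where "J = {x. size_of x \<ge> 3} \<inter> {0..<L}"
  have fJ: "finite J" using finite_junctions by (simp add: J_def)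
  have fX: "finite (X \<inter> {0..<L})"
    using fin_special fin_class[of 0] by (simp add: X_def Int_Un_distrib2)
  have pX: "periodic L X"
    using periodic_size[of "\<lambda>n. n \<noteq> 2"] periodic_class[of 0] unfolding periodic_def X_def by blast
  have cX: "y \<in> X" if "x \<in> X" "R x y" for x y
    using that class_size_R[OF that(2)] R_trans[of 0 x y] unfolding X_def by auto
  have "(\<Sum>x\<in>X \<inter> {0..<L}. 2 / real (size_of x) - 1) = 2"
    by (rule euler[OF pX cX _ fX]) (use R_refl[of 0] in \<open>auto simp: X_def\<close>)
  moreover have "(\<Sum>x\<in>X \<inter> {0..<L}. 2 / real (size_of x) - 1) =
      (\<Sum>x\<in>leaves L R \<union> J. 2 / real (size_of x) - 1)"
  proof (rule sum.mono_neutral_right[OF fX])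
    show "leaves L R \<union> J \<subseteq> X \<inter> {0..<L}" by (auto simp: leaves_def J_def X_def)
    show "\<forall>i\<in>X \<inter> {0..<L} - (leaves L R \<union> J). 2 / real (size_of i) - 1 = 0"
    proof
      fix i assume i: "i \<in> X \<inter> {0..<L} - (leaves L R \<union> J)"
      then have "size_of i = 2" using class_size_pos[of i] unfolding leaves_def J_def by fastforce
      then show "2 / real (size_of i) - 1 = 0" by simp
    qed
  qed
  moreover have "\<dots> = (\<Sum>x\<in>leaves L R. 2 / real (size_of x) - 1) + (\<Sum>x\<in>J. 2 / real (size_of x) - 1)"
    by (rule sum.union_disjoint[OF finite_leaves fJ]) (auto simp: leaves_def J_def)
  moreover have "(\<Sum>x\<in>leaves L R. 2 / real (size_of x) - 1) = real (card (leaves L R))"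
    by (simp add: leaves_def)
  moreover have "(\<Sum>x\<in>J. 1 - 2 / real (size_of x)) = - (\<Sum>x\<in>J. 2 / real (size_of x) - 1)"
    by (simp add: sum_negf[symmetric])
  ultimately show ?thesis unfolding J_def by linarith
qed

lemma card_leaves_ge: "card (leaves L R) \<ge> 2"
proof -
  have "(\<Sum>x\<in>{x. size_of x \<ge> 3} \<inter> {0..<L}. 1 - 2 / real (size_of x)) \<ge> 0"
    by (rule sum_nonneg) auto
  then show ?thesis using junction_sum by simp
qed

lemma size_le_2_of_two_leaves:
  assumes "card (leaves L R) = 2" shows "size_of x \<le> 2"
proof (rule ccontr)
  assume n: "\<not> size_of x \<le> 2"
  let ?J = "{x. size_of x \<ge> 3} \<inter> {0..<L}"
  have "size_of (window L 0 x) = size_of x" by (rule class_size_cg[OF cong_per_sym[OF window_cong_per]])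
  then have x: "window L 0 x \<in> ?J" using n window_in[OF L_pos, of 0 x] by simp
  have "0 < (\<Sum>x\<in>?J. 1 - 2 / real (size_of x))"
    by (rule sum_pos[OF finite_junctions]) (use x in auto)
  then show False using junction_sum assms by simp
qed

text \<open>The two sides of a leaf are glued to each other up to the first point whose class is not
  a pair. They meet after L / 2 at the latest: otherwise the point opposite to the leaf would be
  glued to itself within the free stretch.\<close>

lemma leaf_fold:
  assumes y: "size_of y = 1"
  obtains \<rho> where "\<rho> > 0" "2 * \<rho> \<le> L" "size_of (y + \<rho>) \<noteq> 2"
    "\<And>t. 0 < t \<Longrightarrow> t < \<rho> \<Longrightarrow> size_of (y + t) = 2" "\<And>t. 0 \<le> t \<Longrightarrow> t \<le> \<rho> \<Longrightarrow> R (y + t) (y - t)"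
proof -
  define X where "X = {x. size_of x \<noteq> 2}"
  have f: "finite (X \<inter> {0..<0 + L})" using fin_special by (simp add: X_def)
  have pX: "periodic L X" unfolding X_def by (rule periodic_size)
  have ne: "X \<noteq> {}" using y by (auto simp: X_def intro!: exI[of _ y])
  note n = next_in[OF L_pos pX f ne, of y]
  define \<rho> where "\<rho> = next_in L X y - y"
  have r0: "\<rho> > 0" using n by (simp add: \<rho>_def)
  have sp: "size_of (y + \<rho>) \<noteq> 2" using n(1) by (simp add: \<rho>_def X_def)
  have pr: "size_of (y + t) = 2" if "0 < t" "t < \<rho>" for t
  proof (rule ccontr)
    assume "size_of (y + t) \<noteq> 2"
    then have "y + t \<in> X" by (simp add: X_def)
    then show False using n(4)[of "y + t"] that by (simp add: \<rho>_def)
  qed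
  have sy: "sc y = y + L" by (rule sc_leaf[OF y])
  have gl: "R (y + t) (y - t)" if "0 \<le> t" "t \<le> \<rho>" for t
  proof -
    have "R (y + t) (y + L - t)" using propagate[of \<rho> y t, OF pr that] sy by simp
    moreover have "cg (y + L - t) (y - t)" using cong_per_minus_period[of L "y + L - t"] by simp
    ultimately show ?thesis using R_cg cong_per_refl by blast
  qed
  have "2 * \<rho> \<le> L"
  proof (rule ccontr)
    assume c: "\<not> 2 * \<rho> \<le> L"
    have e: "y + L - L / 2 = y + L / 2" by simp
    have "cg (sc (sc y - L / 2)) (y + L / 2)"
      by (rule propagate_pred[of \<rho>], rule pr) (use c L_pos in auto)
    then have "cg (y + L / 2) (sc (y + L / 2))" unfolding sy e by (rule cong_per_sym)
    then have "size_of (y + L / 2) = 1" by (simp only: sc_self)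
    then show False using pr[of "L / 2"] c L_pos by simp
  qed
  then show thesis using that r0 sp pr gl by blast
qed

text \<open>A fold that uses up the whole circle, 2 \<rho> = L, leaves room for two leaves only.
  With three leaves the fold ends at two distinct glued points whose class is not a pair, hence at a
  junction.\<close>

lemma leaf_branch:
  assumes y: "size_of y = 1" and l: "card (leaves L R) \<ge> 3"
  obtains \<rho> where "\<rho> > 0" "branch L R (y - \<rho>) (y + \<rho>)"
proof -
  obtain \<rho> where r: "\<rho> > 0" "2 * \<rho> \<le> L" "size_of (y + \<rho>) \<noteq> 2"
    "\<And>t. 0 < t \<Longrightarrow> t < \<rho> \<Longrightarrow> size_of (y + t) = 2" "\<And>t. 0 \<le> t \<Longrightarrow> t \<le> \<rho> \<Longrightarrow> R (y + t) (y - t)"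
    using leaf_fold[OF y] by blast
  have gl: "R x (2 * y - x)" if "y - \<rho> \<le> x" "x \<le> y + \<rho>" for x
  proof (cases "x \<ge> y")
    case True then show ?thesis using r(5)[of "x - y"] that by simp
  next
    case False
    then have "R (2 * y - x) x" using r(5)[of "y - x"] that by simp
    then show ?thesis by (rule R_sym)
  qed
  have pr: "size_of x = 2" if "y - \<rho> < x" "x < y + \<rho>" "x \<noteq> y" for x
  proof (cases "x > y")
    case True then show ?thesis using r(4)[of "x - y"] that by simp
  next
    case False
    then have "size_of (2 * y - x) = 2" using r(4)[of "y - x"] that by simp
    then show ?thesis using class_size_R[OF gl[of x]] that by simp
  qed
  have "2 * \<rho> \<noteq> L"
  proof
    assume e: "2 * \<rho> = L"
    have "leaves L R \<subseteq> {window L 0 y, window L 0 (y - \<rho>)}"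
    proof
      fix x assume x: "x \<in> leaves L R"
      define w where "w = window L (y - \<rho>) x"
      have c: "cg x w" unfolding w_def by (rule window_cong_per)
      have "size_of w = 1" using x class_size_cg[OF c] by (simp add: leaves_def)
      then have "w = y \<or> w = y - \<rho>"
        using pr[of w] window_ge[OF L_pos, of "y - \<rho>" x] window_less[OF L_pos, of "y - \<rho>" x] e
        by (fastforce simp: w_def)
      moreover have "x = window L 0 w" using window_id[OF L_pos, of 0 x] x window_eq_iff[OF L_pos, of 0 x w] c
        by (simp add: leaves_def)
      ultimately show "x \<in> {window L 0 y, window L 0 (y - \<rho>)}" by blast
    qed
    then have "card (leaves L R) \<le> card {window L 0 y, window L 0 (y - \<rho>)}" by (intro card_mono) auto
    also have "\<dots> \<le> 2" by (simp add: card_insert_if)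
    finally show False using l by simp
  qed
  then have r2: "2 * \<rho> < L" using r(2) by simp
  have Rab: "R (y - \<rho>) (y + \<rho>)" using gl[of "y - \<rho>"] r(1) by simp
  have "\<not> cg (y - \<rho>) (y + \<rho>)" using cong_per_close_eq[OF L_pos, of "y - \<rho>" "y + \<rho>"] r(1) r2 by auto
  then have "size_of (y - \<rho>) \<ge> 2" by (rule class_size_ge2I[OF Rab])
  moreover have "size_of (y - \<rho>) \<noteq> 2" using r(3) class_size_R[OF Rab] by simp
  ultimately have "size_of (y - \<rho>) \<ge> 3" by simp
  then have "branch L R (y - \<rho>) (y + \<rho>)"
    unfolding branch_def using r(1) r2 y pr gl by auto
  then show thesis using that r(1) by blast
qed

text \<open>Two leaves exclude junctions, so the fold that starts at one leaf can only end at the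
  other one, after exactly L / 2, and it glues the whole circle.\<close>

lemma two_leaves_reflection:
  assumes l: "card (leaves L R) = 2"
  obtains y where "0 \<le> y" "y < L" "\<And>p q. R p q \<longleftrightarrow> cg p q \<or> cg (2 * y - p) q"
proof -
  have "leaves L R \<noteq> {}" using l by auto
  then obtain y where y: "0 \<le> y" "y < L" "size_of y = 1" by (auto simp: leaves_def)
  obtain \<rho> where r: "\<rho> > 0" "2 * \<rho> \<le> L" "size_of (y + \<rho>) \<noteq> 2"
    "\<And>t. 0 \<le> t \<Longrightarrow> t \<le> \<rho> \<Longrightarrow> R (y + t) (y - t)"
    using leaf_fold[OF y(3)] by metis
  have s1: "size_of (y + \<rho>) = 1"
    using r(3) size_le_2_of_two_leaves[OF l, of "y + \<rho>"] class_size_pos[of "y + \<rho>"] by linarith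
  have c: "cg (y - \<rho>) (y + \<rho>)" using cong_per_sym[OF class_size_1[OF s1 r(4)[of \<rho>]]] r(1) by simp
  have e: "2 * \<rho> = L" using cong_per_L_ge[OF L_pos c] r by simp
  have refl: "R p (2 * y - p)" for p
  proof -
    define w where "w = window L (y - \<rho>) p"
    have w: "y - \<rho> \<le> w" "w < y + \<rho>" "cg p w"
      using window_ge[OF L_pos, of "y - \<rho>" p] window_less[OF L_pos, of "y - \<rho>" p] window_cong_per e by (auto simp: w_def)
    have "R w (2 * y - w)"
    proof (cases "w \<ge> y")
      case True then show ?thesis using r(4)[of "w - y"] w by simp
    next
      case False
      then have "R (2 * y - w) w" using r(4)[of "y - w"] w by simp
      then show ?thesis by (rule R_sym)
    qed
    then show ?thesis by (rule R_cg[OF _ cong_per_sym[OF w(3)] cong_per_diff_left[OF cong_per_sym[OF w(3)]]])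
  qed
  have "R p q \<longleftrightarrow> cg p q \<or> cg (2 * y - p) q" for p q
  proof
    assume "cg p q \<or> cg (2 * y - p) q"
    then show "R p q" using cg_R R_cg[OF refl[of p] cong_per_refl] by blast
  next
    assume pq: "R p q"
    show "cg p q \<or> cg (2 * y - p) q"
    proof (cases "cg p (2 * y - p)")
      case False
      then have "size_of p = 2" using class_size_ge2I[OF refl[of p]] size_le_2_of_two_leaves[OF l, of p] by simp
      then show ?thesis using class_size_2[OF _ refl False pq] by blast
    next
      case True
      define w where "w = window L (y - \<rho>) p"
      have w: "y - \<rho> \<le> w" "w < y + \<rho>" "cg p w"
        using window_ge[OF L_pos, of "y - \<rho>" p] window_less[OF L_pos, of "y - \<rho>" p] window_cong_per e by (auto simp: w_def)
      have cw: "cg w (2 * y - w)"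
        using cong_per_trans[OF cong_per_trans[OF cong_per_sym[OF w(3)] True] cong_per_diff_left[OF w(3)]] .
      have "w = y \<or> w = y - \<rho>"
        using cong_per_close_eq[OF L_pos cw] w(1,2) e by (cases "w = y - \<rho>") auto
      then have "size_of w = 1" using y(3) s1 class_size_cg[OF c] by auto
      then have "size_of p = 1" using class_size_cg[OF w(3)] by simp
      then show ?thesis using class_size_1[OF _ pq] by blast
    qed
  qed
  then show thesis using that y(1,2) by blast
qed

lemma branch_leaf_unique:
  assumes b: "branch L R a b" and "size_of y = 1" "a < y" "y < b"
  shows "y = (a + b) / 2"
  using assms unfolding branch_def by force

lemma branch_shift:
  assumes b: "branch L R a b" shows "branch L R (a + of_int k * L) (b + of_int k * L)"
proof -
  let ?k = "of_int k * L"
  have c: "cg (x - ?k) x" for x using cong_per_plus_int[of L "x - ?k" k] by simp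
  have sh: "size_of (x - ?k) = size_of x" for x by (rule class_size_cg[OF c])
  have m: "((a + ?k) + (b + ?k)) / 2 - ?k = (a + b) / 2" by (simp add: field_simps)
  show ?thesis unfolding branch_def
  proof (intro conjI allI impI)
    show "a + ?k < b + ?k" "b + ?k < a + ?k + L" using b by (auto simp: branch_def)
    show "3 \<le> size_of (a + ?k)" using b sh[of "a + ?k"] by (simp add: branch_def)
    show "size_of (((a + ?k) + (b + ?k)) / 2) = 1"
      using b sh[of "((a + ?k) + (b + ?k)) / 2"] unfolding m by (simp add: branch_def)
    fix x assume x: "a + ?k < x \<and> x < b + ?k \<and> x \<noteq> ((a + ?k) + (b + ?k)) / 2"
    then have "a < x - ?k" "x - ?k < b" by auto
    moreover have "x - ?k \<noteq> (a + b) / 2"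
    proof
      assume "x - ?k = (a + b) / 2"
      then have "x = ((a + ?k) + (b + ?k)) / 2" using m by linarith
      then show False using x by blast
    qed
    ultimately have "size_of (x - ?k) = 2" using b unfolding branch_def by blast
    then show "size_of x = 2" using sh by simp
  next
    fix x assume x: "a + ?k \<le> x \<and> x \<le> b + ?k"
    then have "a \<le> x - ?k" "x - ?k \<le> b" by auto
    then have 1: "R (x - ?k) (a + b - (x - ?k))" using b unfolding branch_def by blast
    have e: "a + ?k + (b + ?k) - x - ?k = a + b - (x - ?k)" by simp
    show "R x (a + ?k + (b + ?k) - x)"
      by (rule R_cg[OF 1 c]) (rule c[of "a + ?k + (b + ?k) - x", unfolded e])
  qed
qed

lemma branch_two_points:
  assumes b: "branch L R a b" and x: "a < x" "x < b" and R: "R x y"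
  shows "cg x y \<or> cg (a + b - x) y"
proof (cases "x = (a + b) / 2")
  case True
  have "size_of x = 1" unfolding True using b unfolding branch_def by blast
  then show ?thesis using class_size_1[OF _ R] by blast
next
  case False
  have s: "size_of x = 2" using b x False by (simp add: branch_def)
  have R': "R x (a + b - x)" using b x unfolding branch_def by auto
  have "\<bar>x - (a + b - x)\<bar> < L" using b x unfolding branch_def by auto
  moreover have "x \<noteq> a + b - x" using False by (simp add: field_simps)
  ultimately have "\<not> cg x (a + b - x)" using cong_per_close_eq[OF L_pos] by blast
  then show ?thesis by (rule class_size_2[OF s R' _ R])
qed

lemma branch_closed:
  assumes b: "branch L R a b" and x: "a < x" "x < b" and R: "R x y" and y: "a \<le> y" "y < a + L"
  shows "y = x \<or> y = a + b - x"
proof -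
  have bL: "b < a + L" using b by (simp add: branch_def)
  have "x = y" if "cg x y" by (rule cong_per_close_eq[OF L_pos that]) (use x y bL in auto)
  moreover have "a + b - x = y" if "cg (a + b - x) y"
    by (rule cong_per_close_eq[OF L_pos that]) (use x y bL in auto)
  ultimately show ?thesis using branch_two_points[OF b x R] by blast
qed

lemma branch_ends:
  assumes b: "branch L R a b" shows "a < b" "b < a + L" "R a b" "size_of a \<ge> 3" "size_of b \<ge> 3"
proof -
  show 1: "a < b" "b < a + L" "size_of a \<ge> 3" using b by (auto simp: branch_def)
  have "R a (a + b - a)" using b unfolding branch_def by (metis less_imp_le order_refl)
  then show 2: "R a b" by simp
  show "size_of b \<ge> 3" using class_size_R[OF 2] 1(3) by simp
qed

lemma branch_rel:
  assumes b: "branch L R a b" and x: "a \<le> x" "x \<le> b" and y: "a \<le> y" "y \<le> b"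
  shows "R x y \<longleftrightarrow> x = y \<or> y = a + b - x"
proof
  assume "x = y \<or> y = a + b - x"
  then show "R x y" using b x R_refl[of x] unfolding branch_def by metis
next
  assume R: "R x y"
  note e = branch_ends[OF b]
  have in2: "size_of z \<le> 2" if "a < z" "z < b" for z 
  proof (cases "z = (a + b) / 2")
    case True
    have "size_of z = 1" unfolding True using b unfolding branch_def by blast
    then show ?thesis by simp
  next
    case False then show ?thesis using b that unfolding branch_def by auto
  qed
  show "x = y \<or> y = a + b - x"
  proof (cases "a < x \<and> x < b")
    case True
    then show ?thesis using branch_closed[OF b _ _ R] y e(2) by auto
  next
    case False
    then have "size_of x \<ge> 3" using x e(4,5) by (cases "x = a") auto
    then have "size_of y \<ge> 3" using class_size_R[OF R] by simp
    then have "\<not> (a < y \<and> y < b)" using in2[of y] by auto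
    then show ?thesis using False x y by auto
  qed
qed

text \<open>A junction C has at most one unmarked point, and the term |C| - 2 of this point equals
  the contribution of all points of C to \<open>junction_sum\<close>.\<close>

lemma unmarked_junctions_le:
  assumes one_unmarked: "\<And>x y. R x y \<Longrightarrow> size_of x \<ge> 3 \<Longrightarrow> x \<notin> M \<Longrightarrow> y \<notin> M \<Longrightarrow> cg x y"
  shows "(\<Sum>p\<in>{p. size_of p \<ge> 3 \<and> p \<notin> M} \<inter> {0..<L}. real (size_of p) - 2) \<le> real (card (leaves L R)) - 2"
proof -
  define J where "J = {x. size_of x \<ge> 3}"
  define g where "g p = (if p \<in> M then 0 else real (size_of p) - 2)" for p
  have fJ: "finite (J \<inter> {0..<L})" using finite_junctions by (simp add: J_def)
  have "(\<Sum>p\<in>{p. size_of p \<ge> 3 \<and> p \<notin> M} \<inter> {0..<L}. real (size_of p) - 2) = sum g (J \<inter> {0..<L})"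
    by (rule sum.mono_neutral_cong_left[OF fJ]) (auto simp: g_def J_def)
  also have "\<dots> = (\<Sum>x\<in>J \<inter> {0..<L}. (\<Sum>y\<in>{y. R x y} \<inter> {0..<L}. g y) / real (size_of x))"
  proof (rule sum_class_average[OF _ fJ, symmetric])
    fix x y assume "x \<in> J" "R x y" then show "y \<in> J" using class_size_R[of x y] by (simp add: J_def)
  qed
  also have "\<dots> \<le> (\<Sum>x\<in>J \<inter> {0..<L}. 1 - 2 / real (size_of x))"
  proof (rule sum_mono)
    fix x assume x: "x \<in> J \<inter> {0..<L}"
    let ?C = "{y. R x y} \<inter> {0..<L}"
    have x3: "size_of x \<ge> 3" using x by (simp add: J_def)
    have "(\<Sum>y\<in>?C. g y) \<le> real (size_of x) - 2"
    proof (cases "\<exists>p\<in>?C. p \<notin> M")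
      case False
      then have "(\<Sum>y\<in>?C. g y) = 0" by (intro sum.neutral) (auto simp: g_def)
      then show ?thesis using x3 by simp
    next
      case True
      then obtain p where p: "p \<in> ?C" "p \<notin> M" by blast
      have "(\<Sum>y\<in>?C. g y) = (\<Sum>y\<in>{p}. g y)"
      proof (rule sum.mono_neutral_right[OF fin_class])
        show "{p} \<subseteq> ?C" using p by blast
        show "\<forall>i\<in>?C - {p}. g i = 0"
        proof
          fix i assume i: "i \<in> ?C - {p}"
          have Rip: "R i p" using i p(1) R_trans[OF R_sym[of x i], of p] by simp
          have "size_of i \<ge> 3" using x3 class_size_R[of x i] i by simp
          then have "i \<in> M" using one_unmarked[OF Rip _ _ p(2)] cong_per_close_eq[OF L_pos, of i p] i p(1) by force
          then show "g i = 0" by (simp add: g_def)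
        qed
      qed
      then show ?thesis using p class_size_R[of x p] by (simp add: g_def)
    qed
    then have "(\<Sum>y\<in>?C. g y) / real (size_of x) \<le> (real (size_of x) - 2) / real (size_of x)"
      by (rule divide_right_mono) simp
    also have "\<dots> = 1 - 2 / real (size_of x)" using x3 by (simp add: field_simps)
    finally show "(\<Sum>y\<in>?C. g y) / real (size_of x) \<le> 1 - 2 / real (size_of x)" .
  qed
  also have "\<dots> = real (card (leaves L R)) - 2" using junction_sum by (simp add: J_def)
  finally show ?thesis .
qed

text \<open>Let U be the set of unmarked junction points. Every leaf branch has an end in U, and a
  point of U is the left end of at most one branch and the right end of at most one, so there are at
  most 2 |U| leaves. By \<open>unmarked_junctions_le\<close> there are at least |U| + 2 leaves. With
  at most four leaves both bounds are attained: |U| = 2, the classes of these points have size 3,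
  and each point of U lies between two branches.\<close>

lemma all_bad:
  assumes M: "periodic L M"
    and one_unmarked: "\<And>x y. R x y \<Longrightarrow> size_of x \<ge> 3 \<Longrightarrow> x \<notin> M \<Longrightarrow> y \<notin> M \<Longrightarrow> cg x y"
    and l: "card (leaves L R) \<ge> 3" "card (leaves L R) \<le> 4"
    and bad: "\<And>a b. branch L R a b \<Longrightarrow> a \<notin> M \<or> b \<notin> M"
  shows "card (leaves L R) = 4"
    "\<exists>p a c. p \<notin> M \<and> size_of p = 3 \<and> branch L R a p \<and> branch L R p c"
proof -
  define U where "U = {p. size_of p \<ge> 3 \<and> p \<notin> M} \<inter> {0..<L}"
  let ?Y = "leaves L R"
  have fU: "finite U" unfolding U_def by (rule finite_subset[OF _ finite_junctions]) auto
  have U_sum: "(\<Sum>p\<in>U. real (size_of p) - 2) \<le> real (card ?Y) - 2"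
    unfolding U_def by (rule unmarked_junctions_le[OF one_unmarked])
  have "\<forall>y\<in>?Y. \<exists>\<rho>>0. branch L R (y - \<rho>) (y + \<rho>)"
    using leaf_branch[OF _ l(1)] unfolding leaves_def by blast
  then obtain \<rho> where r: "\<And>y. y \<in> ?Y \<Longrightarrow> \<rho> y > 0" "\<And>y. y \<in> ?Y \<Longrightarrow> branch L R (y - \<rho> y) (y + \<rho> y)"
    by metis
  have y1: "size_of y = 1" if "y \<in> ?Y" for y using that by (simp add: leaves_def)
  define A where "A = {y\<in>?Y. y + \<rho> y \<notin> M}"
  define B where "B = {y\<in>?Y. y - \<rho> y \<notin> M}"
  have Y: "?Y = A \<union> B" using bad r(2) by (auto simp: A_def B_def)
  \<comment> \<open>Of two branches with a common left or a common right end, the shorter one would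
    have its leaf inside the longer one, which contains a single leaf. The sign s selects the
    end.\<close>
  have uniq: "y = y'" if y: "y \<in> ?Y" "y' \<in> ?Y" and c: "cg (y + s * \<rho> y) (y' + s * \<rho> y')" and s: "s = 1 \<or> s = -1"
    and le: "\<rho> y \<le> \<rho> y'" for y y' s
  proof -
    obtain k where k: "y' + s * \<rho> y' = y + s * \<rho> y + of_int k * L" using c unfolding cong_per_def by blast
    define w where "w = y + of_int k * L"
    have cw: "cg y w" by (simp add: w_def)
    have e: "w = y' + s * (\<rho> y' - \<rho> y)" using k by (simp add: w_def algebra_simps)
    have "w = ((y' - \<rho> y') + (y' + \<rho> y')) / 2"
    proof (rule branch_leaf_unique[OF r(2)[OF y(2)]])
      show "size_of w = 1" using class_size_cg[OF cw] y1[OF y(1)] by simp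
      show "y' - \<rho> y' < w" "w < y' + \<rho> y'" using e s le r(1)[OF y(1)] r(1)[OF y(2)] by auto
    qed
    then have "cg y y'" using cw by simp
    then show ?thesis using cong_per_close_eq[OF L_pos, of y y'] y by (auto simp: leaves_def)
  qed
  have inj: "inj_on (\<lambda>y. window L 0 (y + s * \<rho> y)) ?Y" if s: "s = 1 \<or> s = -1" for s
  proof (rule inj_onI)
    fix y y' assume y: "y \<in> ?Y" "y' \<in> ?Y" "window L 0 (y + s * \<rho> y) = window L 0 (y' + s * \<rho> y')"
    then have c: "cg (y + s * \<rho> y) (y' + s * \<rho> y')" using window_eq_iff[OF L_pos] by blast
    show "y = y'"
    proof (cases "\<rho> y \<le> \<rho> y'")
      case True then show ?thesis using uniq[OF y(1,2) c s] by blast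
    next
      case False then show ?thesis using uniq[OF y(2,1) cong_per_sym[OF c] s] by simp
    qed
  qed
  have inU: "window L 0 x \<in> U" if "size_of x \<ge> 3" "x \<notin> M" for x
    using that class_size_cg[OF window_cong_per[of L x 0]] window_mem[OF M, of 0 x] window_in[OF L_pos, of 0 x] by (simp add: U_def)
  define fA where "fA y = window L 0 (y + 1 * \<rho> y)" for y
  define fB where "fB y = window L 0 (y + (-1) * \<rho> y)" for y
  have fAU: "fA ` A \<subseteq> U"
  proof (rule image_subsetI)
    fix y assume y: "y \<in> A"
    then have br: "branch L R (y - \<rho> y) (y + \<rho> y)" using r(2) by (simp add: A_def)
    then have "size_of (y + \<rho> y) \<ge> 3" by (rule branch_ends)
    then show "fA y \<in> U" using inU y by (simp add: fA_def A_def)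
  qed
  have fBU: "fB ` B \<subseteq> U"
  proof (rule image_subsetI)
    fix y assume y: "y \<in> B"
    then have "size_of (y - \<rho> y) \<ge> 3" using r(2)[of y] by (simp add: B_def branch_def)
    then show "fB y \<in> U" using inU[of "y - \<rho> y"] y by (simp add: fB_def B_def)
  qed
  have injA: "inj_on fA A" unfolding fA_def using inj[of 1] inj_on_subset[of _ ?Y A] Y by blast
  have injB: "inj_on fB B" unfolding fB_def using inj[of "-1"] inj_on_subset[of _ ?Y B] Y by blast
  have cA: "card A \<le> card U" using card_inj_on_le[OF injA fAU fU] .
  have cB: "card B \<le> card U" using card_inj_on_le[OF injB fBU fU] .
  have cY: "card ?Y \<le> card A + card B" using card_Un_le[of A B] Y by simp
  have ge: "real (size_of p) - 2 \<ge> 1" if "p \<in> U" for p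
  proof -
    have "size_of p \<ge> 3" using that by (simp add: U_def)
    then show ?thesis by simp
  qed
  have "real (card U) \<le> (\<Sum>p\<in>U. real (size_of p) - 2)"
    using sum_mono[of U "\<lambda>_. 1" "\<lambda>p. real (size_of p) - 2"] ge by simp
  then have "card U + 2 \<le> card ?Y" using U_sum by linarith
  then have c4: "card ?Y = 4" and c2: "card U = 2" "card A = 2" "card B = 2"
    using cA cB cY l by linarith+
  then show "card ?Y = 4" by blast
  have sA: "fA ` A = U" using card_image[OF injA] c2 fU card_subset_eq[OF fU fAU] by simp
  have sB: "fB ` B = U" using card_image[OF injB] c2 fU card_subset_eq[OF fU fBU] by simp
  obtain p where p: "p \<in> U" using c2(1) by fastforce
  have "(\<Sum>q\<in>U. real (size_of q) - 2) = (real (size_of p) - 2) + (\<Sum>q\<in>U - {p}. real (size_of q) - 2)"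
    by (rule sum.remove[OF fU p])
  moreover have "(\<Sum>q\<in>U - {p}. real (size_of q) - 2) \<ge> (\<Sum>q\<in>U - {p}. 1)"
    by (rule sum_mono) (use ge in auto)
  moreover have "(\<Sum>q\<in>U - {p}. 1 :: real) = 1" using c2(1) p fU by simp
  ultimately have "size_of p \<le> 3" using U_sum c4 by simp
  then have s3: "size_of p = 3" using p by (simp add: U_def)
  obtain y where y: "y \<in> A" "fA y = p" using sA p by blast
  obtain z where z: "z \<in> B" "fB z = p" using sB p by blast
  define q where "q = y + \<rho> y"
  have cq: "cg q (z - \<rho> z)"
    using y(2) z(2) window_eq_iff[OF L_pos, of 0 q "z - \<rho> z"] by (simp add: fA_def fB_def q_def)
  have cqp: "cg q p" using y(2) window_cong_per[of L q 0] by (simp add: fA_def q_def)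
  obtain k where k: "z - \<rho> z = q + of_int k * L" using cq unfolding cong_per_def by blast
  have bz: "branch L R (z - \<rho> z) (z + \<rho> z)" using r(2) z(1) by (simp add: B_def)
  have "branch L R q (z + \<rho> z - of_int k * L)" using branch_shift[OF bz, of "- k"] k by simp
  moreover have "branch L R (y - \<rho> y) q" using r(2)[of y] y(1) by (simp add: q_def A_def)
  moreover have "q \<notin> M" using y(1) by (simp add: q_def A_def)
  moreover have "size_of q = 3" using s3 class_size_cg[OF cqp] by simp
  ultimately show "\<exists>p a c. p \<notin> M \<and> size_of p = 3 \<and> branch L R a p \<and> branch L R p c" by blast
qed

text \<open>Take the mark in the branch that is nearest to the leaf. Its mirror image is a mark by
  flatness, and there is no mark between the two, so the leaf would be the midpoint of consecutive
  marks, which \<open>mid\<close> excludes.\<close>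

lemma no_marks_in_branch:
  assumes M: "periodic L M" "finite (M \<inter> {0..<L})"
    and mark_flat: "\<And>x y. R x y \<Longrightarrow> size_of x = 2 \<Longrightarrow> x \<in> M \<Longrightarrow> y \<in> M"
    and b: "branch L R a b"
    and mid: "(a + b) / 2 \<notin> M" "\<And>m. m \<in> M \<Longrightarrow> (a + b) / 2 \<noteq> (m + next_in L M m) / 2"
    and x: "a < x" "x < b"
  shows "x \<notin> M"
proof
  assume xM: "x \<in> M"
  let ?S = "M \<inter> {a<..<b}"
  define y where "y = (a + b) / 2"
  have f: "finite (M \<inter> {0..<0 + L})" using M(2) by simp
  have "finite ?S" using finite_subset[OF _ finite_window(1)[OF L_pos M(1) f, of a]] b
    unfolding branch_def by (metis (no_types, lifting) Int_mono greaterThanLessThan_subseteq_atLeastLessThan_iff less_imp_le order_refl)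
  moreover have "?S \<noteq> {}" using xM x by auto
  ultimately obtain m where m: "m \<in> ?S" "\<And>w. w \<in> ?S \<Longrightarrow> \<bar>m - y\<bar> \<le> \<bar>w - y\<bar>"
    using ex_is_arg_min_if_finite[of ?S "\<lambda>w. \<bar>w - y\<bar>"] unfolding is_arg_min_linorder by blast
  have my: "m \<noteq> y" using m(1) mid(1) y_def by blast
  have m': "2 * y - m \<in> M"
  proof (rule mark_flat)
    have e: "2 * y - m = a + b - m" by (simp add: y_def)
    show "R m (2 * y - m)" unfolding e using b m(1) unfolding branch_def by auto
    show "size_of m = 2" "m \<in> M" using b m(1) my unfolding branch_def y_def by auto
  qed
  define u where "u = min m (2 * y - m)"
  have u: "u \<in> M" "u < y" "2 * y - u \<in> M" "\<bar>m - y\<bar> = y - u"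
    using m(1) m' my by (auto simp: u_def min_def)
  have "2 * y = a + b" by (simp add: y_def)
  then have uab: "a < u" "2 * y - u < b" using m(1) by (auto simp: u_def min_def)
  have "next_in L M u = 2 * y - u"
  proof (rule next_in_unique[OF L_pos M(1) f u(3)])
    show "u < 2 * y - u" using u(2) by simp
    fix w assume w: "u < w" "w < 2 * y - u"
    show "w \<notin> M"
    proof
      assume "w \<in> M"
      then have "w \<in> ?S" using w uab by auto
      then show False using m(2)[of w] u(4) w by auto
    qed
  qed
  then show False using mid(2)[OF u(1)] by (simp add: y_def)
qed

end

section \<open>Combinatorial equivalence and counting\<close>

text \<open>The map is the lift of an orientation-preserving homeomorphism of the circle: an
  increasing surjection of the line is continuous.\<close>

definition comb_equiv :: "real \<Rightarrow> real set \<Rightarrow> (real \<Rightarrow> real \<Rightarrow> bool) \<Rightarrow> (real \<Rightarrow> real \<Rightarrow> bool) \<Rightarrow> bool" where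
  "comb_equiv L M R R' \<longleftrightarrow> (\<exists>\<phi>. strict_mono \<phi> \<and> surj \<phi> \<and> (\<forall>x. \<phi> (x + L) = \<phi> x + L) \<and>
     (\<forall>m\<in>M. \<phi> m = m) \<and> (\<forall>x y. R x y \<longleftrightarrow> R' (\<phi> x) (\<phi> y)))"

text \<open>A bound on the number of equivalence classes met by \<open>F\<close>, phrased as a
  colouring because colourings combine over unions and pull back along cuts without quotient
  sets.\<close>

definition covered :: "real \<Rightarrow> real set \<Rightarrow> (real \<Rightarrow> real \<Rightarrow> bool) set \<Rightarrow> nat \<Rightarrow> bool" where
  "covered L M F N \<longleftrightarrow> (\<exists>g :: (real \<Rightarrow> real \<Rightarrow> bool) \<Rightarrow> nat. (\<forall>R\<in>F. g R < N) \<and>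
     (\<forall>R\<in>F. \<forall>R'\<in>F. g R = g R' \<longrightarrow> comb_equiv L M R R'))"

lemma comb_equiv_refl: "comb_equiv L M R R"
  unfolding comb_equiv_def by (rule exI[of _ "\<lambda>x. x"]) (auto simp: strict_mono_def)

lemma comb_equiv_sym: assumes "comb_equiv L M R R'" shows "comb_equiv L M R' R"
proof -
  obtain \<phi> where p: "strict_mono \<phi>" "surj \<phi>" "\<And>x. \<phi> (x + L) = \<phi> x + L" "\<And>m. m \<in> M \<Longrightarrow> \<phi> m = m"
    "\<And>x y. R x y \<longleftrightarrow> R' (\<phi> x) (\<phi> y)" using assms unfolding comb_equiv_def by blast
  have inj: "inj \<phi>" using p(1) by (rule strict_mono_imp_inj_on)
  define \<psi> where "\<psi> = inv \<phi>"
  have pp: "\<phi> (\<psi> x) = x" "\<psi> (\<phi> x) = x" for x using p(2) inj by (simp_all add: \<psi>_def surj_f_inv_f)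
  have eq: "\<psi> x = y" if "\<phi> y = x" for x y using pp that by blast
  show ?thesis unfolding comb_equiv_def
  proof (intro exI[of _ \<psi>] conjI allI ballI)
    show "strict_mono \<psi>"
    proof (rule strict_monoI)
      fix x y :: real assume "x < y"
      then have "\<phi> (\<psi> x) < \<phi> (\<psi> y)" by (simp add: pp)
      then show "\<psi> x < \<psi> y" using strict_mono_less[OF p(1)] by blast
    qed
    show "surj \<psi>" using pp(2) by (rule surjI)
    show "\<psi> (x + L) = \<psi> x + L" for x by (rule eq) (simp add: p(3) pp)
    show "\<psi> m = m" if "m \<in> M" for m by (rule eq) (simp add: p(4) that)
    show "R' x y \<longleftrightarrow> R (\<psi> x) (\<psi> y)" for x y by (simp add: p(5) pp)
  qed
qed

lemma comb_equiv_trans: assumes "comb_equiv L M R R'" "comb_equiv L M R' R''" shows "comb_equiv L M R R''"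
proof -
  obtain \<phi> where p: "strict_mono \<phi>" "surj \<phi>" "\<forall>x. \<phi> (x + L) = \<phi> x + L" "\<forall>m\<in>M. \<phi> m = m"
    "\<forall>x y. R x y \<longleftrightarrow> R' (\<phi> x) (\<phi> y)" using assms(1) unfolding comb_equiv_def by blast
  obtain \<psi> where q: "strict_mono \<psi>" "surj \<psi>" "\<forall>x. \<psi> (x + L) = \<psi> x + L" "\<forall>m\<in>M. \<psi> m = m"
    "\<forall>x y. R' x y \<longleftrightarrow> R'' (\<psi> x) (\<psi> y)" using assms(2) unfolding comb_equiv_def by blast
  show ?thesis unfolding comb_equiv_def
    by (rule exI[of _ "\<psi> \<circ> \<phi>"]) (use p q comp_surj[OF p(2) q(2)] strict_mono_o[OF q(1) p(1)] in \<open>simp add: o_def\<close>)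
qed

lemma covered_single: assumes "\<And>R R'. R \<in> F \<Longrightarrow> R' \<in> F \<Longrightarrow> comb_equiv L M R R'" shows "covered L M F 1"
  unfolding covered_def by (rule exI[of _ "\<lambda>_. 0"]) (use assms in auto)

lemma covered_mono: assumes "covered L M F N" "F' \<subseteq> F" "N \<le> N'" shows "covered L M F' N'"
proof -
  obtain g where g: "\<forall>R\<in>F. g R < N" "\<forall>R\<in>F. \<forall>R'\<in>F. g R = g R' \<longrightarrow> comb_equiv L M R R'"
    using assms(1) unfolding covered_def by blast
  have "g R < N'" if "R \<in> F'" for R using g(1) that assms(2,3) by (meson less_le_trans subsetD)
  then show ?thesis unfolding covered_def using g(2) assms(2) by (intro exI[of _ g]) blast
qed

lemma covered_UN:
  assumes Z: "finite Z" "F \<subseteq> (\<Union>z\<in>Z. G z)" and c: "\<And>z. z \<in> Z \<Longrightarrow> covered L M (G z) N"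
  shows "covered L M F (card Z * N)"
proof -
  obtain e where e: "bij_betw e Z {0..<card Z}" using ex_bij_betw_finite_nat[OF Z(1)] by blast
  have "\<forall>z\<in>Z. \<exists>g::(real \<Rightarrow> real \<Rightarrow> bool) \<Rightarrow> nat. (\<forall>R\<in>G z. g R < N) \<and> (\<forall>R\<in>G z. \<forall>R'\<in>G z. g R = g R' \<longrightarrow> comb_equiv L M R R')"
    using c unfolding covered_def by blast
  then obtain g :: "_ \<Rightarrow> (real \<Rightarrow> real \<Rightarrow> bool) \<Rightarrow> nat" where
    g: "\<And>z R. z \<in> Z \<Longrightarrow> R \<in> G z \<Longrightarrow> g z R < N"
       "\<And>z R R'. z \<in> Z \<Longrightarrow> R \<in> G z \<Longrightarrow> R' \<in> G z \<Longrightarrow> g z R = g z R' \<Longrightarrow> comb_equiv L M R R'"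
    by metis
  have "\<forall>R\<in>F. \<exists>z. z \<in> Z \<and> R \<in> G z" using Z(2) by blast
  then obtain ch where ch: "\<And>R. R \<in> F \<Longrightarrow> ch R \<in> Z \<and> R \<in> G (ch R)" by metis
  \<comment> \<open>The index of the part and the colour inside it, as digits in base
    \<open>N\<close>.\<close>
  define h where "h R = e (ch R) * N + g (ch R) R" for R
  have d: "h R div N = e (ch R) \<and> h R mod N = g (ch R) R" if "R \<in> F" for R
    using g(1)[of "ch R" R] ch[OF that] by (simp add: h_def)
  show ?thesis unfolding covered_def
  proof (intro exI[of _ h] conjI ballI impI)
    fix R assume R: "R \<in> F"
    have "e (ch R) < card Z" using e ch[OF R] by (auto simp: bij_betw_def)
    then have "Suc (e (ch R)) * N \<le> card Z * N" by (intro mult_le_mono) auto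
    then show "h R < card Z * N" using g(1)[of "ch R" R] ch[OF R] by (simp add: h_def)
  next
    fix R R' assume R: "R \<in> F" "R' \<in> F" "h R = h R'"
    then have "e (ch R) = e (ch R')" "g (ch R) R = g (ch R') R'" using d[OF R(1)] d[OF R(2)] by auto
    moreover from this have "ch R = ch R'"
      using e ch[OF R(1)] ch[OF R(2)] unfolding bij_betw_def by (meson inj_onD)
    ultimately show "comb_equiv L M R R'" using g(2)[of "ch R" R R'] ch[OF R(1)] ch[OF R(2)] by simp
  qed
qed

lemma covered_Un:
  assumes "covered L M F N" "covered L M F' N'" shows "covered L M (F \<union> F') (N + N')"
proof -
  obtain g where g: "\<forall>R\<in>F. g R < N" "\<forall>R\<in>F. \<forall>R'\<in>F. g R = g R' \<longrightarrow> comb_equiv L M R R'"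
    using assms(1) unfolding covered_def by blast
  obtain h where h: "\<forall>R\<in>F'. h R < N'" "\<forall>R\<in>F'. \<forall>R'\<in>F'. h R = h R' \<longrightarrow> comb_equiv L M R R'"
    using assms(2) unfolding covered_def by blast
  show ?thesis unfolding covered_def
  proof (intro exI[of _ "\<lambda>R. if R \<in> F then g R else N + h R"] conjI ballI impI)
    fix R assume R: "R \<in> F \<union> F'"
    show "(if R \<in> F then g R else N + h R) < N + N'" using R g(1) h(1) by force
    fix R' assume R': "R' \<in> F \<union> F'" "(if R \<in> F then g R else N + h R) = (if R' \<in> F then g R' else N + h R')"
    show "comb_equiv L M R R'"
    proof (cases "R \<in> F")
      case True
      have "R' \<in> F" using R'(2) g(1) True by (cases "R' \<in> F") force+
      then show ?thesis using True R'(2) g(2) by simp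
    next
      case False
      have "R' \<notin> F" using R'(2) g(1) False by (cases "R' \<in> F") force+
      then show ?thesis using False R R' h(2) by simp
    qed
  qed
qed

lemma covered_pull:
  assumes "covered L' M' F' N" "\<And>R. R \<in> F \<Longrightarrow> T R \<in> F'"
    "\<And>R1 R2. R1 \<in> F \<Longrightarrow> R2 \<in> F \<Longrightarrow> comb_equiv L' M' (T R1) (T R2) \<Longrightarrow> comb_equiv L M R1 R2"
  shows "covered L M F N"
proof -
  obtain g where g: "\<forall>R\<in>F'. g R < N" "\<forall>R\<in>F'. \<forall>R'\<in>F'. g R = g R' \<longrightarrow> comb_equiv L' M' R R'"
    using assms(1) unfolding covered_def by blast
  show ?thesis unfolding covered_def
    by (rule exI[of _ "\<lambda>R. g (T R)"]) (use g assms(2,3) in blast)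
qed

section \<open>Combinatorial types of reflections\<close>

definition reflection :: "real \<Rightarrow> real \<Rightarrow> real \<Rightarrow> real \<Rightarrow> bool" where
  "reflection L y p q \<longleftrightarrow> cong_per L p q \<or> cong_per L (2 * y - p) q"

lemma shift_int:
  assumes "\<And>x::real. \<phi> (x + L) = \<phi> x + (L::real)" shows "\<phi> (x + of_int k * L) = \<phi> x + of_int k * L"
proof (induction k rule: int_induct[where k = 0])
  case base then show ?case by simp
next
  case (step1 i) then show ?case using assms[of "x + of_int i * L"] by (simp add: algebra_simps)
next
  case (step2 i) then show ?case using assms[of "x + of_int (i - 1) * L"] by (simp add: algebra_simps)
qed

lemma cong_per_shift_iff:
  assumes "\<And>x::real. \<phi> (x + L) = \<phi> x + (L::real)" "inj \<phi>"
  shows "cong_per L (\<phi> x) (\<phi> y) \<longleftrightarrow> cong_per L x y"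
  unfolding cong_per_def using shift_int[of \<phi> L x, OF assms(1)] injD[OF assms(2)] by metis

text \<open>Modulo L the numbers m + m' - 2 y take finitely many values, none of them 0, so their
  distances to the multiples of L have a positive minimum.\<close>

lemma separated_marks:
  assumes L: "L > 0" and M: "periodic L M" "finite (M \<inter> {0..<L})"
    and nc: "\<And>m m'. m \<in> M \<Longrightarrow> m' \<in> M \<Longrightarrow> m + m' \<noteq> 2 * y"
  obtains D where "D > 0" "\<And>m m'. m \<in> M \<Longrightarrow> m' \<in> M \<Longrightarrow> D \<le> \<bar>m + m' - 2 * y\<bar>"
proof -
  \<comment> \<open>The distance from c to the nearest multiple of L.\<close>
  define f where "f c = min (window L 0 c) (L - window L 0 c)" for c
  define Q where "Q = (\<lambda>(a, b). f (a + b - 2 * y)) ` ((M \<inter> {0..<L}) \<times> (M \<inter> {0..<L}))"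
  define D where "D = Min (insert 1 Q)"
  have fin: "finite (insert 1 Q)" using M(2) by (simp add: Q_def)
  have pos: "0 < f (a + b - 2 * y)" if ab: "a \<in> M" "b \<in> M" for a b
  proof -
    have "window L 0 (a + b - 2 * y) \<noteq> 0"
    proof
      assume "window L 0 (a + b - 2 * y) = 0"
      then have "cong_per L (a + b - 2 * y) 0" using window_cong_per by metis
      then obtain k where "0 = a + b - 2 * y + of_int k * L" unfolding cong_per_def by blast
      then have "a + (b + of_int k * L) = 2 * y" by simp
      then show False using nc[OF ab(1)] periodic_int[OF M(1), of b k] ab(2) by blast
    qed
    then show ?thesis using window_ge[OF L, of 0 "a + b - 2 * y"] window_less[OF L, of 0 "a + b - 2 * y"] by (simp add: f_def)
  qed
  have "D > 0" unfolding D_def using fin pos by (subst Min_gr_iff) (auto simp: Q_def)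
  moreover have "D \<le> \<bar>m + m' - 2 * y\<bar>" if m: "m \<in> M" "m' \<in> M" for m m'
  proof -
    define c where "c = m + m' - 2 * y"
    define a b where "a = window L 0 m" and "b = window L 0 m'"
    have ab: "a \<in> M \<inter> {0..<L}" "b \<in> M \<inter> {0..<L}"
      using m window_in[OF L, of 0 m] window_in[OF L, of 0 m'] window_mem[OF M(1), of 0 m] window_mem[OF M(1), of 0 m']
      by (auto simp: a_def b_def)
    obtain i j where ij: "a = m + of_int i * L" "b = m' + of_int j * L"
      using window_cong_per[of L m 0] window_cong_per[of L m' 0] unfolding cong_per_def a_def b_def by blast
    have "a + b - 2 * y = c + of_int (i + j) * L" using ij by (simp add: c_def algebra_simps)
    then have "cong_per L c (a + b - 2 * y)" by (simp only: cong_per_plus_int)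
    then have e: "window L 0 c = window L 0 (a + b - 2 * y)" using window_eq_iff[OF L] by blast
    have "D \<le> f (a + b - 2 * y)" unfolding D_def using fin ab by (intro Min_le) (auto simp: Q_def)
    also have "\<dots> = f c" by (simp add: f_def e)
    also have "\<dots> \<le> \<bar>c\<bar>"
    proof -
      obtain k where k: "window L 0 c = c + of_int k * L" using window_cong_per[of L c 0] unfolding cong_per_def by blast
      show ?thesis
      proof (cases "k \<le> 0")
        case True
        then have "of_int k * L \<le> 0" using L by (simp add: mult_nonpos_nonneg)
        then show ?thesis using k by (simp add: f_def)
      next
        case False
        then have "1 * L \<le> of_int k * L" using L by (intro mult_right_mono) auto
        then show ?thesis using k by (simp add: f_def)
      qed
    qed
    finally show ?thesis by (simp add: c_def)
  qed
  ultimately show thesis using that by blast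
qed

text \<open>With \<open>u\<close> the normalised distance to the marks, \<open>u \<circ> (reflection at y) = 1 - u\<close>; this makes
  \<open>p \<mapsto> p + 2 \<delta> u p\<close> conjugate the reflection at \<open>y\<close> to the one at \<open>y + \<delta>\<close>.\<close>

lemma reflection_comb_equiv_local:
  assumes L: "L > 0" and M: "periodic L M" "M \<noteq> {}"
    and D: "D > 0" "\<And>m m'. m \<in> M \<Longrightarrow> m' \<in> M \<Longrightarrow> D \<le> \<bar>m + m' - 2 * y\<bar>"
    and small: "2 * \<bar>\<delta>\<bar> < D"
  shows "comb_equiv L M (reflection L y) (reflection L (y + \<delta>))"
proof -
  \<comment> \<open>The mirror images of the marks. They are at distance at least D from the marks,
    so the sum of the two distance functions d and e never falls below D.\<close>
  define N where "N = (\<lambda>m. 2 * y - m) ` M"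
  have N: "N \<noteq> {}" using M(2) by (simp add: N_def)
  define d where "d p = infdist p M" for p
  define e where "e p = infdist p N" for p
  have d_refl: "d (2 * y - p) = e p" for p
    unfolding d_def e_def infdist_def N_def using M(2) by (simp add: image_image dist_real_def abs_minus_commute algebra_simps)
  have e_refl: "e (2 * y - p) = d p" for p using d_refl[of "2 * y - p"] by simp
  have shift: "(\<lambda>m. m + L) ` M = M"
  proof
    show "(\<lambda>m. m + L) ` M \<subseteq> M" using M(1) by (auto simp: periodic_def)
    show "M \<subseteq> (\<lambda>m. m + L) ` M"
    proof
      fix m assume "m \<in> M"
      then have "m - L \<in> M" using M(1) unfolding periodic_def by (metis diff_add_cancel)
      then show "m \<in> (\<lambda>m. m + L) ` M" by (rule rev_image_eqI) simp
    qed
  qed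
  have d_per: "d (p + L) = d p" for p
  proof -
    have "d (p + L) = infdist (p + L) ((\<lambda>m. m + L) ` M)" by (simp add: d_def shift)
    also have "\<dots> = d p" unfolding d_def infdist_def using M(2) by (simp add: image_image dist_real_def)
    finally show ?thesis .
  qed
  have e_per: "e (p + L) = e p" for p
    using d_refl[of "p + L"] d_refl[of p] d_per[of "2 * y - (p + L)"] by simp
  have ge: "D \<le> d p + e p" for p
  proof -
    have "D - e p \<le> dist p m" if m: "m \<in> M" for m
    proof -
      have "D \<le> infdist m N"
        unfolding infdist_notempty[OF N]
        by (rule cINF_greatest[OF N]) (use D(2)[OF m] in \<open>auto simp: N_def dist_real_def algebra_simps\<close>)
      also have "\<dots> \<le> e p + dist m p" unfolding e_def by (rule infdist_triangle)
      finally show ?thesis by (simp add: dist_commute)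
    qed
    then have "D - e p \<le> d p" unfolding d_def infdist_notempty[OF M(2)] by (intro cINF_greatest[OF M(2)])
    then show ?thesis by simp
  qed
  have nn: "0 \<le> d p" "0 \<le> e p" for p by (simp_all add: d_def e_def infdist_nonneg)
  \<comment> \<open>A Urysohn function: 0 at the marks and 1 at their mirror images. Its Lipschitz
    constant 1 / D, shown in \<open>lip\<close>, makes \<phi> increasing because 2 |\<delta>| <
    D.\<close>
  define u where "u p = d p / (d p + e p)" for p
  have pos: "d p + e p > 0" for p using ge[of p] D(1) by simp
  have u01: "0 \<le> u p" "u p \<le> 1" for p using nn[of p] pos[of p] by (simp_all add: u_def)
  have u_refl: "u (2 * y - p) = 1 - u p" for p
    unfolding u_def d_refl e_refl using pos[of p] by (simp add: field_simps)
  have lip: "\<bar>u p - u q\<bar> \<le> \<bar>p - q\<bar> / D" for p q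
  proof -
    have d1: "\<bar>d p - d q\<bar> \<le> \<bar>p - q\<bar>" unfolding d_def
      using infdist_triangle[of p M q] infdist_triangle[of q M p] by (simp add: dist_real_def)
    have e1: "\<bar>e p - e q\<bar> \<le> \<bar>p - q\<bar>" unfolding e_def
      using infdist_triangle[of p N q] infdist_triangle[of q N p] by (simp add: dist_real_def)
    have "u p - u q = ((d p - d q) * e q - d q * (e p - e q)) / ((d p + e p) * (d q + e q))"
      using pos[of p] pos[of q] unfolding u_def by (subst diff_frac_eq) (auto simp: algebra_simps)
    then have "\<bar>u p - u q\<bar> = \<bar>(d p - d q) * e q - d q * (e p - e q)\<bar> / ((d p + e p) * (d q + e q))"
      using pos[of p] pos[of q] by (simp add: abs_divide abs_mult)
    also have "\<dots> \<le> (\<bar>p - q\<bar> * e q + d q * \<bar>p - q\<bar>) / ((d p + e p) * (d q + e q))"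
    proof (rule divide_right_mono)
      have "\<bar>(d p - d q) * e q - d q * (e p - e q)\<bar> \<le> \<bar>(d p - d q) * e q\<bar> + \<bar>d q * (e p - e q)\<bar>"
        by (rule abs_triangle_ineq4)
      also have "\<dots> = \<bar>d p - d q\<bar> * e q + d q * \<bar>e p - e q\<bar>" using nn[of q] by (simp add: abs_mult)
      also have "\<dots> \<le> \<bar>p - q\<bar> * e q + d q * \<bar>p - q\<bar>"
        using d1 e1 nn[of q] by (intro add_mono mult_right_mono mult_left_mono) auto
      finally show "\<bar>(d p - d q) * e q - d q * (e p - e q)\<bar> \<le> \<bar>p - q\<bar> * e q + d q * \<bar>p - q\<bar>" .
      show "0 \<le> (d p + e p) * (d q + e q)" using pos[of p] pos[of q] by simp
    qed
    also have "\<bar>p - q\<bar> * e q + d q * \<bar>p - q\<bar> = \<bar>p - q\<bar> * (d q + e q)" by (simp add: algebra_simps)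
    also have "\<bar>p - q\<bar> * (d q + e q) / ((d p + e p) * (d q + e q)) = \<bar>p - q\<bar> / (d p + e p)"
      using pos[of q] by simp
    also have "\<dots> \<le> \<bar>p - q\<bar> / D" using ge[of p] D(1) by (intro divide_left_mono) auto
    finally show ?thesis .
  qed
  define \<phi> where "\<phi> p = p + 2 * \<delta> * u p" for p
  have mono: "strict_mono \<phi>"
  proof (rule strict_monoI)
    fix p q :: real assume pq: "p < q"
    have "\<bar>2 * \<delta> * (u q - u p)\<bar> \<le> 2 * \<bar>\<delta>\<bar> * (\<bar>q - p\<bar> / D)"
      using mult_left_mono[OF lip[of q p], of "2 * \<bar>\<delta>\<bar>"] by (simp add: abs_mult)
    also have "\<dots> = (2 * \<bar>\<delta>\<bar> / D) * (q - p)" using pq by simp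
    also have "\<dots> < 1 * (q - p)" using small D(1) pq by (intro mult_strict_right_mono) auto
    finally have "\<bar>2 * \<delta> * (u q - u p)\<bar> < q - p" by simp
    then show "\<phi> p < \<phi> q" unfolding \<phi>_def by (simp add: algebra_simps abs_less_iff)
  qed
  have cont: "continuous_on A \<phi>" for A
    unfolding \<phi>_def u_def d_def e_def using pos unfolding d_def e_def
    by (intro continuous_intros) (auto simp: less_imp_neq[symmetric])
  have near: "\<bar>\<phi> p - p\<bar> \<le> 2 * \<bar>\<delta>\<bar>" for p
    using u01[of p] mult_left_mono[of "\<bar>u p\<bar>" 1 "2 * \<bar>\<delta>\<bar>"] by (simp add: \<phi>_def abs_mult)
  have "surj \<phi>"
    unfolding surj_def
  proof
    fix z
    have "\<phi> (z - 2 * \<bar>\<delta>\<bar>) \<le> z" "z \<le> \<phi> (z + 2 * \<bar>\<delta>\<bar>)"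
      using near[of "z - 2 * \<bar>\<delta>\<bar>"] near[of "z + 2 * \<bar>\<delta>\<bar>"] by linarith+
    then have "\<exists>x\<ge>z - 2 * \<bar>\<delta>\<bar>. x \<le> z + 2 * \<bar>\<delta>\<bar> \<and> \<phi> x = z"
      by (rule IVT') (simp_all add: cont)
    then show "\<exists>x. z = \<phi> x" by blast
  qed
  moreover have per: "\<phi> (x + L) = \<phi> x + L" for x by (simp add: \<phi>_def u_def d_per e_per)
  moreover have "\<phi> m = m" if "m \<in> M" for m using that by (simp add: \<phi>_def u_def d_def)
  moreover have "reflection L y p q \<longleftrightarrow> reflection L (y + \<delta>) (\<phi> p) (\<phi> q)" for p q
  proof -
    have inj: "inj \<phi>" using mono by (rule strict_mono_imp_inj_on)
    have "\<phi> (2 * y - p) = 2 * (y + \<delta>) - \<phi> p" unfolding \<phi>_def u_refl by (simp add: algebra_simps)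
    then show ?thesis unfolding reflection_def
      using cong_per_shift_iff[of \<phi> L p q, OF per inj] cong_per_shift_iff[of \<phi> L "2 * y - p" q, OF per inj] by simp
  qed
  ultimately show ?thesis unfolding comb_equiv_def using mono by blast
qed

text \<open>The reflection at y glues m to m' when m + m' = 2 y. While the axis meets no such
  position the type is locally constant, hence constant on the interval by connectedness.\<close>

lemma reflection_comb_equiv:
  assumes L: "L > 0" and M: "periodic L M" "M \<noteq> {}" "finite (M \<inter> {0..<L})"
    and nc: "\<And>y m m'. y \<in> {a..b} \<Longrightarrow> m \<in> M \<Longrightarrow> m' \<in> M \<Longrightarrow> m + m' \<noteq> 2 * y" and ab: "a \<le> b"
  shows "comb_equiv L M (reflection L a) (reflection L b)"
proof (rule connected_equivalence_relation[of "{a..b}" a b "\<lambda>x y. comb_equiv L M (reflection L x) (reflection L y)"])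
  fix y assume y: "y \<in> {a..b}"
  obtain D where D: "D > 0" "\<And>m m'. m \<in> M \<Longrightarrow> m' \<in> M \<Longrightarrow> D \<le> \<bar>m + m' - 2 * y\<bar>"
    using separated_marks[OF L M(1,3) nc[OF y]] by blast
  show "\<exists>T. openin (top_of_set {a..b}) T \<and> y \<in> T \<and> (\<forall>x\<in>T. comb_equiv L M (reflection L y) (reflection L x))"
  proof (intro exI[of _ "{a..b} \<inter> ball y (D / 2)"] conjI ballI)
    show "openin (top_of_set {a..b}) ({a..b} \<inter> ball y (D / 2))" by (simp add: openin_open_Int)
    show "y \<in> {a..b} \<inter> ball y (D / 2)" using y D(1) by simp
    fix x assume "x \<in> {a..b} \<inter> ball y (D / 2)"
    then have "2 * \<bar>x - y\<bar> < D" by (simp add: dist_real_def abs_minus_commute)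
    then show "comb_equiv L M (reflection L y) (reflection L x)"
      using reflection_comb_equiv_local[OF L M(1,2) D, of "x - y"] by simp
  qed
qed (use ab in \<open>auto intro: comb_equiv_sym elim: comb_equiv_trans\<close>)

text \<open>With n marks per period, the positions at which marks are glued to marks are half-sums
  of marks with three possible shifts by L. Together with 0, which serves as a starting point, there
  are at most 4 n^2 of them, and each accounts for two types: the position itself and the gap after
  it.\<close>

lemma covered_reflections:
  assumes L: "L > 0" and M: "periodic L M" "M \<noteq> {}" "finite (M \<inter> {0..<L})"
  shows "covered L M {reflection L y | y. 0 \<le> y \<and> y < L} (8 * card (M \<inter> {0..<L}) ^ 2)"
proof -
  let ?M = "M \<inter> {0..<L}"
  define C where "C = (\<lambda>(a, b, k). (a + b + of_int k * L) / 2) ` (?M \<times> ?M \<times> {-1, 0, 1 :: int})"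
  define K where "K = insert 0 C"
  have fK: "finite K" using M(3) by (simp add: K_def C_def)
  obtain m0 where m0: "m0 \<in> M" using M(2) by blast
  have "window L 0 m0 \<in> ?M" using m0 window_in[OF L, of 0 m0] window_mem[OF M(1), of 0 m0] by simp
  then have n1: "card ?M \<ge> 1" using M(3) by (metis Suc_leI card_gt_0_iff empty_iff One_nat_def)
  have "card C \<le> card (?M \<times> ?M \<times> {-1, 0, 1 :: int})" unfolding C_def by (rule card_image_le) (use M(3) in simp)
  also have "\<dots> = 3 * card ?M ^ 2" by (simp add: card_cartesian_product power2_eq_square)
  finally have "card K \<le> 3 * card ?M ^ 2 + 1" unfolding K_def using card_insert_le_m1 by (simp add: card_insert_if M(3) C_def)
  also have "\<dots> \<le> 4 * card ?M ^ 2" using n1 by (simp add: power2_eq_square)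
  finally have cK: "card K \<le> 4 * card ?M ^ 2" .
  have crit: "y \<in> K" if y: "0 \<le> y" "y < L" and m: "m \<in> M" "m' \<in> M" "m + m' = 2 * y" for y m m'
  proof -
    define a b where "a = window L 0 m" and "b = window L 0 m'"
    have ab: "a \<in> ?M" "b \<in> ?M"
      using m window_in[OF L, of 0 m] window_in[OF L, of 0 m'] window_mem[OF M(1), of 0 m] window_mem[OF M(1), of 0 m']
      by (auto simp: a_def b_def)
    obtain i j where ij: "m = a + of_int i * L" "m' = b + of_int j * L"
      using cong_per_sym[OF window_cong_per[of L m 0]] cong_per_sym[OF window_cong_per[of L m' 0]] unfolding cong_per_def a_def b_def by blast
    have e: "2 * y = a + b + of_int (i + j) * L" using m(3) ij by (simp add: algebra_simps)
    have "\<bar>of_int (i + j) * L\<bar> < 2 * L" using e ab y by auto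
    then have "\<bar>of_int (i + j)\<bar> * L < 2 * L" using L by (simp add: abs_mult)
    then have "\<bar>of_int (i + j) :: real\<bar> < 2" using L by simp
    then have "i + j \<in> {-1, 0, 1}" by auto
    then have "(a, b, i + j) \<in> ?M \<times> ?M \<times> {-1, 0, 1}" using ab by simp
    moreover have "y = (a + b + of_int (i + j) * L) / 2" using e by simp
    ultimately have "y \<in> C" unfolding C_def by (intro image_eqI[of _ _ "(a, b, i + j)"]) simp_all
    then show ?thesis by (simp add: K_def)
  qed
  \<comment> \<open>\<open>True\<close> stands for the critical position k itself,
    \<open>False\<close> for the axes in the open gap that follows k.\<close>
  define G where "G z = (case z of (k, True) \<Rightarrow> {reflection L k} |
      (k, False) \<Rightarrow> {reflection L y | y. 0 \<le> y \<and> y < L \<and> y \<notin> K \<and> k < y \<and> (\<forall>k'\<in>K. \<not> (k < k' \<and> k' \<le> y))})" for z :: "real \<times> bool"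
  have "covered L M {reflection L y | y. 0 \<le> y \<and> y < L} (card (K \<times> (UNIV :: bool set)) * 1)"
  proof (rule covered_UN)
    show "finite (K \<times> (UNIV :: bool set))" using fK by simp
    show "{reflection L y | y. 0 \<le> y \<and> y < L} \<subseteq> (\<Union>z\<in>K \<times> UNIV. G z)"
    proof
      fix R assume "R \<in> {reflection L y | y. 0 \<le> y \<and> y < L}"
      then obtain y where y: "R = reflection L y" "0 \<le> y" "y < L" by blast
      show "R \<in> (\<Union>z\<in>K \<times> UNIV. G z)"
      proof (cases "y \<in> K")
        case True
        then show ?thesis using y by (intro UN_I[of "(y, True)"]) (auto simp: G_def)
      next
        case False
        define k where "k = Max {k\<in>K. k \<le> y}"
        have f: "finite {k\<in>K. k \<le> y}" using fK by simp
        have "0 \<in> {k\<in>K. k \<le> y}" using y by (simp add: K_def)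
        then have k: "k \<in> {k\<in>K. k \<le> y}" unfolding k_def using f Max_in by blast
        have mx: "k' \<le> k" if "k' \<in> K" "k' \<le> y" for k' unfolding k_def using f that by (intro Max_ge) auto
        have "k \<noteq> y" using k False by auto
        then have "k < y" using k by simp
        moreover have "\<forall>k'\<in>K. \<not> (k < k' \<and> k' \<le> y)" using mx by force
        ultimately have "R \<in> G (k, False)" unfolding G_def using y False by auto
        then show ?thesis using k by blast
      qed
    qed
    fix z assume "z \<in> K \<times> (UNIV :: bool set)"
    obtain k b where z: "z = (k, b)" by (cases z)
    have sub: "comb_equiv L M (reflection L y) (reflection L y')"
      if "0 \<le> y" "y \<notin> K" "y \<le> y'" "y' < L" "k < y" "\<forall>k'\<in>K. \<not> (k < k' \<and> k' \<le> y')" for y y'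
    proof (rule reflection_comb_equiv[OF L M _ that(3)])
      fix t m m' assume t: "t \<in> {y..y'}" and m: "m \<in> M" "m' \<in> M"
      show "m + m' \<noteq> 2 * t"
      proof
        assume "m + m' = 2 * t"
        then have "t \<in> K" using crit[OF _ _ m] t that(1,4) by simp
        then show False using that(5,6) t by force
      qed
    qed
    show "covered L M (G z) 1"
    proof (rule covered_single)
      fix R R' assume RR: "R \<in> G z" "R' \<in> G z"
      show "comb_equiv L M R R'"
      proof (cases b)
        case True then show ?thesis using RR z by (simp add: G_def comb_equiv_refl)
      next
        case False
        then obtain y y' where y: "R = reflection L y" "0 \<le> y" "y < L" "y \<notin> K" "k < y" "\<forall>k'\<in>K. \<not> (k < k' \<and> k' \<le> y)"
          and y': "R' = reflection L y'" "0 \<le> y'" "y' < L" "y' \<notin> K" "k < y'" "\<forall>k'\<in>K. \<not> (k < k' \<and> k' \<le> y')"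
          using RR z unfolding G_def by auto
        show ?thesis
        proof (cases "y \<le> y'")
          case True then show ?thesis unfolding y(1) y'(1) by (intro sub[OF y(2,4) _ y'(3) y(5) y'(6)])
        next
          case False
          then have "y' \<le> y" by simp
          then show ?thesis unfolding y(1) y'(1) by (intro comb_equiv_sym[OF sub[OF y'(2,4) _ y(3) y'(5) y(6)]])
        qed
      qed
    qed
  qed
  then show ?thesis by (rule covered_mono) (use cK fK in \<open>auto simp: card_cartesian_product\<close>)
qed

section \<open>Cutting out arcs\<close>

text \<open>Cutting the arc \<open>[a, b]\<close> out of the circle; \<open>unred\<close> maps the shorter circle back, sending
  \<open>0\<close> to the merged point \<open>b\<close>.\<close>

definition unred :: "real \<Rightarrow> real \<Rightarrow> real \<Rightarrow> real \<Rightarrow> real" where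
  "unred L a b p = b + p + (b - a) * of_int \<lfloor>p / (L - (b - a))\<rfloor>"

definition red :: "real \<Rightarrow> real \<Rightarrow> real \<Rightarrow> (real \<Rightarrow> real \<Rightarrow> bool) \<Rightarrow> real \<Rightarrow> real \<Rightarrow> bool" where
  "red L a b R p q \<longleftrightarrow> R (unred L a b p) (unred L a b q)"

text \<open>The point 0, where the gap is closed, is always a mark. Hence equivalences of the
  shorter circle fix it and can be extended over the removed arc.\<close>

definition red_marks :: "real \<Rightarrow> real \<Rightarrow> real \<Rightarrow> real set \<Rightarrow> real set" where
  "red_marks L a b M = {p. cong_per (L - (b - a)) 0 p \<or> unred L a b p \<in> M}"

text \<open>The interior of the arc may be glued to the rest only through the class of the ends.
  This makes the relation that remains after the cut a circle gluing again, and lets the two parts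
  be compared separately.\<close>

definition self_contained :: "real \<Rightarrow> (real \<Rightarrow> real \<Rightarrow> bool) \<Rightarrow> real \<Rightarrow> real \<Rightarrow> bool" where
  "self_contained L R a b \<longleftrightarrow> a < b \<and> b < a + L \<and> R a b \<and>
     (\<forall>x y. a < x \<and> x < b \<and> b \<le> y \<and> y < a + L \<and> R x y \<longrightarrow> R a x)"

lemma unred_shift:
  assumes "b - a < L"
  shows "unred L a b (p + of_int k * (L - (b - a))) = unred L a b p + of_int k * L"
proof -
  have "(p + of_int k * (L - (b - a))) / (L - (b - a)) = p / (L - (b - a)) + of_int k"
    using assms by (simp add: add_divide_distrib)
  then have "\<lfloor>(p + of_int k * (L - (b - a))) / (L - (b - a))\<rfloor> = \<lfloor>p / (L - (b - a))\<rfloor> + k" by simp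
  then show ?thesis by (simp add: unred_def algebra_simps)
qed

lemma unred_shift1: "b - a < L \<Longrightarrow> unred L a b (p + (L - (b - a))) = unred L a b p + L"
  using unred_shift[of b a L p 1] by simp

lemma unred_base: "0 \<le> p \<Longrightarrow> p < L - (b - a) \<Longrightarrow> unred L a b p = b + p"
  unfolding unred_def by (simp add: floor_eq_iff)

lemma unred_strict_mono:
  assumes "a < b" "b - a < L" shows "strict_mono (unred L a b)"
proof (rule strict_monoI)
  fix p q :: real assume pq: "p < q"
  have "p / (L - (b - a)) \<le> q / (L - (b - a))" using pq assms by (simp add: divide_right_mono)
  then have "of_int \<lfloor>p / (L - (b - a))\<rfloor> \<le> (of_int \<lfloor>q / (L - (b - a))\<rfloor> :: real)" using floor_mono by simp
  then have "(b - a) * of_int \<lfloor>p / (L - (b - a))\<rfloor> \<le> (b - a) * of_int \<lfloor>q / (L - (b - a))\<rfloor>"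
    using assms by (intro mult_left_mono) auto
  then show "unred L a b p < unred L a b q" using pq unfolding unred_def by linarith
qed

lemma unred_cong_per:
  assumes "a < b" "b - a < L" shows "cong_per L (unred L a b p) (unred L a b q) \<longleftrightarrow> cong_per (L - (b - a)) p q"
proof
  assume "cong_per (L - (b - a)) p q"
  then show "cong_per L (unred L a b p) (unred L a b q)"
    unfolding cong_per_def using unred_shift[OF assms(2), of p] by blast
next
  assume "cong_per L (unred L a b p) (unred L a b q)"
  then obtain k where "unred L a b q = unred L a b p + of_int k * L" unfolding cong_per_def by blast
  then have "unred L a b q = unred L a b (p + of_int k * (L - (b - a)))" using unred_shift[OF assms(2)] by simp
  then have "q = p + of_int k * (L - (b - a))" using strict_mono_eq[OF unred_strict_mono[OF assms]] by blast
  then show "cong_per (L - (b - a)) p q" unfolding cong_per_def by blast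
qed

lemma periodic_red_marks:
  assumes "a < b" "b - a < L" "periodic L M" shows "periodic (L - (b - a)) (red_marks L a b M)"
proof -
  let ?L = "L - (b - a)"
  have "cong_per ?L 0 (x + ?L) \<longleftrightarrow> cong_per ?L 0 x" for x
    using cong_per_trans[of ?L 0 x "x + ?L"] cong_per_trans[of ?L 0 "x + ?L" x] cong_per_sym[OF cong_per_plus_period[of ?L x]]
      cong_per_plus_period[of ?L x] by blast
  moreover have "unred L a b (x + ?L) \<in> M \<longleftrightarrow> unred L a b x \<in> M" for x
    using assms(3) unred_shift1[OF assms(2), of x] unfolding periodic_def by simp
  ultimately show ?thesis unfolding periodic_def red_marks_def by blast
qed

text \<open>The marked end of the arc is lost and the merged point is gained, so the number of marks
  does not grow from one step of the induction to the next.\<close>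

lemma card_red_marks:
  assumes ab: "a < b" "b - a < L" and M: "periodic L M" "finite (M \<inter> {0..<L})" and m: "a \<in> M \<or> b \<in> M"
  shows "finite (red_marks L a b M \<inter> {0..<L - (b - a)})"
    "card (red_marks L a b M \<inter> {0..<L - (b - a)}) \<le> card (M \<inter> {0..<L})"
proof -
  let ?L = "L - (b - a)"
  have L: "L > 0" using ab by simp
  have f: "finite (M \<inter> {0..<0 + L})" using M(2) by simp
  have fa: "finite (M \<inter> {a..<a + L})" by (rule finite_window(1)[OF L M(1) f])
  let ?S = "M \<inter> {b<..<a + L}"
  have fS: "finite ?S" by (rule finite_subset[OF _ fa]) (use ab in auto)
  have sub: "red_marks L a b M \<inter> {0..<?L} \<subseteq> insert 0 ((\<lambda>x. x - b) ` ?S)"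
  proof
    fix p assume p: "p \<in> red_marks L a b M \<inter> {0..<?L}"
    show "p \<in> insert 0 ((\<lambda>x. x - b) ` ?S)"
    proof (cases "cong_per ?L 0 p")
      case True
      then have "0 = p" using cong_per_close_eq[of ?L 0 p] p ab by auto
      then show ?thesis by simp
    next
      case False
      then have "p \<noteq> 0" by auto
      then have "b + p \<in> ?S" using p False unred_base[of p L b a] by (auto simp: red_marks_def)
      then show ?thesis by (intro insertI2 rev_image_eqI[of "b + p"]) auto
    qed
  qed
  show "finite (red_marks L a b M \<inter> {0..<?L})" by (rule finite_subset[OF sub]) (use fS in simp)
  have "card (red_marks L a b M \<inter> {0..<?L}) \<le> card (insert 0 ((\<lambda>x. x - b) ` ?S))"
    by (rule card_mono[OF _ sub]) (use fS in simp)
  also have "\<dots> \<le> Suc (card ((\<lambda>x. x - b) ` ?S))" using fS by (simp add: card_insert_if)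
  also have "\<dots> \<le> Suc (card ?S)" using card_image_le[OF fS] by simp
  also have "\<dots> \<le> card (M \<inter> {a..<a + L})"
  proof -
    obtain c where c: "c \<in> M" "c = a \<or> c = b" using m by blast
    have "insert c ?S \<subseteq> M \<inter> {a..<a + L}" using c ab by auto
    then have "card (insert c ?S) \<le> card (M \<inter> {a..<a + L})" by (rule card_mono[OF fa])
    moreover have "c \<notin> ?S" using c(2) ab by auto
    ultimately show ?thesis using fS by simp
  qed
  also have "\<dots> = card (M \<inter> {0..<L})" using card_window[OF L M(1), of a 0] by simp
  finally show "card (red_marks L a b M \<inter> {0..<?L}) \<le> card (M \<inter> {0..<L})" .
qed

lemma red_marks_0: "0 \<in> red_marks L a b M"
  by (simp add: red_marks_def)

locale circle_cut = circle_gluing +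
  fixes a b
  assumes sc: "self_contained L R a b"
begin

abbreviation "s \<equiv> unred L a b"
abbreviation "L' \<equiv> L - (b - a)"
abbreviation "R' \<equiv> red L a b R"

lemma ab: "a < b" "b < a + L" "R a b" and ab': "b - a < L" and L'_pos: "0 < L'"
  using sc by (auto simp: self_contained_def)

lemma sc_cut: "a < x \<Longrightarrow> x < b \<Longrightarrow> b \<le> y \<Longrightarrow> y < a + L \<Longrightarrow> R x y \<Longrightarrow> R a x"
  using sc unfolding self_contained_def by blast

lemma R_plus_L: "R x (y + L) \<longleftrightarrow> R x y"
  using R_trans[of x y "y + L"] R_trans[of x "y + L" y] R_period[of y] R_sym[OF R_period[of y]] by blast

lemma Ra_iff_Rb: "R x a \<longleftrightarrow> R x b"
  using R_trans[of x a b] R_trans[of x b a] ab(3) R_sym[OF ab(3)] by blast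

lemma cut_back: assumes "b \<le> x" "x < a + L" "a + L < y" "y < b + L" "R x y" shows "R x a"
proof -
  have 1: "R (y - L) x" using R_sym[OF assms(5)] R_sym[of x "y - L"] R_plus_L[of x "y - L"] assms(5) by simp
  have "R a (y - L)" by (rule sc_cut[OF _ _ assms(1,2) 1]) (use assms in auto)
  then show ?thesis by (rule R_sym[OF R_trans[OF _ 1]])
qed

text \<open>The old successor y of x lies before the next copy of the arc, at its start, or after
  its end: if y lay further inside that copy or at its end, x would be in the class of a, and a + L
  would have come first. If y lies after the copy, it is moved back by the length of the
  arc.\<close>

lemma red_germ_base:
  assumes p: "0 \<le> p" "p < L'"
  shows "\<exists>q e. p < q \<and> q \<le> p + L' \<and> R' p q \<and> (\<forall>r. p < r \<and> r < q \<longrightarrow> \<not> R' p r) \<and>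
           0 < e \<and> (\<forall>t. 0 \<le> t \<and> t \<le> e \<longrightarrow> R' (p + t) (q - t))"
proof -
  define x where "x = b + p"
  have sp: "s p = x" using unred_base[OF p] by (simp add: x_def)
  have x: "b \<le> x" "x < a + L" using p by (auto simp: x_def)
  define y where "y = sc x"
  have y: "x < y" "y \<le> x + L" "R x y" "\<And>w. x < w \<Longrightarrow> w < y \<Longrightarrow> \<not> R x w"
    using sc_gt sc_le sc_R sc_min by (auto simp: y_def)
  show ?thesis
  proof (cases "y \<le> a + L")
    case True
    define c where "c = (y - x) / 2"
    have c: "0 < c" "c \<le> (a + L - x) / 2" using y True x by (auto simp: c_def)
    obtain e where e: "e > 0" "e \<le> c" "\<And>t. 0 \<le> t \<Longrightarrow> t \<le> e \<Longrightarrow> R (x + t) (y - t)"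
      using germ_sc'[OF c(1), of x] unfolding y_def by blast
    \<comment> \<open>If y is the start a + L of the next copy, the merged point takes its place,
      and \<open>unred\<close> sends this point to b + L.\<close>
    have Ry: "R x (s (y - b))"
    proof (cases "y = a + L")
      case True
      have "R x a" using y(3) unfolding True using R_plus_L by blast
      then have "R x (b + L)" using Ra_iff_Rb R_plus_L by blast
      moreover have "s (y - b) = b + L" using unred_shift1[OF ab', of 0] unred_base[of 0 L b a] L'_pos True by (simp add: algebra_simps)
      ultimately show ?thesis by simp
    next
      case False
      then have "s (y - b) = y" using True x y(1) by (subst unred_base) auto
      then show ?thesis using y(3) by simp
    qed
    show ?thesis
    proof (rule exI[of _ "y - b"], rule exI[of _ e], intro conjI allI impI)
      show "p < y - b" "y - b \<le> p + L'" "0 < e" using y True p e by (auto simp: x_def)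
      show "R' p (y - b)" using Ry sp by (simp add: red_def)
      fix r assume r: "p < r \<and> r < y - b"
      have "s r = b + r" using r p True by (intro unred_base) auto
      then show "\<not> R' p r" using y(4)[of "b + r"] r sp by (auto simp: red_def x_def)
    next
      fix t assume t: "0 \<le> t \<and> t \<le> e"
      show "R' (p + t) (y - b - t)"
      proof (cases "t = 0")
        case True then show ?thesis using Ry sp by (simp add: red_def)
      next
        case False
        have 1: "s (p + t) = x + t" using t e(2) c p by (subst unred_base) (auto simp: x_def field_simps)
        have 2: "s (y - b - t) = y - t"
          using t False e(2) c(1) \<open>y \<le> a + L\<close> p y(1) by (subst unred_base) (auto simp: x_def c_def field_simps)
        show ?thesis using e(3)[of t] t 1 2 by (simp add: red_def)
      qed
    qed
  next
    case False
    have na: "\<not> R x a" using y(4)[of "a + L"] False x R_plus_L by auto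
    have "y > b + L"
    proof (rule ccontr)
      assume "\<not> y > b + L"
      moreover have "y \<noteq> b + L" using na y(3) Ra_iff_Rb R_plus_L by metis
      ultimately show False using cut_back[OF x _ _ y(3)] False na by auto
    qed
    then have y2: "b + L < y" .
    define q where "q = y - L - b + L'"
    have q: "L' < q" "q \<le> p + L'" using y2 y(2) by (auto simp: q_def x_def)
    have sq: "s (q - t) = y - t" if "0 \<le> t" "t < q - L'" for t
    proof -
      have "s (q - t) = s ((q - t - L') + L')" by simp
      also have "\<dots> = s (q - t - L') + L" by (rule unred_shift1[OF ab'])
      also have "s (q - t - L') = b + (q - t - L')" using that q p by (intro unred_base) auto
      finally show ?thesis by (simp add: q_def)
    qed
    define c where "c = min ((q - L') / 2) ((a + L - x) / 2)"
    have c: "0 < c" using q x by (auto simp: c_def)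
    obtain e where e: "e > 0" "e \<le> c" "\<And>t. 0 \<le> t \<Longrightarrow> t \<le> e \<Longrightarrow> R (x + t) (y - t)"
      using germ_sc'[OF c(1), of x] unfolding y_def by blast
    show ?thesis
    proof (rule exI[of _ q], rule exI[of _ e], intro conjI allI impI)
      show "p < q" "q \<le> p + L'" "0 < e" using q p e by auto
      show "R' p q" using sq[of 0] q y(3) sp by (simp add: red_def)
      fix r assume r: "p < r \<and> r < q"
      have "s p < s r" "s r < s q" using r strict_mono_less[OF unred_strict_mono[OF ab(1) ab']] by blast+
      then show "\<not> R' p r" using y(4)[of "s r"] sq[of 0] q sp by (simp add: red_def)
    next
      fix t assume t: "0 \<le> t \<and> t \<le> e"
      have 1: "s (p + t) = x + t" using t e(2) x p by (subst unred_base) (auto simp: x_def c_def field_simps)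
      have "t < q - L'" using t e(1,2) q by (auto simp: c_def)
      then have 2: "s (q - t) = y - t" using sq t by blast
      show "R' (p + t) (q - t)" using e(3)[of t] t 1 2 by (simp add: red_def)
    qed
  qed
qed

lemma red_shift: "R' (p + of_int i * L') (q + of_int j * L') \<longleftrightarrow> R' p q"
  unfolding red_def unred_shift[OF ab']
  using R_cg[of "s p" "s q" "s p + of_int i * L" "s q + of_int j * L"]
    R_cg[of "s p + of_int i * L" "s q + of_int j * L" "s p" "s q"] cong_per_plus_int[of L "s p" i] cong_per_plus_int[of L "s q" j]
    cong_per_sym[OF cong_per_plus_int[of L "s p" i]] cong_per_sym[OF cong_per_plus_int[of L "s q" j]] by blast

lemma red_germ:
  "\<exists>q e. p < q \<and> q \<le> p + L' \<and> R' p q \<and> (\<forall>r. p < r \<and> r < q \<longrightarrow> \<not> R' p r) \<and>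
           0 < e \<and> (\<forall>t. 0 \<le> t \<and> t \<le> e \<longrightarrow> R' (p + t) (q - t))"
proof -
  define p0 where "p0 = window L' 0 p"
  obtain k where k: "p = p0 + of_int k * L'"
    using cong_per_sym[OF window_cong_per[of L' p 0]] unfolding p0_def cong_per_def by blast
  have p0: "0 \<le> p0" "p0 < L'" using window_in[OF L'_pos, of 0 p] by (auto simp: p0_def)
  obtain q e where q: "p0 < q" "q \<le> p0 + L'" "R' p0 q" "\<And>r. p0 < r \<Longrightarrow> r < q \<Longrightarrow> \<not> R' p0 r"
    "0 < e" "\<And>t. 0 \<le> t \<Longrightarrow> t \<le> e \<Longrightarrow> R' (p0 + t) (q - t)"
    using red_germ_base[OF p0] by (elim exE conjE) blast
  show ?thesis
  proof (rule exI[of _ "q + of_int k * L'"], rule exI[of _ e], intro conjI allI impI)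
    show "p < q + of_int k * L'" "q + of_int k * L' \<le> p + L'" "0 < e" using q k by auto
    show "R' p (q + of_int k * L')" using q(3) red_shift[of p0 k q k] k by simp
    fix r assume r: "p < r \<and> r < q + of_int k * L'"
    then have "\<not> R' p0 (r - of_int k * L')" using q(4) k by simp
    then show "\<not> R' p r" using red_shift[of p0 k "r - of_int k * L'" k] k by simp
  next
    fix t assume t: "0 \<le> t \<and> t \<le> e"
    then have "R' (p0 + t) (q - t)" using q(6) by blast
    then have "R' (p0 + t + of_int k * L') (q - t + of_int k * L')" by (simp only: red_shift)
    then show "R' (p + t) (q + of_int k * L' - t)" unfolding k by (simp add: algebra_simps)
  qed
qed

lemma bij_unred: "bij_betw s {0..<L'} {b..<a + L}"
proof (rule bij_betw_byWitness[where f' = "\<lambda>x. x - b"])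
  show "\<forall>p\<in>{0..<L'}. s p - b = p" by (auto simp: unred_base)
  show "\<forall>x\<in>{b..<a + L}. s (x - b) = x" by (auto simp: unred_base)
  show "s ` {0..<L'} \<subseteq> {b..<a + L}" by (auto simp: unred_base)
  show "(\<lambda>x. x - b) ` {b..<a + L} \<subseteq> {0..<L'}" by auto
qed

lemma bij_unred_on: "bij_betw s ({p. s p \<in> S} \<inter> {0..<L'}) (S \<inter> {b..<a + L})"
proof -
  have "s ` ({p. s p \<in> S} \<inter> {0..<L'}) = S \<inter> {b..<a + L}"
    using bij_betw_imp_surj_on[OF bij_unred] by auto
  then show ?thesis using bij_betw_imp_inj_on[OF bij_unred] unfolding bij_betw_def
    by (auto intro: inj_on_subset)
qed

lemma class_size_red: "class_size L' R' p = card ({y. R (s p) y} \<inter> {b..<a + L})"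
  using bij_betw_same_card[OF bij_unred_on[of "{y. R (s p) y}"]] by (simp add: class_size_def red_def)

lemma fin_cut_class: "finite ({y. R x y} \<inter> {b..<a + L})"
  by (rule finite_subset[OF _ fin_window[of x b]]) (use ab in auto)

lemma class_size_red_le: "class_size L' R' p \<le> size_of (s p)"
  unfolding class_size_red class_size_window[of "s p" b] by (rule card_mono[OF fin_window]) (use ab in auto)

lemma class_size_red_eq:
  assumes p: "0 \<le> p" "p < L'" and n: "\<not> R (s p) a"
  shows "class_size L' R' p = size_of (s p)"
proof -
  have x: "b \<le> s p" "s p < a + L" using p unred_base[OF p] by auto
  have "{y. R (s p) y} \<inter> {b..<a + L} = {y. R (s p) y} \<inter> {b..<b + L}"
  proof (intro subset_antisym subsetI)
    fix y assume y: "y \<in> {y. R (s p) y} \<inter> {b..<b + L}"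
    have "y \<noteq> a + L" using y n R_plus_L by auto
    moreover have "\<not> y > a + L" using cut_back[OF x, of y] y n by auto
    ultimately show "y \<in> {y. R (s p) y} \<inter> {b..<a + L}" using y by auto
  qed (use ab in auto)
  then show ?thesis unfolding class_size_red class_size_window[of "s p" b] by simp
qed

lemma red_gluing: "circle_gluing L' R'"
proof
  show "0 < L'" by (rule L'_pos)
  show "R' x x" for x by (simp add: red_def R_refl)
  show "R' y x" if "R' x y" for x y using that R_sym unfolding red_def by blast
  show "R' x z" if "R' x y" "R' y z" for x y z using that R_trans unfolding red_def by blast
  show "R' x (x + L')" for x unfolding red_def unred_shift1[OF ab'] by (rule R_period)
  show "finite ({y. R' x y} \<inter> {0..<L'})" for x
    using bij_betw_finite[OF bij_unred_on[of "{y. R (s x) y}"]] fin_cut_class[of "s x"] by (simp add: red_def)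
  show "\<exists>q e. p < q \<and> q \<le> p + L' \<and> R' p q \<and> (\<forall>r. p < r \<and> r < q \<longrightarrow> \<not> R' p r) \<and>
           0 < e \<and> (\<forall>t. 0 \<le> t \<and> t \<le> e \<longrightarrow> R' (p + t) (q - t))" for p by (rule red_germ)
  have f0: "finite ({x. size_of x \<noteq> 2} \<inter> {0..<0 + L})" using fin_special by simp
  let ?S = "{x. size_of x \<noteq> 2} \<union> {y. R a y}"
  have "finite ({x. size_of x \<noteq> 2} \<inter> {b..<b + L})" by (rule finite_window(1)[OF L_pos periodic_size f0])
  then have "finite ({x. size_of x \<noteq> 2} \<inter> {b..<a + L})" by (rule rev_finite_subset) (use ab in auto)
  then have "finite (?S \<inter> {b..<a + L})" using fin_cut_class[of a] by (simp add: Int_Un_distrib2)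
  then have f: "finite ({p. s p \<in> ?S} \<inter> {0..<L'})" using bij_betw_finite[OF bij_unred_on] by blast
  show "finite ({x. class_size L' R' x \<noteq> 2} \<inter> {0..<L'})"
  proof (rule finite_subset[OF _ f], rule subsetI)
    fix p assume p: "p \<in> {x. class_size L' R' x \<noteq> 2} \<inter> {0..<L'}"
    show "p \<in> {p. s p \<in> ?S} \<inter> {0..<L'}"
    proof (cases "R (s p) a")
      case True then show ?thesis using p R_sym[OF True] by auto
    next
      case False then show ?thesis using p class_size_red_eq[of p] by auto
    qed
  qed
qed

definition "rest_leaves = {x. size_of x = 1} \<inter> {b<..<a + L}"

lemma finite_rest_leaves: "finite rest_leaves"
proof -
  have f0: "finite ({x. size_of x = 1} \<inter> {0..<0 + L})" using finite_leaves by (simp add: leaves_def)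
  show ?thesis unfolding rest_leaves_def
    by (rule finite_subset[OF _ finite_window(1)[OF L_pos periodic_size f0, of b]]) (use ab in auto)
qed

text \<open>Only the class of the ends loses points by the cut, so the merged point is the only
  possible new leaf, and it is none if that class has another point outside the arc.\<close>

lemma red_leaves_subset:
  "leaves L' R' \<subseteq> insert 0 ((\<lambda>x. x - b) ` rest_leaves)"
  "b < y \<Longrightarrow> y < a + L \<Longrightarrow> R a y \<Longrightarrow> leaves L' R' \<subseteq> (\<lambda>x. x - b) ` rest_leaves"
proof -
  have *: "p \<in> (\<lambda>x. x - b) ` rest_leaves \<or> p = 0 \<and> {y. R a y} \<inter> {b..<a + L} = {b}"
    if p: "p \<in> leaves L' R'" for p
  proof -
    have p1: "class_size L' R' p = 1" "0 \<le> p" "p < L'" using p by (auto simp: leaves_def)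
    have sp: "s p = b + p" by (rule unred_base[OF p1(2,3)])
    show ?thesis
    proof (cases "R (s p) a")
      case True
      obtain w where w: "{y. R (s p) y} \<inter> {b..<a + L} = {w}" using p1(1) unfolding class_size_red by (rule card_1_singletonE)
      have "R (s p) b" using True Ra_iff_Rb by blast
      then have "b \<in> {w}" unfolding w[symmetric] using ab by simp
      moreover have "s p \<in> {w}" unfolding w[symmetric] using R_refl sp p1 by simp
      ultimately have "w = b" "s p = b" by auto
      moreover have "{y. R a y} = {y. R (s p) y}" using class_eq[OF True] by simp
      ultimately show ?thesis using w sp by simp
    next
      case False
      have "p \<noteq> 0" using False sp Ra_iff_Rb[of b] R_refl[of b] by auto
      then have "b + p \<in> rest_leaves" using class_size_red_eq[OF p1(2,3) False] p1 sp by (auto simp: rest_leaves_def)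
      then show ?thesis by (intro disjI1 rev_image_eqI[of "b + p"]) auto
    qed
  qed
  show "leaves L' R' \<subseteq> insert 0 ((\<lambda>x. x - b) ` rest_leaves)" using * by blast
  assume "b < y" "y < a + L" "R a y"
  then have "{y. R a y} \<inter> {b..<a + L} \<noteq> {b}" by auto
  then show "leaves L' R' \<subseteq> (\<lambda>x. x - b) ` rest_leaves" using * by blast
qed

lemma rest_leaves_le:
  assumes "finite A" "A \<subseteq> {x. size_of x = 1} \<inter> {a<..<b}"
  shows "card rest_leaves + card A \<le> card (leaves L R)"
proof -
  have f0: "finite ({x. size_of x = 1} \<inter> {0..<0 + L})" using finite_leaves by (simp add: leaves_def)
  have fw: "finite ({x. size_of x = 1} \<inter> {a..<a + L})" by (rule finite_window(1)[OF L_pos periodic_size f0])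
  have "card rest_leaves + card A = card (rest_leaves \<union> A)"
    by (rule card_Un_disjoint[symmetric, OF finite_rest_leaves assms(1)]) (use assms(2) in \<open>auto simp: rest_leaves_def\<close>)
  also have "\<dots> \<le> card ({x. size_of x = 1} \<inter> {a..<a + L})"
    by (rule card_mono[OF fw]) (use assms(2) ab in \<open>auto simp: rest_leaves_def\<close>)
  also have "\<dots> = card (leaves L R)" unfolding leaves_def using card_window[OF L_pos periodic_size[of "\<lambda>n. n = 1"], of a 0] by simp
  finally show ?thesis .
qed

text \<open>The only possible new leaf is the merged point, and this point is marked.\<close>

lemma red_unmarked_leaves:
  assumes M: "periodic L M"
  shows "card (leaves L' R' - red_marks L a b M) \<le> card (leaves L R - M)"
proof -
  have "leaves L' R' - red_marks L a b M \<subseteq> (\<lambda>x. x - b) ` (rest_leaves - M)"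
  proof
    fix p assume p: "p \<in> leaves L' R' - red_marks L a b M"
    then have "p \<noteq> 0" using red_marks_0 by auto
    then obtain x where x: "x \<in> rest_leaves" "p = x - b" using red_leaves_subset(1) p by auto
    have "unred L a b p = x" using x by (subst unred_base) (auto simp: rest_leaves_def)
    then have "x \<notin> M" using p by (auto simp: red_marks_def)
    then show "p \<in> (\<lambda>x. x - b) ` (rest_leaves - M)" using x by blast
  qed
  then have "card (leaves L' R' - red_marks L a b M) \<le> card ((\<lambda>x. x - b) ` (rest_leaves - M))"
    by (rule card_mono[rotated]) (use finite_rest_leaves in simp)
  also have "\<dots> \<le> card (rest_leaves - M)" by (rule card_image_le) (use finite_rest_leaves in simp)
  also have "\<dots> \<le> card (leaves L R - M)"
  proof (rule card_inj_on_le[where f = "window L 0"])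
    show "inj_on (window L 0) (rest_leaves - M)"
    proof (rule inj_onI)
      fix x y assume xy: "x \<in> rest_leaves - M" "y \<in> rest_leaves - M" "window L 0 x = window L 0 y"
      then have "cg x y" using window_eq_iff[OF L_pos] by blast
      then show "x = y" by (rule cong_per_close_eq[OF L_pos]) (use xy ab in \<open>auto simp: rest_leaves_def\<close>)
    qed
    show "window L 0 ` (rest_leaves - M) \<subseteq> leaves L R - M"
    proof (rule image_subsetI)
      fix x assume x: "x \<in> rest_leaves - M"
      have "size_of (window L 0 x) = size_of x" by (rule class_size_cg[OF cong_per_sym[OF window_cong_per]])
      then show "window L 0 x \<in> leaves L R - M"
        using x window_in[OF L_pos, of 0 x] window_mem[OF M, of 0 x] by (auto simp: leaves_def rest_leaves_def)
    qed
    show "finite (leaves L R - M)" by simp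
  qed
  finally show ?thesis .
qed

lemma red_one_unmarked:
  assumes M: "periodic L M" and one_unmarked: "\<And>x y. R x y \<Longrightarrow> size_of x \<ge> 3 \<Longrightarrow> x \<notin> M \<Longrightarrow> y \<notin> M \<Longrightarrow> cg x y"
    and p: "R' p q" "class_size L' R' p \<ge> 3" "p \<notin> red_marks L a b M" "q \<notin> red_marks L a b M"
  shows "cong_per L' p q"
proof -
  have "cg (s p) (s q)"
    by (rule one_unmarked) (use p class_size_red_le[of p] in \<open>auto simp: red_def red_marks_def\<close>)
  then show ?thesis using unred_cong_per[OF ab(1) ab'] by blast
qed

end

lemma extend_periodic:
  fixes F :: "real \<Rightarrow> real"
  assumes L: "L > 0" and mono: "strict_mono_on {a..<a + L} F" and im: "F ` {a..<a + L} = {a..<a + L}"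
  defines "\<phi> \<equiv> \<lambda>x. F (window L a x) + (x - window L a x)"
  shows "strict_mono \<phi>" "surj \<phi>" "\<phi> (x + L) = \<phi> x + L" "cong_per L (F (window L a x)) (\<phi> x)"
proof -
  have win: "window L a x \<in> {a..<a + L}" for x by (rule window_in[OF L])
  have Fin: "F (window L a x) \<in> {a..<a + L}" for x using win[of x] im by blast
  have wL: "window L a (x + L) = window L a x" for x using window_eq_iff[OF L, of a "x + L" x] cong_per_sym[OF cong_per_plus_period] by blast
  show "\<phi> (x + L) = \<phi> x + L" by (simp add: \<phi>_def wL)
  have "\<phi> x = F (window L a x) + of_int \<lfloor>(x - a) / L\<rfloor> * L" for x by (simp add: \<phi>_def window_def)
  then show "cong_per L (F (window L a x)) (\<phi> x)" by simp
  show "strict_mono \<phi>"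
  proof (rule strict_monoI)
    fix x y :: real assume xy: "x < y"
    define i where "i = \<lfloor>(x - a) / L\<rfloor>"
    define j where "j = \<lfloor>(y - a) / L\<rfloor>"
    have i: "x - window L a x = of_int i * L" and j: "y - window L a y = of_int j * L" by (auto simp: i_def j_def window_def)
    have "i \<le> j" unfolding i_def j_def using xy L by (intro floor_mono divide_right_mono) auto
    show "\<phi> x < \<phi> y"
    proof (cases "i = j")
      case True
      then have "window L a x < window L a y" using i j xy by simp
      then have "F (window L a x) < F (window L a y)" using mono win by (auto simp: strict_mono_on_def)
      then show ?thesis using i j True by (simp add: \<phi>_def)
    next
      case False
      then have "of_int (i + 1) * L \<le> of_int j * L" using \<open>i \<le> j\<close> L by (intro mult_right_mono) auto
      then show ?thesis unfolding \<phi>_def i j using Fin[of x] Fin[of y] by (simp add: algebra_simps)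
    qed
  qed
  show "surj \<phi>" unfolding surj_def
  proof
    fix z
    obtain w where w: "w \<in> {a..<a + L}" "F w = window L a z" using im win[of z] by (metis imageE)
    obtain k where k: "window L a z = z + of_int k * L" using window_cong_per[of L z a] unfolding cong_per_def by blast
    define x where "x = w - of_int k * L"
    have "cong_per L x w" using cong_per_plus_int[of L x k] by (simp add: x_def)
    then have "window L a x = window L a w" using window_eq_iff[OF L] by blast
    then have "window L a x = w" using w(1) window_id[OF L, of a w] by simp
    then have "\<phi> x = z" using w(2) k by (simp add: \<phi>_def x_def)
    then show "\<exists>x. z = \<phi> x" by blast
  qed
qed

text \<open>The map of the shorter circle fixes the merged mark and \<psi> fixes both ends, so they
  fit together. In both gluings a relation between the arc and the rest passes through the class of
  a, hence it is preserved as well.\<close>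

lemma comb_equiv_of_red:
  assumes c1: "circle_cut L R1 a b" and c2: "circle_cut L R2 a b" and M: "periodic L M"
    and eqv: "comb_equiv (L - (b - a)) (red_marks L a b M) (red L a b R1) (red L a b R2)"
    and \<psi>: "strict_mono_on {a..b} \<psi>" "\<psi> ` {a..b} = {a..b}" "\<psi> a = a" "\<psi> b = b"
      "\<And>m. m \<in> M \<Longrightarrow> a \<le> m \<Longrightarrow> m \<le> b \<Longrightarrow> \<psi> m = m"
      "\<And>x y. x \<in> {a..b} \<Longrightarrow> y \<in> {a..b} \<Longrightarrow> R1 x y \<longleftrightarrow> R2 (\<psi> x) (\<psi> y)"
  shows "comb_equiv L M R1 R2"
proof -
  interpret A: circle_cut L R1 a b by (rule c1)
  interpret B: circle_cut L R2 a b by (rule c2)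
  let ?L = "L - (b - a)"
  note L = A.L_pos note ab = A.ab note L' = A.L'_pos
  obtain f where f: "strict_mono f" "surj f" "\<And>x. f (x + ?L) = f x + ?L" "\<And>m. m \<in> red_marks L a b M \<Longrightarrow> f m = m"
    "\<And>x y. red L a b R1 x y \<longleftrightarrow> red L a b R2 (f x) (f y)" using eqv unfolding comb_equiv_def by blast
  have f0: "f 0 = 0" by (rule f(4)[OF red_marks_0])
  have fL: "f ?L = ?L" using f(3)[of 0] f0 by simp
  have fin: "f p \<in> {0..<?L} \<longleftrightarrow> p \<in> {0..<?L}" for p
    using strict_mono_less_eq[OF f(1), of 0 p] strict_mono_less[OF f(1), of p ?L] f0 fL by auto
  define F where "F x = (if x < b then \<psi> x else b + f (x - b))" for x
  have psi_in: "\<psi> x \<in> {a..<b}" if x: "a \<le> x" "x < b" for x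
  proof -
    have "\<psi> x \<in> {a..b}" using \<psi>(2) x by auto
    moreover have "\<psi> x < \<psi> b" using \<psi>(1) x by (auto simp: strict_mono_on_def)
    ultimately show ?thesis using \<psi>(4) by auto
  qed
  have f_in: "b + f (x - b) \<in> {b..<a + L}" if "b \<le> x" "x < a + L" for x
    using fin[of "x - b"] that by auto
  have mono: "strict_mono_on {a..<a + L} F"
  proof (rule strict_mono_onI)
    fix x y assume xy: "x \<in> {a..<a + L}" "y \<in> {a..<a + L}" "x < y"
    consider "y < b" | "x < b" "b \<le> y" | "b \<le> x" by linarith
    then show "F x < F y"
    proof cases
      case 1 then show ?thesis using xy \<psi>(1) by (auto simp: F_def strict_mono_on_def)
    next
      case 2 then show ?thesis using xy psi_in[of x] f_in[of y] by (auto simp: F_def)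
    next
      case 3 then show ?thesis using xy strict_mono_less[OF f(1), of "x - b" "y - b"] by (auto simp: F_def)
    qed
  qed
  have im: "F ` {a..<a + L} = {a..<a + L}"
  proof
    show "F ` {a..<a + L} \<subseteq> {a..<a + L}"
    proof (rule image_subsetI)
      fix x assume x: "x \<in> {a..<a + L}"
      show "F x \<in> {a..<a + L}" using x psi_in[of x] f_in[of x] ab by (cases "x < b") (auto simp: F_def)
    qed
    show "{a..<a + L} \<subseteq> F ` {a..<a + L}"
    proof
      fix z assume z: "z \<in> {a..<a + L}"
      show "z \<in> F ` {a..<a + L}"
      proof (cases "z < b")
        case True
        then obtain x where x: "x \<in> {a..b}" "\<psi> x = z" using \<psi>(2) z by (metis atLeastAtMost_iff atLeastLessThan_iff imageE less_imp_le)
        have "x \<noteq> b" using x(2) \<psi>(4) True by auto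
        then have "F x = z" "x \<in> {a..<a + L}" using x ab by (auto simp: F_def)
        then show ?thesis by blast
      next
        case False
        obtain p where p: "f p = z - b" using f(2) by (metis surjD)
        have "p \<in> {0..<?L}" using fin[of p] p z False by auto
        then have "F (p + b) = z" "p + b \<in> {a..<a + L}" using p ab by (auto simp: F_def)
        then show ?thesis by blast
      qed
    qed
  qed
  define \<phi> where "\<phi> x = F (window L a x) + (x - window L a x)" for x
  note ext = extend_periodic[OF L mono im, folded \<phi>_def]
  have hi: "R1 x y \<longleftrightarrow> R2 (F x) (F y)" if x: "b \<le> x" "x < a + L" and y: "b \<le> y" "y < a + L" for x y
  proof -
    have u: "unred L a b (x - b) = x" "unred L a b (y - b) = y" using x y by (simp_all add: unred_base)
    have v: "unred L a b (f (x - b)) = F x" "unred L a b (f (y - b)) = F y"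
      using fin[of "x - b"] fin[of "y - b"] x y by (simp_all add: unred_base F_def)
    show ?thesis using f(5)[of "x - b" "y - b"] unfolding red_def u v .
  qed
  have Fb: "F b = b" by (simp add: F_def f0)
  have mix: "R1 x y \<longleftrightarrow> R2 (F x) (F y)" if x: "a \<le> x" "x < b" and y: "b \<le> y" "y < a + L" for x y
  proof -
    have Fx: "F x = \<psi> x" "\<psi> x \<in> {a..<b}" using x psi_in[of x] by (auto simp: F_def)
    have Fy: "F y \<in> {b..<a + L}" using y f_in[of y] by (auto simp: F_def)
    have 1: "R1 x y \<longleftrightarrow> R1 x a \<and> R1 a y"
    proof
      assume R: "R1 x y"
      have "R1 a x" by (cases "x = a") (use A.R_refl A.sc_cut[OF _ x(2) y R] x in auto)
      then show "R1 x a \<and> R1 a y" using A.R_sym A.R_trans R by blast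
    qed (use A.R_trans in blast)
    have 2: "R2 (F x) (F y) \<longleftrightarrow> R2 (F x) a \<and> R2 a (F y)"
    proof
      assume R: "R2 (F x) (F y)"
      have "R2 a (F x)" by (cases "F x = a") (use B.R_refl B.sc_cut[of "F x" "F y"] R Fx Fy in auto)
      then show "R2 (F x) a \<and> R2 a (F y)" using B.R_sym B.R_trans R by blast
    qed (use B.R_trans in blast)
    have 3: "R1 x a \<longleftrightarrow> R2 (F x) a" using \<psi>(6)[of x a] x ab \<psi>(3) Fx by simp
    have "R1 a y \<longleftrightarrow> R1 b y" using A.Ra_iff_Rb[of y] A.R_sym by blast
    also have "\<dots> \<longleftrightarrow> R2 b (F y)" using hi[of b y] y ab Fb by simp
    also have "\<dots> \<longleftrightarrow> R2 a (F y)" using B.Ra_iff_Rb[of "F y"] B.R_sym by blast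
    finally show ?thesis using 1 2 3 by blast
  qed
  have base: "R1 x y \<longleftrightarrow> R2 (F x) (F y)" if x: "x \<in> {a..<a + L}" and y: "y \<in> {a..<a + L}" for x y
  proof -
    consider "x < b" "y < b" | "x < b" "b \<le> y" | "b \<le> x" "y < b" | "b \<le> x" "b \<le> y" by linarith
    then show ?thesis
    proof cases
      case 1 then show ?thesis using \<psi>(6)[of x y] x y by (simp add: F_def)
    next
      case 2 then show ?thesis using mix[of x y] x y by simp
    next
      case 3
      then have "R1 y x \<longleftrightarrow> R2 (F y) (F x)" using mix[of y x] x y by simp
      then show ?thesis using A.R_sym B.R_sym by blast
    next
      case 4 then show ?thesis using hi[of x y] x y by simp
    qed
  qed
  show ?thesis unfolding comb_equiv_def
  proof (intro exI[of _ \<phi>] conjI allI ballI)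
    show "strict_mono \<phi>" "surj \<phi>" by (rule ext)+
    show "\<phi> (x + L) = \<phi> x + L" for x by (rule ext)
    show "\<phi> m = m" if m: "m \<in> M" for m
    proof -
      let ?w = "window L a m"
      have w: "?w \<in> M" "a \<le> ?w" "?w < a + L" using m window_mem[OF M, of a m] window_in[OF L, of a m] by auto
      have "F ?w = ?w"
      proof (cases "?w < b")
        case True then show ?thesis using \<psi>(5)[OF w(1)] w by (simp add: F_def)
      next
        case False
        have "unred L a b (?w - b) = ?w" using False w by (simp add: unred_base)
        then have "?w - b \<in> red_marks L a b M" using w by (simp add: red_marks_def)
        then show ?thesis using f(4) False by (simp add: F_def)
      qed
      then show ?thesis by (simp add: \<phi>_def)
    qed
    show "R1 x y \<longleftrightarrow> R2 (\<phi> x) (\<phi> y)" for x y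
    proof -
      have "R1 x y \<longleftrightarrow> R1 (window L a x) (window L a y)"
        using A.R_cg[OF _ window_cong_per window_cong_per, of x y a a] A.R_cg[OF _ cong_per_sym[OF window_cong_per] cong_per_sym[OF window_cong_per], of a x a y] by blast
      also have "\<dots> \<longleftrightarrow> R2 (F (window L a x)) (F (window L a y))" by (rule base[OF window_in[OF L] window_in[OF L]])
      also have "\<dots> \<longleftrightarrow> R2 (\<phi> x) (\<phi> y)"
        using B.R_cg[OF _ ext(4)[of x] ext(4)[of y]] B.R_cg[OF _ cong_per_sym[OF ext(4)[of x]] cong_per_sym[OF ext(4)[of y]]] by blast
      finally show ?thesis .
    qed
  qed
qed

section \<open>The gluings to be counted and their behaviour under cuts\<close>

definition one_unmarked :: "real \<Rightarrow> real set \<Rightarrow> (real \<Rightarrow> real \<Rightarrow> bool) \<Rightarrow> bool" where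
  "one_unmarked L M R \<longleftrightarrow> (\<forall>x y. R x y \<longrightarrow> class_size L R x \<ge> 3 \<longrightarrow> x \<notin> M \<longrightarrow> y \<notin> M \<longrightarrow> cong_per L x y)"

definition mark_flat :: "real \<Rightarrow> real set \<Rightarrow> (real \<Rightarrow> real \<Rightarrow> bool) \<Rightarrow> bool" where
  "mark_flat L M R \<longleftrightarrow> (\<forall>x y. R x y \<longrightarrow> class_size L R x = 2 \<longrightarrow> x \<in> M \<longrightarrow> y \<in> M)"

text \<open>The last condition is what Gauss-Bonnet leaves of the geometry: an unmarked leaf has
  curvature \<pi>, the total is at most 4 \<pi>, and four such leaves leave no curvature for
  anything else. Shorter circles have no angles, so the alternative is carried along instead; after
  a cut that removes a leaf its first case holds.\<close>

definition family :: "real \<Rightarrow> real set \<Rightarrow> nat \<Rightarrow> (real \<Rightarrow> real \<Rightarrow> bool) set" where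
  "family L M k = {R. circle_gluing L R \<and> one_unmarked L M R \<and> card (leaves L R) \<le> k \<and>
     (card (leaves L R - M) \<le> 3 \<or> card (leaves L R) \<le> 4 \<and> mark_flat L M R)}"

text \<open>Two branches that meet at a point p in the stretch between consecutive marks, which is
  an edge when the marks are the vertices. No label determines p, but a alone determines b.\<close>

definition belt :: "real \<Rightarrow> real set \<Rightarrow> (real \<Rightarrow> real \<Rightarrow> bool) \<Rightarrow> real \<Rightarrow> real \<Rightarrow> bool" where
  "belt L M R a b \<longleftrightarrow> card (leaves L R) = 4 \<and> a \<in> M \<and> b \<in> M \<and> (\<forall>m\<in>M. \<not> (a < m \<and> m < b)) \<and>
     (\<exists>p. branch L R a p \<and> branch L R p b \<and> class_size L R p = 3)"

context circle_gluing begin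

lemma cut_of_branch: assumes "branch L R a b" shows "circle_cut L R a b"
proof
  show "self_contained L R a b" unfolding self_contained_def
  proof (intro conjI allI impI)
    show "a < b" "b < a + L" "R a b" using branch_ends[OF assms] by blast+
    fix x y assume xy: "a < x \<and> x < b \<and> b \<le> y \<and> y < a + L \<and> R x y"
    then have "y = x \<or> y = a + b - x" using branch_closed[OF assms, of x y] by auto
    then show "R a x" using xy by auto
  qed
qed

text \<open>The junction has a point off the branch. This prevents the merged point from becoming a
  leaf when the branch is cut out.\<close>

lemma third_point:
  assumes b: "branch L R a b" obtains y where "b < y" "y < a + L" "R a y"
proof -
  note e = branch_ends[OF b]
  have "\<not> {y. R a y} \<inter> {a..<a + L} \<subseteq> {a, b}"
  proof
    assume "{y. R a y} \<inter> {a..<a + L} \<subseteq> {a, b}"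
    then have "card ({y. R a y} \<inter> {a..<a + L}) \<le> card {a, b}" by (intro card_mono) auto
    also have "\<dots> \<le> 2" by (simp add: card_insert_if)
    finally show False using e(4) class_size_window[of a a] by simp
  qed
  then obtain y where "y \<in> {y. R a y} \<inter> {a..<a + L}" "y \<notin> {a, b}" by blast
  then have y: "R a y" "a \<le> y" "y < a + L" "y \<noteq> a" "y \<noteq> b" by auto
  have "\<not> y < b"
  proof
    assume "y < b"
    then have "a = y \<or> a = a + b - y" using branch_closed[OF b _ _ R_sym[OF y(1)], of] y e by auto
    then show False using y by auto
  qed
  then have "b < y" using y(5) by simp
  then show thesis using that y by blast
qed

lemma leaf_of_branch: "branch L R a b \<Longrightarrow> size_of ((a + b) / 2) = 1"
  by (simp add: branch_def)

lemma red_family: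
  assumes cut: "circle_cut L R a b" and M: "periodic L M" and R: "one_unmarked L M R"
    and l: "card (leaves (L - (b - a)) (red L a b R)) \<le> k"
      "card (leaves (L - (b - a)) (red L a b R)) \<le> 3 \<or> card (leaves L R - M) \<le> 3"
  shows "red L a b R \<in> family (L - (b - a)) (red_marks L a b M) k"
proof -
  interpret circle_cut L R a b by (rule cut)
  interpret r: circle_gluing "L - (b - a)" "red L a b R" by (rule red_gluing)
  have "one_unmarked (L - (b - a)) (red_marks L a b M) (red L a b R)"
    unfolding one_unmarked_def by (intro allI impI red_one_unmarked[OF M]) (use R in \<open>auto simp: one_unmarked_def\<close>)
  moreover have "card (leaves (L - (b - a)) (red L a b R) - red_marks L a b M) \<le> 3"
    using l(2)
  proof
    assume "card (leaves (L - (b - a)) (red L a b R)) \<le> 3"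
    moreover have "card (leaves (L - (b - a)) (red L a b R) - red_marks L a b M) \<le> card (leaves (L - (b - a)) (red L a b R))"
      by (rule card_mono) auto
    ultimately show ?thesis by linarith
  qed (use red_unmarked_leaves[OF M] in linarith)
  ultimately show ?thesis using l(1) r.circle_gluing_axioms by (simp add: family_def)
qed

lemma red_branch_family:
  assumes b: "branch L R a b" and M: "periodic L M" and R: "R \<in> family L M (Suc k)"
  shows "red L a b R \<in> family (L - (b - a)) (red_marks L a b M) k"
proof -
  interpret circle_cut L R a b by (rule cut_of_branch[OF b])
  obtain y where y: "b < y" "y < a + L" "R a y" using third_point[OF b] .
  have "card (leaves (L - (b - a)) (red L a b R)) \<le> card ((\<lambda>x. x - b) ` rest_leaves)"
    by (rule card_mono[OF _ red_leaves_subset(2)[OF y]]) (simp add: finite_rest_leaves)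
  also have "\<dots> \<le> card rest_leaves" by (rule card_image_le[OF finite_rest_leaves])
  finally have 1: "card (leaves (L - (b - a)) (red L a b R)) \<le> card rest_leaves" .
  have "card rest_leaves + card {(a + b) / 2} \<le> card (leaves L R)"
    by (rule rest_leaves_le) (use leaf_of_branch[OF b] ab(1) in auto)
  then have 2: "card (leaves (L - (b - a)) (red L a b R)) + 1 \<le> card (leaves L R)" using 1 by simp
  show ?thesis
    by (rule red_family[OF circle_cut_axioms M]) (use R 2 in \<open>auto simp: family_def\<close>)
qed

text \<open>The class of p is {a, p, b}, since all other points between a and b have classes of size
  at most 2. If b came around to a + L, only a and p would remain, against size 3.\<close>

lemma belt_facts:
  assumes ap: "branch L R a p" and pb: "branch L R p b" and p3: "size_of p = 3"
  shows "circle_cut L R a b" "a < p" "p < b"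
    "\<And>x y. x \<in> {a..b} \<Longrightarrow> y \<in> {a..b} \<Longrightarrow> R x y \<longleftrightarrow>
       x = y \<or> x \<le> p \<and> y \<le> p \<and> y = a + p - x \<or> p \<le> x \<and> p \<le> y \<and> y = p + b - x \<or> x = a \<and> y = b \<or> x = b \<and> y = a"
proof -
  note e = branch_ends[OF ap] and e' = branch_ends[OF pb]
  show "a < p" "p < b" using e e' by blast+
  have Rab: "R a b" by (rule R_trans[OF e(3) e'(3)])
  have in1: "size_of z \<le> 2" if z: "a < z" "z < p" for z
  proof (cases "z = (a + p) / 2")
    case True show ?thesis unfolding True using leaf_of_branch[OF ap] by simp
  next
    case False then show ?thesis using ap z unfolding branch_def by auto
  qed
  have in2: "size_of z \<le> 2" if z: "p < z" "z < b" for z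
  proof (cases "z = (p + b) / 2")
    case True show ?thesis unfolding True using leaf_of_branch[OF pb] by simp
  next
    case False then show ?thesis using pb z unfolding branch_def by auto
  qed
  have bL: "b < a + L"
  proof (rule ccontr)
    assume n: "\<not> b < a + L"
    have "{y. R p y} \<inter> {a..<a + L} \<subseteq> {a, p}"
    proof
      fix y assume y: "y \<in> {y. R p y} \<inter> {a..<a + L}"
      then have "size_of y = 3" using class_size_R[of p y] p3 by simp
      then show "y \<in> {a, p}" using in1[of y] in2[of y] y n by (cases "y = a"; cases "y = p"; cases "y < p") auto
    qed
    then have "card ({y. R p y} \<inter> {a..<a + L}) \<le> card {a, p}" by (intro card_mono) auto
    also have "\<dots> \<le> 2" by (simp add: card_insert_if)
    finally show False using p3 class_size_window[of p a] by simp
  qed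
  have out1: "y = x \<or> y = a + p - x" if "a < x" "x < p" "R x y" "a \<le> y" "y < a + L" for x y
    by (rule branch_closed[OF ap that])
  have out2: "y = x \<or> y = p + b - x" if "p < x" "x < b" "R x y" "p \<le> y" "y < p + L" for x y
    by (rule branch_closed[OF pb that])
  show "circle_cut L R a b"
  proof
    show "self_contained L R a b" unfolding self_contained_def
    proof (intro conjI allI impI)
      show "a < b" "b < a + L" "R a b" using e e' bL Rab by auto
      fix x y assume xy: "a < x \<and> x < b \<and> b \<le> y \<and> y < a + L \<and> R x y"
      consider "x < p" | "x = p" | "p < x" by linarith
      then show "R a x"
      proof cases
        case 1 then show ?thesis using out1[of x y] xy e e' by auto
      next
        case 2 then show ?thesis using e(3) by simp
      next
        case 3 then show ?thesis using out2[of x y] xy e e' by auto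
      qed
    qed
  qed
  fix x y assume x: "x \<in> {a..b}" and y: "y \<in> {a..b}"
  show "R x y \<longleftrightarrow> x = y \<or> x \<le> p \<and> y \<le> p \<and> y = a + p - x \<or> p \<le> x \<and> p \<le> y \<and> y = p + b - x \<or> x = a \<and> y = b \<or> x = b \<and> y = a"
    (is "_ \<longleftrightarrow> ?S")
  proof
    assume ?S
    then consider "x = y" | "x \<le> p" "y \<le> p" "y = a + p - x" | "p \<le> x" "p \<le> y" "y = p + b - x" | "x = a" "y = b" | "x = b" "y = a"
      by blast
    then show "R x y"
    proof cases
      case 1 then show ?thesis using R_refl[of x] by simp
    next
      case 2 then show ?thesis using branch_rel[OF ap, of x y] x y by simp
    next
      case 3 then show ?thesis using branch_rel[OF pb, of x y] x y by simp
    next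
      case 4 then show ?thesis using Rab by simp
    next
      case 5 then show ?thesis using R_sym[OF Rab] by simp
    qed
  next
    assume R: "R x y"
    consider "x \<le> p" "y \<le> p" | "p \<le> x" "p \<le> y" | "x < p" "p < y" | "p < x" "y < p" by linarith
    then show ?S
    proof cases
      case 1 then show ?thesis using branch_rel[OF ap, of x y] x y R by auto
    next
      case 2 then show ?thesis using branch_rel[OF pb, of x y] x y R by auto
    next
      case 3
      have xa: "x = a" using out1[of x y] 3 x y R bL by force
      have "size_of y = 3" using p3 class_size_R[OF R] class_size_R[OF e(3)] xa by simp
      then have "y = b" using in2[of y] 3 y by fastforce
      then show ?thesis using xa by blast
    next
      case 4
      have ya: "y = a" using out1[of y x] 4 x y R_sym[OF R] bL by force
      have "size_of x = 3" using p3 class_size_R[OF R] class_size_R[OF e(3)] ya by simp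
      then have "x = b" using in2[of x] 4 x by fastforce
      then show ?thesis using ya by blast
    qed
  qed
qed

text \<open>Two leaves disappear, and the merged point, to which the class {a, p, b} shrinks, may be
  a new one: 4 - 2 + 1 = 3.\<close>

lemma red_belt_family:
  assumes b: "belt L M R a b" and M: "periodic L M" and R: "one_unmarked L M R"
  shows "red L a b R \<in> family (L - (b - a)) (red_marks L a b M) 3"
proof -
  obtain p where p: "branch L R a p" "branch L R p b" "size_of p = 3" using b unfolding belt_def by blast
  note bf = belt_facts[OF p]
  interpret circle_cut L R a b by (rule bf)
  have "card (leaves (L - (b - a)) (red L a b R)) \<le> card (insert 0 ((\<lambda>x. x - b) ` rest_leaves))"
    by (rule card_mono[OF _ red_leaves_subset(1)]) (simp add: finite_rest_leaves)
  also have "\<dots> \<le> Suc (card ((\<lambda>x. x - b) ` rest_leaves))" by (simp add: card_insert_if finite_rest_leaves)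
  also have "\<dots> \<le> Suc (card rest_leaves)" using card_image_le[OF finite_rest_leaves] by simp
  finally have 1: "card (leaves (L - (b - a)) (red L a b R)) \<le> Suc (card rest_leaves)" .
  have "card rest_leaves + card {(a + p) / 2, (p + b) / 2} \<le> card (leaves L R)"
    by (rule rest_leaves_le) (use leaf_of_branch[OF p(1)] leaf_of_branch[OF p(2)] bf(2,3) in auto)
  moreover have "card {(a + p) / 2, (p + b) / 2} = 2" using bf(2,3) by simp
  ultimately have 2: "card (leaves (L - (b - a)) (red L a b R)) \<le> 3" using 1 b by (simp add: belt_def)
  show ?thesis by (rule red_family[OF circle_cut_axioms M R 2]) (use 2 in simp)
qed

end

lemma comb_equiv_of_red_branch:
  assumes R: "circle_gluing L R1" "circle_gluing L R2" and b: "branch L R1 a b" "branch L R2 a b"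
    and M: "periodic L M"
    and e: "comb_equiv (L - (b - a)) (red_marks L a b M) (red L a b R1) (red L a b R2)"
  shows "comb_equiv L M R1 R2"
proof (rule comb_equiv_of_red[OF _ _ M e, where \<psi> = "\<lambda>x. x"])
  show "circle_cut L R1 a b" "circle_cut L R2 a b"
    by (rule circle_gluing.cut_of_branch[OF R(1) b(1)], rule circle_gluing.cut_of_branch[OF R(2) b(2)])
  fix x y assume xy: "x \<in> {a..b}" "y \<in> {a..b}"
  show "R1 x y \<longleftrightarrow> R2 x y"
    using circle_gluing.branch_rel[OF R(1) b(1), of x y] circle_gluing.branch_rel[OF R(2) b(2), of x y] xy by auto
qed (auto simp: strict_mono_on_def)

text \<open>Matches two belts on the same arc whose inner points p and p' differ. Being affine on
  [a, p] and on [p, b], the map commutes with the folds of both branches; the disjunctions set aside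
  arguments whose mirror image lies on the other piece.\<close>

lemma piecewise_mono:
  fixes a p b p' :: real
  assumes p: "a < p" "p < b" "a < p'" "p' < b"
  defines "\<psi> \<equiv> \<lambda>x. if x \<le> p then a + (x - a) * ((p' - a) / (p - a)) else p' + (x - p) * ((b - p') / (b - p))"
  shows "strict_mono \<psi>" "\<psi> a = a" "\<psi> b = b" "\<psi> p = p'" "\<psi> ` {a..b} = {a..b}"
    "x \<le> p \<Longrightarrow> \<psi> (a + p - x) = a + p' - \<psi> x \<or> a + p - x > p" "p \<le> x \<Longrightarrow> \<psi> (p + b - x) = p' + b - \<psi> x \<or> p + b - x < p"
proof -
  define c d where "c = (p' - a) / (p - a)" and "d = (b - p') / (b - p)"
  have cd: "c > 0" "d > 0" using p by (simp_all add: c_def d_def)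
  have cp: "(p - a) * c = p' - a" "(b - p) * d = b - p'" using p by (simp_all add: c_def d_def)
  have psi: "\<psi> x = (if x \<le> p then a + (x - a) * c else p' + (x - p) * d)" for x by (simp add: \<psi>_def c_def d_def)
  have psi2: "\<psi> x = p' + (x - p) * d" if "p \<le> x" for x using cp that by (cases "x = p") (auto simp: psi)
  show mono: "strict_mono \<psi>"
  proof (rule strict_monoI)
    fix x y :: real assume xy: "x < y"
    consider "y \<le> p" | "x \<le> p" "p < y" | "p < x" by linarith
    then show "\<psi> x < \<psi> y"
    proof cases
      case 1 then show ?thesis using xy cd by (simp add: psi)
    next
      case 2
      have "(x - a) * c \<le> (p - a) * c" using 2 cd by (intro mult_right_mono) auto
      moreover have "0 < (y - p) * d" using 2 cd by simp
      ultimately show ?thesis using 2 cp by (simp add: psi)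
    next
      case 3 then show ?thesis using xy cd by (simp add: psi)
    qed
  qed
  show a: "\<psi> a = a" using p by (simp add: psi)
  show b: "\<psi> b = b" using p cp by (simp add: psi)
  show "\<psi> p = p'" using cp by (simp add: psi)
  show "\<psi> ` {a..b} = {a..b}"
  proof
    show "\<psi> ` {a..b} \<subseteq> {a..b}"
      using strict_mono_less_eq[OF mono, of a] strict_mono_less_eq[OF mono, of _ b] a b by auto
    show "{a..b} \<subseteq> \<psi> ` {a..b}"
    proof
      fix z assume z: "z \<in> {a..b}"
      show "z \<in> \<psi> ` {a..b}"
      proof (cases "z \<le> p'")
        case True
        have "(z - a) / c \<le> p - a" using True cd cp by (simp add: divide_le_eq)
        then have "\<psi> (a + (z - a) / c) = z" using cd by (simp add: psi)
        moreover have "0 \<le> (z - a) / c" using z cd by simp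
        ultimately show ?thesis using \<open>(z - a) / c \<le> p - a\<close> p by (intro rev_image_eqI[of "a + (z - a) / c"]) auto
      next
        case False
        have 0: "(z - p') / d > 0" using False cd by simp
        then have "\<psi> (p + (z - p') / d) = z" using cd by (simp add: psi)
        moreover have "(z - p') / d \<le> b - p" using z cd cp by (simp add: divide_le_eq)
        ultimately show ?thesis using 0 p by (intro rev_image_eqI[of "p + (z - p') / d"]) auto
      qed
    qed
  qed
  show "\<psi> (a + p - x) = a + p' - \<psi> x \<or> a + p - x > p" if "x \<le> p"
    using that cp by (auto simp: psi algebra_simps)
  show "\<psi> (p + b - x) = p' + b - \<psi> x \<or> p + b - x < p" if "p \<le> x"
    using that cp psi2[of x] psi2[of "p + b - x"] by (auto simp: algebra_simps)
qed

lemma comb_equiv_of_red_belt: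
  assumes R: "circle_gluing L R1" "circle_gluing L R2" and b: "belt L M R1 a b" "belt L M R2 a b"
    and M: "periodic L M"
    and e: "comb_equiv (L - (b - a)) (red_marks L a b M) (red L a b R1) (red L a b R2)"
  shows "comb_equiv L M R1 R2"
proof -
  obtain p where p: "branch L R1 a p" "branch L R1 p b" "class_size L R1 p = 3" using b(1) unfolding belt_def by blast
  obtain p' where p': "branch L R2 a p'" "branch L R2 p' b" "class_size L R2 p' = 3" using b(2) unfolding belt_def by blast
  note f = circle_gluing.belt_facts[OF R(1) p] and f' = circle_gluing.belt_facts[OF R(2) p']
  define \<psi> where "\<psi> x = (if x \<le> p then a + (x - a) * ((p' - a) / (p - a)) else p' + (x - p) * ((b - p') / (b - p)))" for x
  note m = piecewise_mono[OF f(2,3) f'(2,3), folded \<psi>_def]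
  have le: "\<psi> x \<le> \<psi> y \<longleftrightarrow> x \<le> y" and eq: "\<psi> x = \<psi> y \<longleftrightarrow> x = y" for x y
    using strict_mono_less_eq[OF m(1)] strict_mono_eq[OF m(1)] by blast+
  show ?thesis
  proof (rule comb_equiv_of_red[OF f(1) f'(1) M e])
    show "strict_mono_on {a..b} \<psi>" using m(1) by (auto simp: strict_mono_on_def strict_mono_def)
    show "\<psi> ` {a..b} = {a..b}" "\<psi> a = a" "\<psi> b = b" by (rule m)+
    show "\<psi> x = x" if "x \<in> M" "a \<le> x" "x \<le> b" for x
    proof -
      have "x = a \<or> x = b" using b(1) that unfolding belt_def by force
      then show ?thesis using m by auto
    qed
    fix x y assume x: "x \<in> {a..b}" and y: "y \<in> {a..b}"
    have px: "\<psi> x \<in> {a..b}" "\<psi> y \<in> {a..b}" using x y m(5) by blast+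
    have c1: "\<psi> x \<le> p' \<longleftrightarrow> x \<le> p" "p' \<le> \<psi> x \<longleftrightarrow> p \<le> x" for x using le[of x p] le[of p x] m(4) by auto
    have c2: "\<psi> x = a \<longleftrightarrow> x = a" "\<psi> x = b \<longleftrightarrow> x = b" for x using eq[of x a] eq[of x b] m by auto
    have c3: "\<psi> y = a + p' - \<psi> x \<longleftrightarrow> y = a + p - x" if "x \<le> p" using m(6)[OF that] eq[of y "a + p - x"] x by auto
    have c4: "\<psi> y = p' + b - \<psi> x \<longleftrightarrow> y = p + b - x" if "p \<le> x" using m(7)[OF that] eq[of y "p + b - x"] x by auto
    show "R1 x y \<longleftrightarrow> R2 (\<psi> x) (\<psi> y)"
      unfolding f(4)[OF x y] f'(4)[OF px] c1 c2 eq using c3 c4 by blast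
  qed
qed

section \<open>Codes of branches and the inductive count\<close>

definition sites :: "real \<Rightarrow> real set \<Rightarrow> real set" where
  "sites L M = M \<union> {(m + next_in L M m) / 2 | m. m \<in> M}"

lemma sites:
  assumes L: "L > 0" and M: "periodic L M" "finite (M \<inter> {0..<L})"
  shows "periodic L (sites L M)" "finite (sites L M \<inter> {0..<L})"
    "card (sites L M \<inter> {0..<L}) \<le> 2 * card (M \<inter> {0..<L})"
proof -
  have f: "finite (M \<inter> {0..<0 + L})" using M(2) by simp
  have np: "(m + of_int k * L + next_in L M (m + of_int k * L)) / 2 = (m + next_in L M m) / 2 + of_int k * L" if "m \<in> M" for m k
  proof -
    have ne: "M \<noteq> {}" using that by blast
    have "next_in L M (m + of_int k * L) = next_in L M m + of_int k * L"
      by (rule shift_int) (rule next_in_period[OF L M(1) f ne])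
    then show ?thesis by (simp add: field_simps)
  qed
  let ?E = "{(m + next_in L M m) / 2 | m. m \<in> M}"
  have pE: "x + of_int k * L \<in> ?E" if xE: "x \<in> ?E" for x k
  proof -
    obtain m where m: "m \<in> M" "x = (m + next_in L M m) / 2" using xE by blast
    have "m + of_int k * L \<in> M" using periodic_int[OF M(1)] m by blast
    moreover have "x + of_int k * L = (m + of_int k * L + next_in L M (m + of_int k * L)) / 2"
      by (simp only: np[OF m(1)] m(2))
    ultimately show ?thesis by blast
  qed
  have "x + L \<in> ?E \<longleftrightarrow> x \<in> ?E" for x using pE[of x 1] pE[of "x + L" "-1"] by auto
  then show P: "periodic L (sites L M)" using M(1) unfolding periodic_def sites_def by blast
  let ?g = "\<lambda>m. window L 0 ((m + next_in L M m) / 2)"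
  have sub: "sites L M \<inter> {0..<L} \<subseteq> (M \<inter> {0..<L}) \<union> ?g ` (M \<inter> {0..<L})"
  proof
    fix x assume x: "x \<in> sites L M \<inter> {0..<L}"
    show "x \<in> (M \<inter> {0..<L}) \<union> ?g ` (M \<inter> {0..<L})"
    proof (cases "x \<in> M")
      case False
      then obtain m where m: "m \<in> M" "x = (m + next_in L M m) / 2" using x by (auto simp: sites_def)
      define w where "w = window L 0 m"
      have w: "w \<in> M \<inter> {0..<L}" using m(1) window_in[OF L, of 0 m] window_mem[OF M(1), of 0 m] by (simp add: w_def)
      obtain k where k: "w = m + of_int k * L" using window_cong_per[of L m 0] unfolding cong_per_def w_def by blast
      have "cong_per L x ((w + next_in L M w) / 2)" unfolding k np[OF m(1)] m(2) by simp
      then have "window L 0 x = ?g w" using window_eq_iff[OF L] by blast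
      then have "x = ?g w" using window_id[OF L, of 0 x] x by simp
      then show ?thesis using w by blast
    qed (use x in blast)
  qed
  show "finite (sites L M \<inter> {0..<L})" by (rule finite_subset[OF sub]) (use M(2) in simp)
  have "card (sites L M \<inter> {0..<L}) \<le> card ((M \<inter> {0..<L}) \<union> ?g ` (M \<inter> {0..<L}))"
    by (rule card_mono[OF _ sub]) (use M(2) in simp)
  also have "\<dots> \<le> card (M \<inter> {0..<L}) + card (?g ` (M \<inter> {0..<L}))" by (rule card_Un_le)
  also have "\<dots> \<le> 2 * card (M \<inter> {0..<L})" using card_image_le[OF M(2), of ?g] by simp
  finally show "card (sites L M \<inter> {0..<L}) \<le> 2 * card (M \<inter> {0..<L})" .
qed

text \<open>The ends (a, b) of the branches that two labels determine: a marked end and the position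
  y of the leaf, from which the other end follows by reflection, or two marked ends. The leaf
  positions that one label can name are the \<open>sites\<close>. The marked end is normalised to
  the first period, a where both are marked, so the second datum may lie one period later or,
  counted from b, one period earlier; this is recorded by j.\<close>

definition zip_codes :: "real \<Rightarrow> real set \<Rightarrow> (real \<times> real) set" where
  "zip_codes L M =
     (\<lambda>(a, y, j). (a, 2 * (y + of_int j * L) - a)) ` ((M \<inter> {0..<L}) \<times> (sites L M \<inter> {0..<L}) \<times> {0, 1 :: int}) \<union>
     (\<lambda>(a, b, j). (a, b + of_int j * L)) ` ((M \<inter> {0..<L}) \<times> (M \<inter> {0..<L}) \<times> {0, 1 :: int}) \<union>
     (\<lambda>(b, y, j). (2 * (y + of_int j * L) - b, b)) ` ((M \<inter> {0..<L}) \<times> (sites L M \<inter> {0..<L}) \<times> {-1, 0 :: int})"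

text \<open>10 = 4 + 2 + 4: n marks, at most 2 n sites and two shifts for a marked left end, the
  same for a marked right end, and n^2 pairs of marks with two shifts.\<close>

lemma zip_codes:
  assumes L: "L > 0" and M: "periodic L M" "finite (M \<inter> {0..<L})"
  shows "finite (zip_codes L M)" "card (zip_codes L M) \<le> 10 * card (M \<inter> {0..<L}) ^ 2"
proof -
  note st = sites[OF L M]
  let ?n = "card (M \<inter> {0..<L})"
  show "finite (zip_codes L M)" unfolding zip_codes_def using st(2) M(2) by simp
  have 1: "card (f ` ((M \<inter> {0..<L}) \<times> (sites L M \<inter> {0..<L}) \<times> {i, j})) \<le> 4 * ?n ^ 2" if "i \<noteq> j"
    for f :: "_ \<Rightarrow> real \<times> real" and i j :: int
  proof -
    have "card (f ` ((M \<inter> {0..<L}) \<times> (sites L M \<inter> {0..<L}) \<times> {i, j})) \<le> card ((M \<inter> {0..<L}) \<times> (sites L M \<inter> {0..<L}) \<times> {i, j})"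
      by (rule card_image_le) (use st(2) M(2) in simp)
    also have "\<dots> = ?n * (card (sites L M \<inter> {0..<L}) * 2)" using that by (simp add: card_cartesian_product)
    also have "\<dots> \<le> ?n * (2 * ?n * 2)" using st(3) by (intro mult_le_mono) auto
    finally show ?thesis by (simp add: power2_eq_square)
  qed
  have 2: "card (f ` ((M \<inter> {0..<L}) \<times> (M \<inter> {0..<L}) \<times> {0, 1})) \<le> 2 * ?n ^ 2"
    for f :: "real \<times> real \<times> int \<Rightarrow> real \<times> real"
  proof -
    have "card (f ` ((M \<inter> {0..<L}) \<times> (M \<inter> {0..<L}) \<times> {0, 1})) \<le> card ((M \<inter> {0..<L}) \<times> (M \<inter> {0..<L}) \<times> {0, 1 :: int})"
      by (rule card_image_le) (use M(2) in simp)
    then show ?thesis by (simp add: card_cartesian_product power2_eq_square algebra_simps)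
  qed
  show "card (zip_codes L M) \<le> 10 * ?n ^ 2"
    unfolding zip_codes_def
    by (rule order_trans[OF card_Un_le], rule order_trans[OF add_mono[OF card_Un_le order_refl]],
        rule order_trans[OF add_mono[OF add_mono[OF 1 2] 1]]) auto
qed

lemma good_branch_code:
  assumes R: "circle_gluing L R" and M: "periodic L M" "finite (M \<inter> {0..<L})"
    and b: "branch L R a b" "a \<in> M \<or> b \<in> M" "(a + b) / 2 \<in> sites L M \<or> a \<in> M \<and> b \<in> M"
  shows "\<exists>(a', b')\<in>zip_codes L M. branch L R a' b' \<and> (a' \<in> M \<or> b' \<in> M)"
proof -
  interpret circle_gluing L R by (rule R)
  note L = L_pos
  note st = sites[OF L M]
  have sh: "branch L R (a + of_int k * L) (b + of_int k * L)" for k by (rule branch_shift[OF b(1)])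
  have per: "x + of_int k * L \<in> S \<longleftrightarrow> x \<in> S" if "periodic L S" for x k S by (rule periodic_int[OF that])
  have dec: "\<exists>y0 j. y = y0 + of_int j * L \<and> y0 \<in> S \<inter> {0..<L}" if "periodic L S" "y \<in> S" for y S
    using cong_per_sym[OF window_cong_per[of L y 0]] window_in[OF L, of 0 y] window_mem[OF that(1), of 0 y] that(2) unfolding cong_per_def by auto
  have jr: "j \<in> {0, 1}" if "0 < y + of_int j * L" "y + of_int j * L < 2 * L" "y \<in> {0..<L}" for y j
  proof -
    have "0 \<le> y" "y < L" using that(3) by auto
    then have "(-1) * L < of_int j * L" "of_int j * L < 2 * L" using that(1,2) by linarith+
    then have "(-1 :: real) < of_int j" "of_int j < (2 :: real)" using L by (simp_all only: mult_less_cancel_right_pos)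
    then show ?thesis by auto
  qed
  have jl: "j \<in> {-1, 0}" if "- L < y + of_int j * L" "y + of_int j * L < L" "y \<in> {0..<L}" for y j
  proof -
    have "0 \<le> y" "y < L" using that(3) by auto
    then have "(-2) * L < of_int j * L" "of_int j * L < 1 * L" using that(1,2) by linarith+
    then have "(-2 :: real) < of_int j" "of_int j < (1 :: real)" using L by (simp_all only: mult_less_cancel_right_pos)
    then show ?thesis by auto
  qed
  note e = branch_ends[OF b(1)]
  show ?thesis
  proof (cases "a \<in> M")
    case True
    obtain a0 k where a0: "a = a0 + of_int k * L" "a0 \<in> M \<inter> {0..<L}" using dec[OF M(1) True] by blast
    define b0 where "b0 = b - of_int k * L"
    have br: "branch L R a0 b0" using sh[of "- k"] a0 by (simp add: b0_def)
    have "a0 < b0" "b0 < a0 + L" using branch_ends[OF br] by auto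
    have "(a0, b0) \<in> zip_codes L M"
      using b(3)
    proof
      assume "(a + b) / 2 \<in> sites L M"
      moreover have "(a + b) / 2 = (a0 + b0) / 2 + of_int k * L" using a0 by (simp add: b0_def field_simps)
      ultimately have "(a0 + b0) / 2 \<in> sites L M" using per[OF st(1), of "(a0 + b0) / 2" k] by (simp only:)
      then obtain y j where y: "(a0 + b0) / 2 = y + of_int j * L" "y \<in> sites L M \<inter> {0..<L}" using dec[OF st(1)] by blast
      have "j \<in> {0, 1}" by (rule jr[of y]) (use y a0 \<open>a0 < b0\<close> \<open>b0 < a0 + L\<close> in auto)
      moreover have "b0 = 2 * (y + of_int j * L) - a0" using y(1) by (simp add: field_simps)
      ultimately show ?thesis unfolding zip_codes_def using y(2) a0(2)
        by (intro UnI1, intro image_eqI[of _ _ "(a0, y, j)"]) auto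
    next
      assume "a \<in> M \<and> b \<in> M"
      then have "b0 \<in> M" using per[OF M(1), of b0 k] by (simp add: b0_def)
      then obtain y j where y: "b0 = y + of_int j * L" "y \<in> M \<inter> {0..<L}" using dec[OF M(1)] by blast
      have "j \<in> {0, 1}" by (rule jr[of y]) (use y a0 \<open>a0 < b0\<close> \<open>b0 < a0 + L\<close> in auto)
      then show ?thesis unfolding zip_codes_def using y a0(2)
        by (intro UnI1 UnI2[of _ "_ ` (_ \<times> (M \<inter> _) \<times> _)"], intro image_eqI[of _ _ "(a0, y, j)"]) auto
    qed
    then show ?thesis using br a0 by blast
  next
    case False
    then have bM: "b \<in> M" and s: "(a + b) / 2 \<in> sites L M" using b(2,3) by auto
    obtain b0 k where b0: "b = b0 + of_int k * L" "b0 \<in> M \<inter> {0..<L}" using dec[OF M(1) bM] by blast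
    define a0 where "a0 = a - of_int k * L"
    have br: "branch L R a0 b0" using sh[of "- k"] b0 by (simp add: a0_def)
    have "a0 < b0" "b0 < a0 + L" using branch_ends[OF br] by auto
    have "(a + b) / 2 = (a0 + b0) / 2 + of_int k * L" using b0 by (simp add: a0_def field_simps)
    then have "(a0 + b0) / 2 \<in> sites L M" using per[OF st(1), of "(a0 + b0) / 2" k] s by (simp only:)
    then obtain y j where y: "(a0 + b0) / 2 = y + of_int j * L" "y \<in> sites L M \<inter> {0..<L}" using dec[OF st(1)] by blast
    have "j \<in> {-1, 0}" by (rule jl[of y]) (use y b0 \<open>a0 < b0\<close> \<open>b0 < a0 + L\<close> in auto)
    moreover have "a0 = 2 * (y + of_int j * L) - b0" using y(1) by (simp add: field_simps)
    ultimately have "(a0, b0) \<in> zip_codes L M" unfolding zip_codes_def using y(2) b0(2)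
      by (intro UnI2, intro image_eqI[of _ _ "(b0, y, j)"]) auto
    then show ?thesis using br b0 by blast
  qed
qed

text \<open>Suppose that no branch has a code. Every branch has a marked end, so a marked leaf,
  being a site, would give a code. Hence all leaves are unmarked, there are at most four, and
  \<open>all_bad\<close> supplies two branches that meet at an unmarked point. Neither contains a
  mark in its interior, so their outer ends are consecutive marks and form a belt.\<close>

lemma family_cases:
  assumes M: "periodic L M" "finite (M \<inter> {0..<L})" "M \<noteq> {}" and R: "R \<in> family L M k"
  shows "card (leaves L R) \<le> 2 \<or> (\<exists>(a, b)\<in>zip_codes L M. branch L R a b \<and> (a \<in> M \<or> b \<in> M)) \<or>
    (\<exists>(a, b)\<in>(\<lambda>a. (a, next_in L M a)) ` (M \<inter> {0..<L}). belt L M R a b)"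
proof (rule ccontr)
  assume "\<not> ?thesis"
  then have l: "card (leaves L R) \<ge> 3"
    and nz: "\<not> (\<exists>(a, b)\<in>zip_codes L M. branch L R a b \<and> (a \<in> M \<or> b \<in> M))"
    and nb: "\<And>a. a \<in> M \<inter> {0..<L} \<Longrightarrow> \<not> belt L M R a (next_in L M a)" by auto
  interpret circle_gluing L R using R by (simp add: family_def)
  note L = L_pos
  have st: "\<And>x y. R x y \<Longrightarrow> size_of x \<ge> 3 \<Longrightarrow> x \<notin> M \<Longrightarrow> y \<notin> M \<Longrightarrow> cg x y"
    using R unfolding family_def one_unmarked_def by blast
  have one: "a \<in> M \<or> b \<in> M" if "branch L R a b" for a b
  proof (rule ccontr)
    assume n: "\<not> (a \<in> M \<or> b \<in> M)"
    note e = branch_ends[OF that]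
    have "cg a b" using st[OF e(3,4)] n by blast
    then show False using cong_per_close_eq[OF L, of a b] e by auto
  qed
  have bad: "(a + b) / 2 \<notin> sites L M \<and> (a \<notin> M \<or> b \<notin> M)" if "branch L R a b" for a b
    using good_branch_code[OF circle_gluing_axioms M(1,2) that one[OF that]] nz by blast
  have "leaves L R \<inter> M = {}"
  proof (rule ccontr)
    assume "leaves L R \<inter> M \<noteq> {}"
    then obtain y where y: "y \<in> M" "size_of y = 1" by (auto simp: leaves_def)
    obtain r where "branch L R (y - r) (y + r)" using leaf_branch[OF y(2) l] by blast
    then have "y \<notin> sites L M" using bad[of "y - r" "y + r"] by simp
    then show False using y(1) by (simp add: sites_def)
  qed
  then have un: "leaves L R - M = leaves L R" by blast
  then have l4: "card (leaves L R) \<le> 4" using R by (auto simp: family_def)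
  have bad': "a \<notin> M \<or> b \<notin> M" if "branch L R a b" for a b using bad[OF that] by blast
  have c4: "card (leaves L R) = 4" by (rule all_bad(1)[OF M(1) st l l4 bad'])
  then have fl: "mark_flat L M R" using R un by (simp add: family_def)
  have fl': "\<And>x y. R x y \<Longrightarrow> size_of x = 2 \<Longrightarrow> x \<in> M \<Longrightarrow> y \<in> M" using fl unfolding mark_flat_def by blast
  have "\<exists>p a c. p \<notin> M \<and> size_of p = 3 \<and> branch L R a p \<and> branch L R p c"
    by (rule all_bad(2)[OF M(1) st l l4 bad'])
  then obtain p a c where p: "p \<notin> M" "size_of p = 3" "branch L R a p" "branch L R p c" by blast
  have nm: "x \<notin> M" if br: "branch L R u w" and x: "u < x" "x < w" for u w x
  proof (rule no_marks_in_branch[OF M(1,2) fl' br _ _ x])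
    show "(u + w) / 2 \<notin> M" using bad[OF br] by (auto simp: sites_def)
    show "(u + w) / 2 \<noteq> (m + next_in L M m) / 2" if "m \<in> M" for m using bad[OF br] that by (auto simp: sites_def)
  qed
  have am: "a \<in> M" "c \<in> M" using one[OF p(3)] one[OF p(4)] p(1) by auto
  \<comment> \<open>The translation by this multiple of L moves the left end of the belt into the
    first period, where the belts are listed.\<close>
  obtain k where k: "window L 0 a = a + of_int k * L" using window_cong_per[of L a 0] unfolding cong_per_def by blast
  define s where "s = of_int k * L"
  have f: "finite (M \<inter> {0..<0 + L})" using M(2) by simp
  have ps: "x + s \<in> M \<longleftrightarrow> x \<in> M" for x unfolding s_def by (rule periodic_int[OF M(1)])
  have apc: "a < p" "p < c" using branch_ends[OF p(3)] branch_ends[OF p(4)] by auto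
  have nom: "x \<notin> M" if "a + s < x" "x < c + s" for x
  proof -
    have "x - s \<notin> M"
    proof (cases "x - s = p")
      case False
      then show ?thesis using nm[OF p(3), of "x - s"] nm[OF p(4), of "x - s"] that by (cases "x - s < p") auto
    qed (use p(1) in simp)
    then show ?thesis using ps[of "x - s"] by simp
  qed
  have bas: "branch L R (a + s) (p + s)" "branch L R (p + s) (c + s)" unfolding s_def by (intro branch_shift p)+
  have "size_of (p + s) = 3" using p(2) class_size_cg[of p "p + s"] by (simp add: s_def)
  then have "belt L M R (a + s) (c + s)"
    unfolding belt_def using c4 am ps nom bas by blast
  moreover have "next_in L M (a + s) = c + s"
    by (rule next_in_unique[OF L M(1) f]) (use ps am apc nom in auto)
  moreover have "a + s \<in> M \<inter> {0..<L}" using k window_in[OF L, of 0 a] am ps by (simp add: s_def)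
  ultimately show False using nb[of "a + s"] by simp
qed

text \<open>A code fixes the removed arc, so all gluings with this code are cut down to the same
  circle with the same marks, at most n per period. The induction hypothesis then gives one bound N
  for every code.\<close>

lemma circle_count:
  assumes "L > 0" "periodic L M" "finite (M \<inter> {0..<L})" "M \<noteq> {}"
  shows "covered L M (family L M (k + 2)) (20 ^ (k + 1) * card (M \<inter> {0..<L}) ^ (2 * k + 2))"
  using assms
proof (induction k arbitrary: L M)
  case base: 0
  note L = base(1) and M = base(2,4,3)
  have "family L M (0 + 2) \<subseteq> {reflection L y | y. 0 \<le> y \<and> y < L}"
  proof
    fix R assume R: "R \<in> family L M (0 + 2)"
    then interpret circle_gluing L R by (simp add: family_def)
    have "card (leaves L R) = 2" using card_leaves_ge R by (simp add: family_def)
    then obtain y where y: "0 \<le> y" "y < L" "\<And>p q. R p q \<longleftrightarrow> cg p q \<or> cg (2 * y - p) q"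
      using two_leaves_reflection by blast
    have "R = reflection L y" by (intro ext) (simp add: y(3) reflection_def)
    then show "R \<in> {reflection L y | y. 0 \<le> y \<and> y < L}" using y by blast
  qed
  then show ?case by (intro covered_mono[OF covered_reflections[OF L M]]) (auto simp: power2_eq_square)
next
  case (Suc k)
  note L = Suc.prems(1) and M = Suc.prems(2-4)
  let ?n = "card (M \<inter> {0..<L})"
  obtain m0 where m0: "m0 \<in> M" using M(3) by blast
  have "window L 0 m0 \<in> M \<inter> {0..<L}" using m0 window_in[OF L, of 0 m0] window_mem[OF M(1), of 0 m0] by simp
  then have n1: "?n \<ge> 1" using M(2) by (metis Suc_leI card_gt_0_iff empty_iff One_nat_def)
  define N where "N = 20 ^ (k + 1) * ?n ^ (2 * k + 2)"
  have N1: "N \<ge> 1" using n1 by (simp add: N_def)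
  have IH: "covered (L - (b - a)) (red_marks L a b M) (family (L - (b - a)) (red_marks L a b M) (k + 2)) N"
    if ab: "a < b" "b < a + L" "a \<in> M \<or> b \<in> M" for a b
  proof -
    have bL: "b - a < L" using ab by simp
    note cr = card_red_marks[OF ab(1) bL M(1,2) ab(3)]
    have "covered (L - (b - a)) (red_marks L a b M) (family (L - (b - a)) (red_marks L a b M) (k + 2))
      (20 ^ (k + 1) * card (red_marks L a b M \<inter> {0..<L - (b - a)}) ^ (2 * k + 2))"
      by (rule Suc.IH) (use bL periodic_red_marks[OF ab(1) bL M(1)] cr(1) red_marks_0[of L a b M] in auto)
    then show ?thesis by (rule covered_mono) (use cr(2) in \<open>auto simp: N_def intro!: mult_le_mono power_mono\<close>)
  qed
  define F where "F = family L M (Suc k + 2)"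
  define G1 where "G1 z = {R \<in> F. branch L R (fst z) (snd z) \<and> (fst z \<in> M \<or> snd z \<in> M)}" for z
  define G2 where "G2 z = {R \<in> F. belt L M R (fst z) (snd z)}" for z
  define Z2 where "Z2 = (\<lambda>a. (a, next_in L M a)) ` (M \<inter> {0..<L})"
  have gl: "circle_gluing L R" if "R \<in> F" for R using that by (simp add: F_def family_def)
  have c1: "covered L M (G1 z) N" for z
  proof (cases "G1 z = {}")
    case True then show ?thesis by (simp add: covered_def)
  next
    case False
    obtain a b where z: "z = (a, b)" by (cases z)
    then obtain R0 where R0: "R0 \<in> F" "branch L R0 a b" "a \<in> M \<or> b \<in> M" using False by (auto simp: G1_def)
    note e = circle_gluing.branch_ends[OF gl[OF R0(1)] R0(2)]
    show ?thesis
    proof (rule covered_pull[OF IH[OF e(1,2) R0(3)], where T = "red L a b"])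
      show "red L a b R \<in> family (L - (b - a)) (red_marks L a b M) (k + 2)" if "R \<in> G1 z" for R
        using that z circle_gluing.red_branch_family[OF gl _ M(1), of R a b "k + 2"] by (simp add: G1_def F_def)
      show "comb_equiv L M R1 R2" if "R1 \<in> G1 z" "R2 \<in> G1 z"
        "comb_equiv (L - (b - a)) (red_marks L a b M) (red L a b R1) (red L a b R2)" for R1 R2
        using that z comb_equiv_of_red_branch[OF gl gl _ _ M(1), of R1 R2 a b] by (simp add: G1_def)
    qed
  qed
  have c2: "covered L M (G2 z) N" for z
  proof (cases "G2 z = {}")
    case True then show ?thesis by (simp add: covered_def)
  next
    case False
    obtain a b where z: "z = (a, b)" by (cases z)
    then obtain R0 where R0: "R0 \<in> F" "belt L M R0 a b" using False by (auto simp: G2_def)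
    obtain p where p: "branch L R0 a p" "branch L R0 p b" "class_size L R0 p = 3" using R0(2) unfolding belt_def by blast
    have "circle_cut L R0 a b" by (rule circle_gluing.belt_facts(1)[OF gl[OF R0(1)] p])
    then have ab: "a < b" "b < a + L" using circle_cut.ab by blast+
    have "4 \<le> Suc k + 2" using R0 by (simp add: F_def family_def belt_def)
    then have k: "3 \<le> k + 2" by simp
    have aM: "a \<in> M \<or> b \<in> M" using R0(2) by (simp add: belt_def)
    show ?thesis
    proof (rule covered_pull[OF IH[OF ab aM], where T = "red L a b"])
      show "red L a b R \<in> family (L - (b - a)) (red_marks L a b M) (k + 2)" if "R \<in> G2 z" for R
      proof -
        have "red L a b R \<in> family (L - (b - a)) (red_marks L a b M) 3"
          by (rule circle_gluing.red_belt_family[OF gl _ M(1)]) (use that z in \<open>auto simp: G2_def F_def family_def\<close>)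
        then show ?thesis using k by (auto simp: family_def)
      qed
      show "comb_equiv L M R1 R2" if "R1 \<in> G2 z" "R2 \<in> G2 z"
        "comb_equiv (L - (b - a)) (red_marks L a b M) (red L a b R1) (red L a b R2)" for R1 R2
        using that z comb_equiv_of_red_belt[OF gl gl _ _ M(1), of R1 R2 a b] by (simp add: G2_def)
    qed
  qed
  have fZ2: "finite Z2" "card Z2 \<le> ?n" unfolding Z2_def using M(2) by (simp_all add: card_image_le)
  note zc = zip_codes[OF L M(1,2)]
  let ?F2 = "{reflection L y | y. 0 \<le> y \<and> y < L}"
  have sub: "F \<subseteq> ?F2 \<union> ((\<Union>z\<in>zip_codes L M. G1 z) \<union> (\<Union>z\<in>Z2. G2 z))"
  proof
    fix R assume R: "R \<in> F"
    interpret circle_gluing L R by (rule gl[OF R])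
    consider "card (leaves L R) \<le> 2" | "\<exists>(a, b)\<in>zip_codes L M. branch L R a b \<and> (a \<in> M \<or> b \<in> M)"
      | "\<exists>(a, b)\<in>Z2. belt L M R a b"
      using family_cases[OF M R[unfolded F_def]] unfolding Z2_def by blast
    then show "R \<in> ?F2 \<union> ((\<Union>z\<in>zip_codes L M. G1 z) \<union> (\<Union>z\<in>Z2. G2 z))"
    proof cases
      case 1
      then have "card (leaves L R) = 2" using card_leaves_ge by simp
      then obtain y where y: "0 \<le> y" "y < L" "\<And>p q. R p q \<longleftrightarrow> cg p q \<or> cg (2 * y - p) q"
        using two_leaves_reflection by blast
      have "R = reflection L y" by (intro ext) (simp add: y(3) reflection_def)
      then show ?thesis using y by blast
    next
      case 2
      then obtain a b where "(a, b) \<in> zip_codes L M" "R \<in> G1 (a, b)" using R by (auto simp: G1_def)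
      then show ?thesis by blast
    next
      case 3
      then obtain a b where "(a, b) \<in> Z2" "R \<in> G2 (a, b)" using R by (auto simp: G2_def)
      then show ?thesis by blast
    qed
  qed
  have "covered L M F (8 * ?n ^ 2 + (card (zip_codes L M) * N + card Z2 * N))"
    by (rule covered_mono[OF covered_Un[OF covered_reflections[OF L M(1,3,2)] covered_Un[OF covered_UN[OF zc(1) order_refl c1] covered_UN[OF fZ2(1) order_refl c2]]] sub order_refl])
  \<comment> \<open>At most 8 n^2 reflections, 10 n^2 branch codes and n belts, the latter two with
    N types each: 19 n^2 N altogether, rounded up to 20 n^2 N.\<close>
  moreover have "8 * ?n ^ 2 + (card (zip_codes L M) * N + card Z2 * N) \<le> 20 ^ (Suc k + 1) * ?n ^ (2 * Suc k + 2)"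
  proof -
    have "card Z2 * N \<le> ?n ^ 2 * N" using fZ2(2) n1 by (intro mult_le_mono) (auto simp: power2_eq_square intro: order_trans)
    moreover have "card (zip_codes L M) * N \<le> 10 * ?n ^ 2 * N" using zc(2) by (intro mult_le_mono) auto
    moreover have "8 * ?n ^ 2 * 1 \<le> 8 * ?n ^ 2 * N" using N1 by (intro mult_le_mono) auto
    ultimately have "8 * ?n ^ 2 + (card (zip_codes L M) * N + card Z2 * N) \<le> 20 * ?n ^ 2 * N" by linarith
    also have "\<dots> = 20 ^ (Suc k + 1) * ?n ^ (2 * Suc k + 2)" by (simp add: N_def power2_eq_square)
    finally show ?thesis .
  qed
  ultimately show ?case unfolding F_def by (rule covered_mono[OF _ order_refl])
qed

section \<open>The angle sum of a simple polygon\<close>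

lemma Arg_quotient:
  assumes "z \<noteq> 0" "w \<noteq> 0" "\<bar>Arg w - Arg z\<bar> < pi"
  shows "Arg (w / z) = Arg w - Arg z"
proof (rule Arg_unique[of "norm w / norm z"])
  have "w / z = (of_real (norm w) * exp (\<i> * of_real (Arg w))) / (of_real (norm z) * exp (\<i> * of_real (Arg z)))"
    using Arg_eq[OF assms(1)] Arg_eq[OF assms(2)] by simp
  then show "of_real (norm w / norm z) * exp (\<i> * of_real (Arg w - Arg z)) = w / z"
    by (simp add: exp_diff right_diff_distrib)
qed (use assms in auto)

text \<open>After rotation into the right half-plane, directions are angles between -\<pi>/2 and
  \<pi>/2, so their differences add up without multiples of 2 \<pi>.\<close>

lemma Arg_halfplane_add:
  assumes "Re (c * z1) > 0" "Re (c * z2) > 0" "Re (c * z3) > 0"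
  shows "Arg (z2 / z1) + Arg (z3 / z2) = Arg (z3 / z1)"
proof -
  have *: "Arg (w / z) = Arg (c * w) - Arg (c * z)" if "Re (c * z) > 0" "Re (c * w) > 0" for z w
  proof -
    have nz: "c * z \<noteq> 0" "c * w \<noteq> 0" using that by auto
    have "\<bar>Arg (c * z)\<bar> < pi / 2" "\<bar>Arg (c * w)\<bar> < pi / 2" using that Arg_Re_pos by blast+
    then have "\<bar>Arg (c * w) - Arg (c * z)\<bar> < pi" by linarith
    then have "Arg (c * w / (c * z)) = Arg (c * w) - Arg (c * z)" by (rule Arg_quotient[OF nz])
    then show ?thesis using nz by simp
  qed
  show ?thesis using *[OF assms(1,2)] *[OF assms(2,3)] *[OF assms(1,3)] by simp
qed

text \<open>Since z2 / z1 is not real, the open half-plane around the bisector of z1 and z2 contains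
  both of them and therefore their sum. The factor c rotates by half of the angle.\<close>

lemma Arg_triangle:
  assumes "z1 \<noteq> 0" "z2 / z1 \<notin> \<real>"
  shows "Arg ((z1 + z2) / z1) + Arg (z2 / (z1 + z2)) = Arg (z2 / z1)"
proof -
  define u where "u = z2 / z1"
  have u0: "u \<noteq> 0" using assms(2) by (auto simp: u_def)
  define t where "t = Arg u / 2"
  have "Arg u \<noteq> pi" using assms(2) Arg_eq_pi[of u] complex_is_Real_iff by (auto simp: u_def)
  then have "\<bar>Arg u\<bar> < pi" using mpi_less_Arg[of u] Arg_le_pi[of u] by linarith
  then have t: "cos t > 0" unfolding t_def by (intro cos_gt_zero_pi) auto
  define c where "c = exp (- (\<i> * of_real t))"
  have 1: "Re c > 0" using t by (simp add: c_def Re_exp)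
  have "c * u = c * (of_real (norm u) * exp (\<i> * of_real (Arg u)))" using Arg_eq[OF u0] by simp
  also have "\<dots> = of_real (norm u) * (exp (- (\<i> * of_real t)) * exp (\<i> * of_real (2 * t)))" by (simp add: c_def t_def)
  also have "\<dots> = of_real (norm u) * exp (\<i> * of_real t)" by (simp add: exp_add[symmetric] algebra_simps)
  finally have 2: "Re (c * u) > 0" using t u0 by (simp add: Re_exp)
  have e: "(c / z1) * z1 = c" "(c / z1) * (z1 + z2) = c + c * u" "(c / z1) * z2 = c * u"
    using assms(1) by (simp_all add: u_def field_simps)
  show ?thesis by (rule Arg_halfplane_add[of "c / z1"]) (unfold e, use 1 2 in auto)
qed

text \<open>Disjoint segments are separated by a line, so all directions from the first to the
  second lie in one half-plane. This is how disjointness of edges enters the computation of the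
  turning.\<close>

lemma Arg_square:
  fixes a b p q :: complex
  assumes "closed_segment a b \<inter> closed_segment p q = {}"
  shows "Arg ((q - a) / (p - a)) + Arg ((q - b) / (q - a)) = Arg ((p - b) / (p - a)) + Arg ((q - b) / (p - b))"
proof -
  have "\<exists>c d. (\<forall>x\<in>closed_segment a b. inner c x < d) \<and> (\<forall>x\<in>closed_segment p q. inner c x > d)"
    by (rule separating_hyperplane_closed_compact) (use assms in auto)
  then obtain c d where c: "\<And>x. x \<in> closed_segment a b \<Longrightarrow> inner c x < d"
    "\<And>x. x \<in> closed_segment p q \<Longrightarrow> inner c x > d" by blast
  have r: "Re (cnj c * (y - x)) > 0" if "x \<in> closed_segment a b" "y \<in> closed_segment p q" for x y
  proof -
    have "inner c x < inner c y" using c that by force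
    then show ?thesis by (simp add: inner_complex_def algebra_simps)
  qed
  have "Re (cnj c * (p - a)) > 0" "Re (cnj c * (q - a)) > 0" "Re (cnj c * (p - b)) > 0" "Re (cnj c * (q - b)) > 0"
    by (intro r ends_in_segment)+
  then show ?thesis by (simp add: Arg_halfplane_add[of "cnj c"])
qed

lemma cyc_inj:
  fixes k n :: nat assumes "i < n" "j < n" "(k + i) mod n = (k + j) mod n" shows "i = j"
proof -
  have "i = j" if "i \<le> j" "j < n" "(k + i) mod n = (k + j) mod n" for i j
  proof -
    have "n dvd (k + j) - (k + i)" using that mod_eq_dvd_iff_nat[of "k + i" "k + j" n] by simp
    then have "n dvd j - i" by simp
    then show ?thesis using that by (auto dest!: dvd_imp_le)
  qed
  then show ?thesis using assms by (metis linorder_linear)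
qed

section \<open>Turning angles and interior angles\<close>

locale polygon =
  fixes v :: "nat \<Rightarrow> complex" and n :: nat
  assumes simple: "simple_polygon v n"
begin

lemma n3: "n \<ge> 3" using simple by (simp add: simple_polygon_def)

lemma nxt_less: "nxt n i < n" and prv_less: "prv n i < n"
  using n3 by (simp_all add: nxt_def prv_def)

lemma nxt_prv: "i < n \<Longrightarrow> nxt n (prv n i) = i"
  using n3 by (cases i) (auto simp: nxt_def prv_def mod_Suc_eq)

lemma prv_nxt: "i < n \<Longrightarrow> prv n (nxt n i) = i"
  using n3 by (cases "Suc i = n") (auto simp: nxt_def prv_def)

definition "edg i = v (nxt n i) - v i"

definition "turn i = edg i / edg (prv n i)"

lemma v_inj: "i < n \<Longrightarrow> j < n \<Longrightarrow> v i = v j \<longleftrightarrow> i = j"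
  using simple unfolding simple_polygon_def inj_on_def by blast

lemma nxt_ne: "i < n \<Longrightarrow> nxt n i \<noteq> i"
  using n3 by (cases "Suc i = n") (auto simp: nxt_def)

lemma edg_nz: "i < n \<Longrightarrow> edg i \<noteq> 0"
  using v_inj[OF nxt_less, of i i] nxt_ne[of i] by (simp add: edg_def)

text \<open>Consecutive vertices are not collinear. This keeps interior angles away from \<pi>, on
  which \<open>mark_flat\<close> rests in the end.\<close>

lemma turn_nonreal: assumes i: "i < n" shows "turn i \<notin> \<real>"
proof
  assume "turn i \<in> \<real>"
  then obtain r where r: "edg i = of_real r * edg (prv n i)"
    using edg_nz[OF prv_less, of i] unfolding turn_def by (metis Reals_cases nonzero_eq_divide_eq)
  have e: "v (nxt n i) - v i = - r *\<^sub>R (v (prv n i) - v i)"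
    using r by (simp add: edg_def nxt_prv[OF i] scaleR_conv_of_real algebra_simps)
  have "collinear {0, v (prv n i) - v i, v (nxt n i) - v i}"
    unfolding collinear_lemma using e by blast
  then have "collinear {v (prv n i), v i, v (nxt n i)}" by (simp add: collinear_3)
  then show False using simple i unfolding simple_polygon_def by blast
qed

lemma Arg_turn: assumes "i < n" shows "\<bar>Arg (turn i)\<bar> < pi" "Arg (turn i) \<noteq> 0" "turn i \<noteq> 0"
proof -
  have "Arg (turn i) \<noteq> pi" using turn_nonreal[OF assms] Arg_eq_pi[of "turn i"] complex_is_Real_iff by auto
  then show "\<bar>Arg (turn i)\<bar> < pi" using mpi_less_Arg[of "turn i"] Arg_le_pi[of "turn i"] by linarith
  show "Arg (turn i) \<noteq> 0" using turn_nonreal[OF assms] Arg_eq_0[of "turn i"] by blast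
  show "turn i \<noteq> 0" using turn_nonreal[OF assms] by auto
qed

lemma int_angle_turn:
  assumes i: "i < n"
  shows "int_angle v n i = (if ccw_polygon v n then pi - Arg (turn i) else pi + Arg (turn i))"
proof -
  define u where "u = turn i"
  have u0: "u \<noteq> 0" and A: "\<bar>Arg u\<bar> < pi" using Arg_turn[OF i] by (simp_all add: u_def)
  have ue: "u = of_real (norm u) * exp (\<i> * of_real (Arg u))" using Arg_eq[OF u0] .
  have p: "v (prv n i) - v i = - edg (prv n i)" by (simp add: edg_def nxt_prv[OF i])
  have q: "v (nxt n i) - v i = edg i" by (simp add: edg_def)
  have "Arg2pi (- (1 / u)) = pi - Arg u"
  proof (rule Arg2pi_unique[of "1 / norm u"])
    have "- (1 / u) = - (1 / (of_real (norm u) * exp (\<i> * of_real (Arg u))))" using ue by simp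
    then show "of_real (1 / norm u) * exp (\<i> * of_real (pi - Arg u)) = - (1 / u)"
      by (simp add: exp_diff right_diff_distrib)
  qed (use u0 A in auto)
  moreover have "- edg (prv n i) / edg i = - (1 / u)" by (simp add: u_def turn_def)
  moreover have "Arg2pi (- u) = pi + Arg u"
  proof (rule Arg2pi_unique[of "norm u"])
    have "- u = - (of_real (norm u) * exp (\<i> * of_real (Arg u)))" using ue by simp
    then show "of_real (norm u) * exp (\<i> * of_real (pi + Arg u)) = - u"
      by (simp add: exp_add distrib_left)
  qed (use u0 A in auto)
  moreover have "edg i / (- edg (prv n i)) = - u" by (simp add: u_def turn_def)
  ultimately show ?thesis unfolding int_angle_def ccw_angle_def p q u_def[symmetric] by simp
qed

lemma int_angle_bounds:
  assumes "i < n" shows "0 < int_angle v n i" "int_angle v n i < 2 * pi" "int_angle v n i \<noteq> pi"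
  using Arg_turn[OF assms] unfolding int_angle_turn[OF assms] by (auto simp: abs_if split: if_splits)

text \<open>The total turning is computed from the directions \<open>w j - w i\<close>, \<open>i < j\<close>: it is unchanged when
  the path of pairs \<open>(i, i + 1)\<close> is deformed to one through pairs containing an extreme vertex.\<close>

lemma total_turn: "\<bar>\<Sum>i<n. Arg (turn i)\<bar> = 2 * pi"
proof -
  \<comment> \<open>The lowest vertex, and the leftmost one among several: seen from it, all other
    vertices have directions with \<open>Arg\<close> in [0, \<pi>).\<close>
  obtain k where k: "k < n" "\<And>j. j < n \<Longrightarrow> j \<noteq> k \<Longrightarrow> Im (v j - v k) > 0 \<or> Im (v j - v k) = 0 \<and> Re (v j - v k) > 0"
  proof -
    define S where "S = {i\<in>{..<n}. \<forall>j<n. Im (v i) \<le> Im (v j)}"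
    have "\<exists>x. is_arg_min (\<lambda>i. Im (v i)) (\<lambda>x. x \<in> {..<n}) x"
      using n3 by (intro ex_is_arg_min_if_finite) (auto simp: lessThan_empty_iff)
    then have "S \<noteq> {}" by (auto simp: S_def is_arg_min_linorder)
    moreover have "finite S" by (simp add: S_def)
    ultimately have "\<exists>x. is_arg_min (\<lambda>i. Re (v i)) (\<lambda>x. x \<in> S) x" by (intro ex_is_arg_min_if_finite)
    then obtain k where k: "k \<in> S" "\<And>j. j \<in> S \<Longrightarrow> Re (v k) \<le> Re (v j)" by (auto simp: is_arg_min_linorder)
    show thesis
    proof (rule that[of k])
      show "k < n" using k by (simp add: S_def)
      fix j assume j: "j < n" "j \<noteq> k"
      have le: "Im (v k) \<le> Im (v j)" using k(1) j by (simp add: S_def)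
      show "Im (v j - v k) > 0 \<or> Im (v j - v k) = 0 \<and> Re (v j - v k) > 0"
      proof (cases "Im (v k) = Im (v j)")
        case True
        then have "j \<in> S" using k(1) j by (simp add: S_def)
        then have "Re (v k) \<le> Re (v j)" by (rule k)
        moreover have "v j \<noteq> v k" using v_inj j k(1) by (simp add: S_def)
        then have "Re (v k) \<noteq> Re (v j)" using True by (simp add: complex_eq_iff)
        ultimately show ?thesis using True by simp
      qed (use le in simp)
    qed
  qed
  define f where "f j = (k + j) mod n" for j
  define w where "w j = v (f j)" for j
  have fn: "f j < n" for j using n3 by (simp add: f_def)
  have fS: "nxt n (f j) = f (Suc j)" for j by (simp add: f_def nxt_def mod_Suc_eq)
  have finj: "f i = f j \<longleftrightarrow> i = j" if "i < n" "j < n" for i j using cyc_inj[of i n j k] that by (auto simp: f_def)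
  have fper: "f n = f 0" by (simp add: f_def)
  have w0: "w n = w 0" by (simp add: w_def fper)
  have prvf: "prv n (f (Suc j)) = f j" for j using prv_nxt[OF fn, of j] fS by simp
  have bij: "bij_betw f {..<n} {..<n}"
  proof -
    have "inj_on f {..<n}" using finj by (auto simp: inj_on_def)
    moreover have "f ` {..<n} \<subseteq> {..<n}" using fn by auto
    ultimately show ?thesis by (simp add: bij_betw_def endo_inj_surj)
  qed
  define D where "D i j = w j - w i" for i j
  \<comment> \<open>\<open>H\<close> and \<open>V\<close> measure how the direction from w i to w j
    changes when the second or the first index advances. The vertices are renumbered so that the
    extreme one is w 0 = w n.\<close>
  define H where "H i j = Arg (D i (Suc j) / D i j)" for i j
  define V where "V i j = Arg (D (Suc i) j / D i j)" for i j
  define E where "E j = Arg (turn (f j))" for j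
  have edgf: "edg (f j) = D j (Suc j)" for j by (simp add: edg_def fS D_def w_def)
  \<comment> \<open>The pair (0, n - 1) is left out because the two edges share the vertex w 0. The
    step around that corner is \<open>c0\<close>.\<close>
  have square: "H i j + V i (Suc j) = V i j + H (Suc i) j" if "Suc i < j" "j < n" "i \<noteq> 0 \<or> j \<noteq> n - 1" for i j
  proof -
    have "f j \<noteq> f (Suc i)" "f i \<noteq> f j" using that finj by auto
    moreover have "f i \<noteq> f (Suc j)"
    proof (cases "Suc j < n")
      case True then show ?thesis using that finj by auto
    next
      case False
      then have "Suc j = n" using that by simp
      moreover from this have "i \<noteq> 0" using that by auto
      ultimately show ?thesis using finj[of i 0] fper that by simp
    qed
    ultimately have "pedge v n (f i) \<inter> pedge v n (f j) = {}"
      using simple fn[of i] fn[of j] fS unfolding simple_polygon_def by simp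
    then show ?thesis unfolding H_def V_def D_def
      by (intro Arg_square) (simp add: pedge_def fS w_def)
  qed
  have corner: "H i (Suc i) + V i (Suc (Suc i)) = E (Suc i)" for i
  proof -
    have t: "turn (f (Suc i)) = D (Suc i) (Suc (Suc i)) / D i (Suc i)" by (simp add: turn_def edgf prvf)
    have nz: "D i (Suc i) \<noteq> 0" using edg_nz[OF fn, of i] by (simp add: edgf)
    have "D i (Suc (Suc i)) = D i (Suc i) + D (Suc i) (Suc (Suc i))" by (simp add: D_def)
    then show ?thesis using Arg_triangle[OF nz, of "D (Suc i) (Suc (Suc i))"] turn_nonreal[OF fn, of "Suc i"]
      by (simp add: H_def V_def E_def t)
  qed
  have row: "(\<Sum>j\<in>{i + 2..<m}. H i j) + V i m = V i (i + 2) + (\<Sum>j\<in>{i + 2..<m}. H (Suc i) j)"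
    if "i + 2 \<le> m" "m \<le> n" "i \<noteq> 0 \<or> m < n" for i m
    using that
  proof (induction m rule: dec_induct)
    case base then show ?case by simp
  next
    case (step m)
    have "H i m + V i (Suc m) = V i m + H (Suc i) m" by (rule square) (use step in auto)
    then show ?case using step by simp
  qed
  \<comment> \<open>The turning along the path of pairs from (i, i + 1) through row i to (i, n) and
    then through column n to (n - 1, n).\<close>
  define T where "T i = (\<Sum>j\<in>{Suc i..<n}. H i j) + (\<Sum>l\<in>{i..<n - 1}. V l n)" for i
  have Tstep: "T i = E (Suc i) + T (Suc i)" if i: "1 \<le> i" "i < n - 1" for i
  proof -
    have "(\<Sum>j\<in>{Suc i..<n}. H i j) = H i (Suc i) + (\<Sum>j\<in>{i + 2..<n}. H i j)"
      using i by (simp add: sum.atLeast_Suc_lessThan)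
    moreover have "(\<Sum>l\<in>{i..<n - 1}. V l n) = V i n + (\<Sum>l\<in>{Suc i..<n - 1}. V l n)"
      using i by (simp add: sum.atLeast_Suc_lessThan)
    moreover have "(\<Sum>j\<in>{i + 2..<n}. H i j) + V i n = V i (i + 2) + (\<Sum>j\<in>{i + 2..<n}. H (Suc i) j)"
      by (rule row) (use i in auto)
    ultimately show ?thesis using corner[of i] by (simp add: T_def)
  qed
  have T1: "T i = (\<Sum>j\<in>{Suc i..<n}. E j)" if "1 \<le> i" "i \<le> n - 1" for i
    using that(2,1)
  proof (induction i rule: inc_induct)
    case base then show ?case using n3 by (simp add: T_def)
  next
    case (step i)
    then have "T (Suc i) = (\<Sum>j\<in>{Suc (Suc i)..<n}. E j)" by simp
    moreover have "(\<Sum>j\<in>{Suc i..<n}. E j) = E (Suc i) + (\<Sum>j\<in>{Suc (Suc i)..<n}. E j)"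
      using step by (simp add: sum.atLeast_Suc_lessThan)
    ultimately show ?case using Tstep[of i] step by simp
  qed
  define P where "P = D 0 (n - 1)"
  define Q where "Q = D 0 1"
  have up: "0 \<le> Arg (D 0 j) \<and> Arg (D 0 j) < pi \<and> D 0 j \<noteq> 0" if "1 \<le> j" "j < n" for j
  proof -
    have "f 0 = k" using k by (simp add: f_def)
    moreover from this have "f j \<noteq> k" using finj[of j 0] that by auto
    ultimately have c: "Im (D 0 j) > 0 \<or> Im (D 0 j) = 0 \<and> Re (D 0 j) > 0"
      using k(2)[OF fn, of j] by (simp add: D_def w_def)
    then have nz: "D 0 j \<noteq> 0" by auto
    from c show ?thesis
    proof
      assume "Im (D 0 j) > 0" then show ?thesis using Arg_lt_pi[of "D 0 j"] nz by auto
    next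
      assume "Im (D 0 j) = 0 \<and> Re (D 0 j) > 0"
      then have "Arg (D 0 j) = 0" unfolding Arg_eq_0 by (simp add: complex_is_Real_iff)
      then show ?thesis using nz by simp
    qed
  qed
  have Arg_up: "Arg (D 0 j / D 0 i) = Arg (D 0 j) - Arg (D 0 i)" if "1 \<le> i" "i < n" "1 \<le> j" "j < n" for i j
    by (rule Arg_quotient) (use up[OF that(1,2)] up[OF that(3,4)] in auto)
  define \<theta> where "\<theta> = Arg Q - Arg P"
  \<comment> \<open>Row 0 and column n both see the polygon from the extreme vertex, once in the
    opposite direction, so they turn by the same amount; as the directions from w 0 stay in a
    half-plane, the differences telescope.\<close>
  have tele: "(\<Sum>j\<in>{1..<n - 1}. Arg (D 0 (Suc j)) - Arg (D 0 j)) = - \<theta>"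
    using sum_Suc_diff'[of 1 "n - 1" "\<lambda>j. Arg (D 0 j)"] n3 by (simp add: \<theta>_def P_def Q_def)
  have s1: "(\<Sum>j\<in>{1..<n - 1}. H 0 j) = - \<theta>"
    unfolding tele[symmetric] by (intro sum.cong refl) (auto simp: H_def intro!: Arg_up)
  have s2: "(\<Sum>l\<in>{1..<n - 1}. V l n) = - \<theta>"
    unfolding tele[symmetric]
  proof (intro sum.cong refl)
    fix l assume l: "l \<in> {1..<n - 1}"
    have "D (Suc l) n / D l n = D 0 (Suc l) / D 0 l" unfolding D_def w0
      by (metis minus_diff_eq minus_divide_divide)
    then show "V l n = Arg (D 0 (Suc l)) - Arg (D 0 l)" using Arg_up[of l "Suc l"] l by (auto simp: V_def)
  qed
  have Pz: "P \<noteq> 0" and Qz: "Q \<noteq> 0" using up[of "n - 1"] up[of 1] n3 by (auto simp: P_def Q_def)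
  have nn: "Suc (n - 1) = n" using n3 by simp
  have f0: "f 0 = f (Suc (n - 1))" using fper nn by simp
  have DP: "D (n - 1) n = - P" "D 1 n = - Q" "D 1 (n - 1) = P + - Q" by (simp_all add: P_def Q_def D_def w0)
  have t0: "turn (f 0) = - Q / P"
  proof -
    have "turn (f 0) = edg (f 0) / edg (prv n (f (Suc (n - 1))))" unfolding turn_def f0[symmetric] ..
    also have "edg (prv n (f (Suc (n - 1)))) = - P" by (simp only: prvf edgf) (simp only: nn DP)
    also have "edg (f 0) = Q" by (simp add: edgf Q_def)
    finally show ?thesis by simp
  qed
  have E0: "E 0 = Arg (- Q / P)" by (simp add: E_def t0)
  have nr: "- Q / P \<notin> \<real>" using turn_nonreal[OF fn, of 0] t0 by simp
  have c0: "V 0 (n - 1) + H 1 (n - 1) = Arg (- Q / P)"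
  proof -
    have "V 0 (n - 1) = Arg (D 1 (n - 1) / P)" by (simp add: V_def P_def)
    moreover have "H 1 (n - 1) = Arg (D 1 n / D 1 (n - 1))" unfolding H_def nn ..
    moreover have "- Q / P \<notin> \<real>" by (rule nr)
    ultimately show ?thesis unfolding DP using Arg_triangle[OF Pz, of "- Q"] by simp
  qed
  have "(\<Sum>j\<in>{1..<n}. E j) = E 1 + T 1" using T1[of 1] n3 by (simp add: sum.atLeast_Suc_lessThan)
  also have "T 1 = (\<Sum>j\<in>{2..<n - 1}. H 1 j) + H 1 (n - 1) + (\<Sum>l\<in>{1..<n - 1}. V l n)"
  proof -
    have "{2..<n} = insert (n - 1) {2..<n - 1}" using n3 by auto
    then show ?thesis by (simp add: T_def numeral_2_eq_2)
  qed
  also have "E 1 = H 0 1 + V 0 2" using corner[of 0] by (simp add: numeral_2_eq_2)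
  also have "H 0 1 + V 0 2 + ((\<Sum>j\<in>{2..<n - 1}. H 1 j) + H 1 (n - 1) + (\<Sum>l\<in>{1..<n - 1}. V l n)) =
      (H 0 1 + (\<Sum>j\<in>{2..<n - 1}. H 0 j)) + (V 0 (n - 1) + H 1 (n - 1)) + (\<Sum>l\<in>{1..<n - 1}. V l n)"
    using row[of 0 "n - 1"] n3 by (simp add: numeral_2_eq_2)
  also have "H 0 1 + (\<Sum>j\<in>{2..<n - 1}. H 0 j) = (\<Sum>j\<in>{1..<n - 1}. H 0 j)"
    using sum.atLeast_Suc_lessThan[of 1 "n - 1" "H 0"] n3 by (simp add: numeral_2_eq_2)
  finally have total: "(\<Sum>j\<in>{1..<n}. E j) = Arg (- Q / P) - 2 * \<theta>" unfolding s1 s2 c0 by simp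
  have "(\<Sum>i<n. Arg (turn i)) = (\<Sum>j<n. E j)"
    unfolding E_def by (rule sum.reindex_bij_betw[OF bij, symmetric])
  also have "\<dots> = E 0 + (\<Sum>j\<in>{1..<n}. E j)"
    using n3 by (simp add: lessThan_atLeast0 sum.atLeast_Suc_lessThan)
  finally have sum: "(\<Sum>i<n. Arg (turn i)) = 2 * Arg (- Q / P) - 2 * \<theta>" using total E0 by simp
  have "1 \<le> n - 1" "n - 1 < n" "1 < n" using n3 by auto
  then have th: "\<bar>\<theta>\<bar> < pi" using up[of "n - 1"] up[of 1] unfolding \<theta>_def P_def Q_def by (auto simp: abs_less_iff)
  have QP: "Arg (Q / P) = \<theta>" unfolding \<theta>_def by (rule Arg_quotient[OF Pz Qz]) (use th in \<open>simp add: \<theta>_def\<close>)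
  have "\<theta> \<noteq> 0"
  proof
    assume "\<theta> = 0"
    then have "Q / P \<in> \<real>" using QP Arg_eq_0 by metis
    then show False using nr Reals_minus_iff[of "Q / P"] by simp
  qed
  moreover have QPe: "Q / P = of_real (norm (Q / P)) * exp (\<i> * of_real \<theta>)"
    using Arg_eq[of "Q / P"] Pz Qz QP by simp
  have m: "- Q / P = of_real (norm (Q / P)) * (- exp (\<i> * of_real \<theta>))"
    using QPe by (metis minus_divide_left mult_minus_right)
  \<comment> \<open>Negation shifts the angle by \<pi> towards the side that stays in the range of
    \<open>Arg\<close>. Hence 2 (Arg (-Q / P) - \<theta>) is -2 \<pi> or 2 \<pi> according to the
    sign of \<theta>.\<close>
  have "Arg (- Q / P) = \<theta> - pi" if "\<theta> > 0"
  proof (rule Arg_unique[of "norm (Q / P)"])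
    show "of_real (norm (Q / P)) * exp (\<i> * of_real (\<theta> - pi)) = - Q / P"
      unfolding m by (simp add: exp_diff right_diff_distrib)
  qed (use th that Pz Qz in auto)
  moreover have "Arg (- Q / P) = \<theta> + pi" if "\<theta> < 0"
  proof (rule Arg_unique[of "norm (Q / P)"])
    show "of_real (norm (Q / P)) * exp (\<i> * of_real (\<theta> + pi)) = - Q / P"
      unfolding m by (simp add: exp_add distrib_left)
  qed (use th that Pz Qz in auto)
  ultimately show ?thesis unfolding sum by (cases "\<theta> > 0") auto
qed

text \<open>The turning is 2 \<pi> or -2 \<pi>, and with either sign the sum is at least (n - 2)
  \<pi>, whatever orientation the shoelace sum assigns. A lower bound on the angles is what the
  upper bound on the curvature rests on.\<close>

lemma int_angle_sum: "(\<Sum>i<n. int_angle v n i) \<ge> (real n - 2) * pi"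
proof -
  have "(\<Sum>i<n. int_angle v n i) = (\<Sum>i<n. if ccw_polygon v n then pi - Arg (turn i) else pi + Arg (turn i))"
    by (intro sum.cong refl int_angle_turn) simp
  also have "\<dots> = real n * pi + (if ccw_polygon v n then - (\<Sum>i<n. Arg (turn i)) else (\<Sum>i<n. Arg (turn i)))"
    by (simp add: sum_subtractf sum.distrib)
  finally show ?thesis using total_turn by (auto simp: left_diff_distrib abs_if split: if_splits)
qed

end

section \<open>The boundary of a simple polygon\<close>

context polygon begin

abbreviation "L \<equiv> perim v n"
abbreviation "cl \<equiv> cumlen v n"

lemma elen_pos: "i < n \<Longrightarrow> elen v n i > 0"
  using edg_nz[of i] by (simp add: elen_def edg_def)

lemma cl_Suc: "cl (Suc i) = cl i + elen v n i"
  by (simp add: cumlen_def)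

lemma cl_0 [simp]: "cl 0 = 0" and cl_n: "cl n = L"
  by (simp_all add: cumlen_def perim_def)

lemma cl_less: "i < j \<Longrightarrow> j \<le> n \<Longrightarrow> cl i < cl j"
proof (induction j)
  case (Suc j)
  have "cl j < cl (Suc j)" using elen_pos[of j] Suc.prems by (simp add: cl_Suc)
  then show ?case using Suc by (cases "i = j") auto
qed simp

lemma cl_le: "i \<le> j \<Longrightarrow> j \<le> n \<Longrightarrow> cl i \<le> cl j"
  using cl_less[of i j] by (cases "i = j") auto

lemma L_pos: "L > 0"
  using cl_less[of 0 n] n3 by (simp add: cl_n)

lemma wrap_window: "wrap v n s = window L 0 s"
  using L_pos by (simp add: wrap_def window_def frac_def field_simps)

lemma ex_edge:
  assumes "0 \<le> u" "u < L" obtains i where "i < n" "cl i \<le> u" "u < cl (Suc i)"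
proof -
  have "\<exists>i<m. cl i \<le> u \<and> u < cl (Suc i)" if "u < cl m" for m
    using that
  proof (induction m)
    case 0 then show ?case using assms by simp
  next
    case (Suc m) then show ?case by (cases "u < cl m") (auto simp: not_less less_Suc_eq)
  qed
  from this[of n] show thesis using assms that by (auto simp: cl_n)
qed

lemma edge_unique:
  assumes "i < n" "j < n" "cl i \<le> u" "u < cl (Suc i)" "cl j \<le> u" "u < cl (Suc j)" shows "i = j"
proof (rule ccontr)
  assume "i \<noteq> j"
  then have "Suc i \<le> j \<or> Suc j \<le> i" by linarith
  then show False
  proof
    assume "Suc i \<le> j"
    then have "cl (Suc i) \<le> cl j" by (rule cl_le) (simp add: assms(2) less_imp_le)
    then show False using assms(4,5) by linarith
  next
    assume "Suc j \<le> i"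
    then have "cl (Suc j) \<le> cl i" by (rule cl_le) (simp add: assms(1) less_imp_le)
    then show False using assms(3,6) by linarith
  qed
qed

lemma bpt_edge_less:
  assumes i: "i < n" "cl i \<le> u" "u < cl (Suc i)"
  shows "bpt v n u = v i + of_real ((u - cl i) / elen v n i) * edg i"
proof -
  have "0 \<le> u" using cl_le[of 0 i] i by simp
  moreover have "u < L" using cl_le[of "Suc i" n] i by (simp add: cl_n)
  ultimately have w: "wrap v n u = u" using window_id[OF L_pos, of 0 u] by (simp add: wrap_window)
  have "(THE j. j < n \<and> cl j \<le> u \<and> u < cl (Suc j)) = i"
    by (rule the_equality) (use i edge_unique in auto)
  then show ?thesis unfolding bpt_def w Let_def by (simp add: edg_def)
qed

lemma bpt_cong_per: "cong_per L s t \<Longrightarrow> bpt v n s = bpt v n t"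
proof -
  assume "cong_per L s t"
  then have e: "window L 0 s = window L 0 t" using window_eq_iff[OF L_pos] by blast
  show ?thesis unfolding bpt_def wrap_window e ..
qed

lemma bpt_cl: "i < n \<Longrightarrow> bpt v n (cl i) = v i"
  using bpt_edge_less[of i "cl i"] elen_pos[of i] by (simp add: cl_Suc)

lemma bpt_cl_Suc: "i < n \<Longrightarrow> bpt v n (cl (Suc i)) = v (nxt n i)"
proof (cases "Suc i < n")
  case True then show ?thesis using bpt_cl[of "Suc i"] by (simp add: nxt_def)
next
  assume "i < n" case False
  then have e: "Suc i = n" using \<open>i < n\<close> by simp
  have "bpt v n (0 + L) = bpt v n 0" by (rule bpt_cong_per[OF cong_per_sym[OF cong_per_plus_period]])
  then show ?thesis using bpt_cl[of 0] n3 e by (simp add: cl_n nxt_def)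
qed

lemma bpt_edge:
  assumes i: "i < n" "cl i \<le> u" "u \<le> cl (Suc i)"
  shows "bpt v n u = v i + of_real ((u - cl i) / elen v n i) * edg i"
proof (cases "u = cl (Suc i)")
  case True then show ?thesis using bpt_cl_Suc[OF i(1)] elen_pos[OF i(1)] by (simp add: cl_Suc edg_def)
qed (use bpt_edge_less[OF i(1,2)] i in simp)

lemma bpt_in_edge:
  assumes i: "i < n" "cl i \<le> u" "u \<le> cl (Suc i)" shows "bpt v n u \<in> pedge v n i"
proof -
  define t where "t = (u - cl i) / elen v n i"
  have "0 \<le> t" "t \<le> 1" using i elen_pos[OF i(1)] by (auto simp: t_def cl_Suc divide_le_eq)
  moreover have "bpt v n u = (1 - t) *\<^sub>R v i + t *\<^sub>R v (nxt n i)"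
    unfolding bpt_edge[OF i] by (simp add: t_def[symmetric] edg_def scaleR_conv_of_real algebra_simps)
  ultimately show ?thesis unfolding pedge_def in_segment by blast
qed

lemma edge_eq_bpt: "i < n \<Longrightarrow> pedge v n i = bpt v n ` {cl i..cl (Suc i)}"
proof (intro subset_antisym subsetI)
  assume i: "i < n"
  fix x assume "x \<in> pedge v n i"
  then obtain t where t: "0 \<le> t" "t \<le> 1" "x = (1 - t) *\<^sub>R v i + t *\<^sub>R v (nxt n i)" unfolding pedge_def in_segment by blast
  define u where "u = cl i + t * elen v n i"
  have u: "cl i \<le> u" "u \<le> cl (Suc i)" using t elen_pos[OF i] by (auto simp: u_def cl_Suc mult_left_le_one_le)
  have "bpt v n u = x" unfolding bpt_edge[OF i u] using elen_pos[OF i] t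
    by (simp add: u_def edg_def scaleR_conv_of_real algebra_simps)
  then show "x \<in> bpt v n ` {cl i..cl (Suc i)}" using u by force
qed (use bpt_in_edge in auto)

lemma bpt_pbdry: "bpt v n u \<in> pbdry v n"
proof -
  obtain i where "i < n" "cl i \<le> window L 0 u" "window L 0 u < cl (Suc i)"
    using ex_edge[OF window_ge[OF L_pos, of 0 u]] window_less[OF L_pos, of 0 u] by auto
  then have "bpt v n (window L 0 u) \<in> pbdry v n" using bpt_in_edge[of i "window L 0 u"] by (auto simp: pbdry_def)
  then show ?thesis using bpt_cong_per[OF window_cong_per] by simp
qed

lemma pbdry_eq: "pbdry v n = bpt v n ` {a..<a + L}"
proof (intro subset_antisym subsetI)
  fix x assume "x \<in> pbdry v n"
  then obtain u where "x = bpt v n u" unfolding pbdry_def using edge_eq_bpt by auto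
  then have "x = bpt v n (window L a u)" using bpt_cong_per[OF window_cong_per] by simp
  then show "x \<in> bpt v n ` {a..<a + L}" using window_in[OF L_pos] by blast
qed (use bpt_pbdry in auto)

text \<open>Edges are parametrised injectively, and two of them meet at most in a vertex that is the
  end of one and the start of the other. The half-open parameter intervals leave out the end
  (\<open>ne\<close>), so such a vertex is not counted twice.\<close>

lemma bpt_eq_iff: "bpt v n s = bpt v n t \<longleftrightarrow> cong_per L s t"
proof
  assume e: "bpt v n s = bpt v n t"
  define a b where "a = window L 0 s" and "b = window L 0 t"
  have ab: "bpt v n a = bpt v n b" using e bpt_cong_per[OF window_cong_per] by (simp add: a_def b_def)
  obtain i where i: "i < n" "cl i \<le> a" "a < cl (Suc i)"
    using ex_edge[OF window_ge[OF L_pos, of 0 s]] window_less[OF L_pos, of 0 s] by (auto simp: a_def)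
  obtain j where j: "j < n" "cl j \<le> b" "b < cl (Suc j)"
    using ex_edge[OF window_ge[OF L_pos, of 0 t]] window_less[OF L_pos, of 0 t] by (auto simp: b_def)
  have ne: "bpt v n u \<noteq> v (nxt n i)" if "i < n" "cl i \<le> u" "u < cl (Suc i)" for i u
  proof
    assume "bpt v n u = v (nxt n i)"
    then have "of_real ((u - cl i) / elen v n i) * edg i = 1 * edg i" unfolding bpt_edge_less[OF that] by (simp add: edg_def algebra_simps)
    then have "of_real ((u - cl i) / elen v n i) = (1 :: complex)"
      unfolding mult_cancel_right using edg_nz[OF that(1)] by blast
    then have "(u - cl i) / elen v n i = 1" by (simp only: of_real_eq_1_iff)
    then show False using that(3) elen_pos[OF that(1)] by (simp add: cl_Suc)
  qed
  have ij: "i = j"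
  proof (rule ccontr)
    assume n: "i \<noteq> j"
    have "bpt v n a \<in> pedge v n i \<inter> pedge v n j" using bpt_in_edge[of i a] bpt_in_edge[of j b] i j ab by auto
    also have "\<dots> = (if j = nxt n i then {v j} else if i = nxt n j then {v i} else {})"
      using simple i(1) j(1) n unfolding simple_polygon_def by blast
    finally have "j = nxt n i \<and> bpt v n a = v j \<or> i = nxt n j \<and> bpt v n b = v i" using ab by (auto split: if_splits)
    then show False using ne[OF i] ne[OF j] by auto
  qed
  have "of_real ((a - cl i) / elen v n i) * edg i = of_real ((b - cl i) / elen v n i) * edg i"
    using ab bpt_edge_less[OF i] bpt_edge_less[OF j] ij by simp
  then have "(a - cl i) / elen v n i = (b - cl i) / elen v n i"
    using edg_nz[OF i(1)] by (simp only: mult_cancel_right of_real_eq_iff) simp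
  then have "a = b" using elen_pos[OF i(1)] by simp
  then show "cong_per L s t" using window_eq_iff[OF L_pos] by (simp add: a_def b_def)
qed (rule bpt_cong_per)

lemma continuous_bpt: "continuous_on S (bpt v n)"
proof -
  have c0: "continuous_on {cl i..cl (Suc i)} (bpt v n)" if i: "i < n" for i
  proof -
    have "continuous_on {cl i..cl (Suc i)} (\<lambda>u. v i + of_real ((u - cl i) / elen v n i) * edg i)"
      using elen_pos[OF i] by (intro continuous_intros) auto
    then show ?thesis by (rule continuous_on_eq) (use bpt_edge[OF i] in auto)
  qed
  have c1: "continuous_on {0..cl m} (bpt v n)" if "m \<le> n" for m
    using that
  proof (induction m)
    case (Suc m)
    have "{0..cl (Suc m)} = {0..cl m} \<union> {cl m..cl (Suc m)}"
      using cl_le[of 0 m] cl_le[of m "Suc m"] Suc.prems by auto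
    then show ?case using continuous_on_closed_Un[of "{0..cl m}" "{cl m..cl (Suc m)}" "bpt v n"] c0[of m] Suc by auto
  qed simp
  have c2: "continuous_on {of_int k * L..of_int k * L + L} (bpt v n)" for k
  proof -
    have "continuous_on {of_int k * L..of_int k * L + L} (bpt v n \<circ> (\<lambda>u. u - of_int k * L))"
      by (rule continuous_on_compose) (use c1[of n] in \<open>auto intro!: continuous_intros simp: cl_n\<close>)
    then show ?thesis
    proof (rule continuous_on_eq)
      fix x
      have "cong_per L (x - of_int k * L) x" using cong_per_plus_int[of L "x - of_int k * L" k] by simp
      then show "(bpt v n \<circ> (\<lambda>u. u - of_int k * L)) x = bpt v n x" by (simp add: bpt_cong_per)
    qed
  qed
  have "isCont (bpt v n) x" for x
  proof -
    define k where "k = \<lfloor>x / L\<rfloor>"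
    have "of_int k \<le> x / L" "x / L < of_int k + 1" unfolding k_def by linarith+
    then have k: "of_int k * L \<le> x" "x < of_int k * L + L"
      using L_pos by (simp_all add: pos_le_divide_eq pos_divide_less_eq algebra_simps)
    have e: "{of_int (k - 1) * L..of_int k * L + L} = {of_int (k - 1) * L..of_int (k - 1) * L + L} \<union> {of_int k * L..of_int k * L + L}"
      using L_pos by (auto simp: algebra_simps)
    have "continuous_on {of_int (k - 1) * L..of_int k * L + L} (bpt v n)"
      unfolding e by (intro continuous_on_closed_Un c2 closed_atLeastAtMost)
    moreover have "x \<in> interior {of_int (k - 1) * L..of_int k * L + L}"
      using k L_pos by (simp add: algebra_simps)
    ultimately show ?thesis by (rule continuous_on_interior)
  qed
  then show ?thesis by (simp add: continuous_at_imp_continuous_on)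
qed

definition "arcp p q = bpt v n \<circ> (\<lambda>t. p + t * (q - p))"

lemma arcp_ends: "pathstart (arcp p q) = bpt v n p" "pathfinish (arcp p q) = bpt v n q"
  by (simp_all add: arcp_def pathstart_def pathfinish_def)

lemma path_arcp: "path (arcp p q)"
  unfolding path_def arcp_def by (intro continuous_on_compose continuous_bpt continuous_intros)

lemma path_image_arcp: assumes "p \<le> q" shows "path_image (arcp p q) = bpt v n ` {p..q}"
proof -
  have "(\<lambda>t. p + t * (q - p)) ` {0..1} = {p..q}"
    using image_affinity_atLeastAtMost[of "q - p" p 0 1] assms by (simp add: mult.commute add.commute)
  moreover have "path_image (arcp p q) = bpt v n ` (\<lambda>t. p + t * (q - p)) ` {0..1}"
    by (simp add: path_image_def arcp_def image_comp)
  ultimately show ?thesis by simp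
qed

lemma arc_arcp: assumes "p < q" "q < p + L" shows "arc (arcp p q)"
  unfolding arc_def
proof (intro conjI path_arcp inj_onI)
  fix s t :: real assume st: "s \<in> {0..1}" "t \<in> {0..1}" "arcp p q s = arcp p q t"
  then have "cong_per L (p + s * (q - p)) (p + t * (q - p))" by (simp add: arcp_def bpt_eq_iff)
  moreover have "\<bar>(p + s * (q - p)) - (p + t * (q - p))\<bar> < L"
  proof -
    have 1: "\<bar>s - t\<bar> * (q - p) \<le> 1 * (q - p)" using st assms by (intro mult_right_mono) auto
    have 2: "(p + s * (q - p)) - (p + t * (q - p)) = (s - t) * (q - p)" by (simp add: algebra_simps)
    have 3: "\<bar>q - p\<bar> = q - p" using assms(1) by simp
    show ?thesis unfolding 2 abs_mult 3 by (rule le_less_trans[OF 1]) (use assms(2) in simp)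
  qed
  ultimately have "p + s * (q - p) = p + t * (q - p)" by (rule cong_per_close_eq[OF L_pos])
  then show "s = t" using assms by simp
qed

lemma simple_path_arcp: "simple_path (arcp p (p + L))"
  unfolding simple_path_def loop_free_def
proof (intro conjI path_arcp ballI impI)
  fix s t :: real assume st: "s \<in> {0..1}" "t \<in> {0..1}" "arcp p (p + L) s = arcp p (p + L) t"
  then have c: "cong_per L (p + s * L) (p + t * L)" by (simp add: arcp_def bpt_eq_iff)
  show "s = t \<or> s = 0 \<and> t = 1 \<or> s = 1 \<and> t = 0"
  proof (cases "\<bar>s - t\<bar> < 1")
    case True
    then have "\<bar>s - t\<bar> * L < 1 * L" using L_pos by (intro mult_strict_right_mono)
    moreover have "\<bar>(p + s * L) - (p + t * L)\<bar> = \<bar>s - t\<bar> * L"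
      using L_pos by (simp add: abs_mult left_diff_distrib[symmetric])
    ultimately have "p + s * L = p + t * L" by (intro cong_per_close_eq[OF L_pos c]) simp
    then show ?thesis using L_pos by simp
  qed (use st in auto)
qed

end

section \<open>Glued pairs do not interleave\<close>

text \<open>Stereographic projection from the point z off the curve leads to a Jordan curve in the
  plane. The part A of the sphere over its inside is open and closed in the complement of the curve,
  nonempty, and without z.\<close>

lemma sphere_jordan_separates:
  fixes \<gamma> :: "real \<Rightarrow> real^3"
  assumes \<gamma>: "simple_path \<gamma>" "pathfinish \<gamma> = pathstart \<gamma>" "path_image \<gamma> \<subseteq> sphere 0 1"
    and z: "z \<in> sphere 0 1 - path_image \<gamma>"
  shows "\<not> connected (sphere 0 1 - path_image \<gamma>)"
proof
  let ?S = "sphere 0 1 :: (real^3) set" and ?J = "path_image \<gamma>"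
  assume conn: "connected (?S - ?J)"
  have "(?S - {z}) homeomorphic (UNIV :: complex set)"
    using z by (intro homeomorphic_punctured_sphere_affine) (auto simp: affine_UNIV)
  then obtain h k where hk: "homeomorphism (?S - {z}) (UNIV :: complex set) h k" unfolding homeomorphic_def by blast
  have ch: "continuous_on (?S - {z}) h" and ck: "continuous_on UNIV k" and kim: "k ` UNIV = ?S - {z}"
    and kh: "\<And>x. x \<in> ?S - {z} \<Longrightarrow> k (h x) = x" and hkk: "\<And>y. h (k y) = y"
    using hk unfolding homeomorphism_def by auto
  have Jsub: "?J \<subseteq> ?S - {z}" using \<gamma>(3) z by blast
  define g where "g = h \<circ> \<gamma>"
  have inj: "inj_on h (path_image \<gamma>)" using kh Jsub by (metis inj_on_def subsetD)
  have sg: "simple_path g" unfolding g_def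
    by (rule simple_path_continuous_image[OF \<gamma>(1) continuous_on_subset[OF ch Jsub] inj])
  have lg: "pathfinish g = pathstart g" using \<gamma>(2) by (simp add: g_def pathfinish_compose pathstart_compose)
  have pg: "path_image g = h ` ?J" by (simp add: g_def path_image_compose)
  define I where "I = inside (path_image g)"
  have I: "I \<noteq> {}" "open I" "bounded I" "frontier I = path_image g"
    using Jordan_inside_outside[OF sg lg] by (auto simp: I_def)
  have dis: "I \<inter> path_image g = {}" unfolding I_def by (rule inside_no_overlap)
  have kJ: "k ` path_image g = ?J" unfolding pg using kh Jsub by (force simp: image_image)
  define A where "A = k ` I"
  have kinj: "k x = k y \<longleftrightarrow> x = y" for x y using hkk by metis
  have "inj k" using kinj by (simp add: inj_def)
  then have AJ: "A \<inter> ?J = {}" unfolding A_def kJ[symmetric] using dis by (simp add: image_Int[symmetric])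
  have AS: "A \<subseteq> ?S - ?J" using kim AJ by (auto simp: A_def)
  have zA: "z \<notin> A" using kim by (auto simp: A_def)
  have "closure I = I \<union> path_image g" using I(4) by (simp add: closure_Un_frontier)
  then have "compact (I \<union> path_image g)" using I(3) by (metis compact_closure)
  then have "compact (k ` (I \<union> path_image g))" by (rule compact_continuous_image[OF continuous_on_subset[OF ck], rotated]) simp
  then have cl: "closed (A \<union> ?J)" unfolding image_Un kJ A_def[symmetric] by (rule compact_imp_closed)
  have "A = (?S - ?J) \<inter> (A \<union> ?J)" using AS by blast
  then have c: "closedin (top_of_set (?S - ?J)) A" using cl by (metis closedin_closed_Int)
  have "A = (?S - {z}) \<inter> h -` I"
  proof (intro subset_antisym subsetI)
    fix x assume "x \<in> A"
    then obtain y where "y \<in> I" "x = k y" by (auto simp: A_def)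
    moreover have "k y \<in> ?S - {z}" unfolding kim[symmetric] by simp
    ultimately show "x \<in> (?S - {z}) \<inter> h -` I" using hkk[of y] by simp
  next
    fix x assume "x \<in> (?S - {z}) \<inter> h -` I"
    then have "x = k (h x)" "h x \<in> I" using kh by auto
    then show "x \<in> A" unfolding A_def by (rule image_eqI)
  qed
  then have "openin (top_of_set (?S - {z})) A" using continuous_openin_preimage_gen[OF ch I(2)] by simp
  moreover have "openin (top_of_set ?S) (?S - {z})" by (simp add: openin_delete)
  ultimately have "openin (top_of_set ?S) A" using openin_trans by blast
  then have o: "openin (top_of_set (?S - ?J)) A" by (rule openin_subset_trans) (use AS in auto)
  have "A = {} \<or> A = ?S - ?J" using conn o c unfolding connected_clopen by blast
  then show False using z zA I(1) by (auto simp: A_def)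
qed

text \<open>Near its point x a segment is a cone with apex x: it stops only at an end point, which
  is x itself or at distance at least \<epsilon>. So a ray from x that meets the segment near x
  stays in it up to distance \<epsilon>.\<close>

lemma segment_cone:
  fixes a b x z :: "'a :: euclidean_space"
  assumes x: "x \<in> closed_segment a b" and e: "a \<noteq> x \<longrightarrow> \<epsilon> \<le> dist x a" "b \<noteq> x \<longrightarrow> \<epsilon> \<le> dist x b"
    and z: "dist x z < \<epsilon>" and t: "0 < \<tau>" "\<tau> \<le> 1" and w: "x + \<tau> *\<^sub>R (z - x) \<in> closed_segment a b"
    and ab: "a \<noteq> b"
  shows "z \<in> closed_segment a b"
proof -
  obtain s where s: "0 \<le> s" "s \<le> 1" "x = a + s *\<^sub>R (b - a)" using x unfolding in_segment by (auto simp: algebra_simps)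
  obtain r where r: "0 \<le> r" "r \<le> 1" "x + \<tau> *\<^sub>R (z - x) = a + r *\<^sub>R (b - a)" using w unfolding in_segment by (auto simp: algebra_simps)
  define \<sigma> where "\<sigma> = s + (r - s) / \<tau>"
  have "\<tau> *\<^sub>R (z - x) = (a + r *\<^sub>R (b - a)) - x" using r(3) by (metis add_diff_cancel_left')
  also have "\<dots> = (r - s) *\<^sub>R (b - a)" by (subst s(3)) (simp add: scaleR_diff_left)
  finally have tz: "\<tau> *\<^sub>R (z - x) = (r - s) *\<^sub>R (b - a)" .
  have "z - x = (1 / \<tau>) *\<^sub>R (\<tau> *\<^sub>R (z - x))" using t by simp
  also have "\<dots> = ((r - s) / \<tau>) *\<^sub>R (b - a)" unfolding tz by simp
  finally have zx: "z - x = (\<sigma> - s) *\<^sub>R (b - a)" by (simp add: \<sigma>_def)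
  have "z = x + (z - x)" by simp
  also have "\<dots> = (a + s *\<^sub>R (b - a)) + (\<sigma> - s) *\<^sub>R (b - a)" by (simp only: zx s(3)[symmetric])
  also have "\<dots> = a + \<sigma> *\<^sub>R (b - a)" by (simp add: scaleR_diff_left)
  finally have zs: "z = a + \<sigma> *\<^sub>R (b - a)" .
  have nb: "norm (b - a) > 0" using ab by simp
  have dz: "\<bar>\<sigma> - s\<bar> * norm (b - a) < \<epsilon>" using z zx by (metis dist_norm norm_minus_commute norm_scaleR)
  have "0 \<le> \<sigma>"
  proof (rule ccontr)
    assume n: "\<not> 0 \<le> \<sigma>"
    then have "(r - s) / \<tau> < 0" using s by (simp add: \<sigma>_def)
    then have "r < s" using t by (simp add: divide_less_0_iff)
    then have s0: "s > 0" using r by simp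
    then have "dist x a = s * norm (b - a)" using s(3) by (simp add: dist_norm)
    moreover have "a \<noteq> x" using s0 s(3) ab by simp
    ultimately have "\<bar>\<sigma> - s\<bar> * norm (b - a) < s * norm (b - a)" using e(1) dz by simp
    then show False using nb n s0 by simp
  qed
  moreover have "\<sigma> \<le> 1"
  proof (rule ccontr)
    assume n: "\<not> \<sigma> \<le> 1"
    then have "(r - s) / \<tau> > 0" using s by (simp add: \<sigma>_def)
    then have "r > s" using t by (simp add: zero_less_divide_iff)
    then have s1: "s < 1" using r by simp
    have "b - x = (1 - s) *\<^sub>R (b - a)" using s(3) by (simp add: algebra_simps)
    then have "dist x b = (1 - s) * norm (b - a)" using s1 by (simp add: dist_norm norm_minus_commute)
    moreover from this have "b \<noteq> x" using s1 nb by auto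
    ultimately have "\<bar>\<sigma> - s\<bar> * norm (b - a) < (1 - s) * norm (b - a)" using e(2) dz by simp
    then show False using nb n s1 by simp
  qed
  ultimately show ?thesis unfolding in_segment zs by (intro exI[of _ \<sigma>]) (simp add: algebra_simps)
qed

section \<open>Accessible boundary points and crosscuts\<close>

context polygon begin

lemma jordan: "pbdry v n = path_image (arcp 0 (0 + L))" "inside (pbdry v n) \<noteq> {}" "open (inside (pbdry v n))"
  "connected (inside (pbdry v n))" "frontier (inside (pbdry v n)) = pbdry v n"
proof -
  have "bpt v n ` {0..L} = bpt v n ` {0..<0 + L}"
  proof -
    have "bpt v n L = bpt v n 0" using bpt_cong_per[OF cong_per_plus_period[of L 0]] by simp
    moreover have "{0..L} = insert L {0..<0 + L}" using L_pos by auto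
    moreover have "bpt v n 0 \<in> bpt v n ` {0..<0 + L}" using L_pos by auto
    ultimately show ?thesis by auto
  qed
  then show e: "pbdry v n = path_image (arcp 0 (0 + L))"
    using path_image_arcp[of 0 "0 + L"] L_pos pbdry_eq[of 0] by simp
  have "pathfinish (arcp 0 (0 + L)) = pathstart (arcp 0 (0 + L))"
    unfolding arcp_ends by (rule bpt_cong_per[OF cong_per_sym[OF cong_per_plus_period]])
  from Jordan_inside_outside[OF simple_path_arcp this]
  show "inside (pbdry v n) \<noteq> {}" "open (inside (pbdry v n))"
    "connected (inside (pbdry v n))" "frontier (inside (pbdry v n)) = pbdry v n" unfolding e by auto
qed

text \<open>Close to x the boundary is a cone with apex x. If the segment from x to a nearby inside
  point z met the boundary after x, then z would itself be a boundary point.\<close>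

lemma access:
  assumes x: "x \<in> pbdry v n"
  obtains z where "z \<in> inside (pbdry v n)" "closed_segment x z - {x} \<subseteq> inside (pbdry v n)"
proof -
  have "\<exists>\<epsilon>>0. \<forall>z \<tau>. dist x z < \<epsilon> \<longrightarrow> 0 < \<tau> \<longrightarrow> \<tau> \<le> 1 \<longrightarrow> x + \<tau> *\<^sub>R (z - x) \<in> pedge v n i \<longrightarrow> z \<in> pedge v n i"
    if i: "i < n" for i
  proof (cases "x \<in> pedge v n i")
    case False
    then obtain \<epsilon> where e: "\<epsilon> > 0" "\<forall>y\<in>pedge v n i. \<epsilon> \<le> dist x y"
      using separate_point_closed[of "pedge v n i" x] by (auto simp: pedge_def)
    have "x + \<tau> *\<^sub>R (z - x) \<notin> pedge v n i" if "dist x z < \<epsilon>" "0 < \<tau>" "\<tau> \<le> 1" for z \<tau>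
    proof
      assume "x + \<tau> *\<^sub>R (z - x) \<in> pedge v n i"
      then have "\<epsilon> \<le> dist x (x + \<tau> *\<^sub>R (z - x))" using e by blast
      also have "\<dots> = \<tau> * dist x z" using that by (simp add: dist_norm norm_minus_commute)
      also have "\<dots> \<le> 1 * dist x z" using that by (intro mult_right_mono) auto
      finally show False using that by simp
    qed
    then show ?thesis using e(1) by blast
  next
    case True
    let ?a = "v i" and ?b = "v (nxt n i)"
    define \<epsilon> where "\<epsilon> = min (if ?a = x then 1 else dist x ?a) (if ?b = x then 1 else dist x ?b)"
    have ne: "?a \<noteq> ?b" using edg_nz[OF i] by (auto simp: edg_def)
    show ?thesis
    proof (intro exI[of _ \<epsilon>] conjI allI impI)
      show "\<epsilon> > 0" by (auto simp: \<epsilon>_def)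
      fix z \<tau> assume h: "dist x z < \<epsilon>" "0 < \<tau>" "\<tau> \<le> 1" "x + \<tau> *\<^sub>R (z - x) \<in> pedge v n i"
      show "z \<in> pedge v n i" unfolding pedge_def
        by (rule segment_cone[OF _ _ _ h(1-3) _ ne]) (use True h(4) in \<open>auto simp: pedge_def \<epsilon>_def\<close>)
    qed
  qed
  then obtain \<epsilon> where \<epsilon>: "\<And>i. i < n \<Longrightarrow> \<epsilon> i > 0"
    "\<And>i z \<tau>. i < n \<Longrightarrow> dist x z < \<epsilon> i \<Longrightarrow> 0 < \<tau> \<Longrightarrow> \<tau> \<le> 1 \<Longrightarrow> x + \<tau> *\<^sub>R (z - x) \<in> pedge v n i \<Longrightarrow> z \<in> pedge v n i"
    by metis
  define d where "d = Min (\<epsilon> ` {..<n})"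
  have "d \<in> \<epsilon> ` {..<n}" unfolding d_def using n3 by (intro Min_in) (auto simp: lessThan_empty_iff)
  then have d: "d > 0" using \<epsilon>(1) by auto
  have d_le: "d \<le> \<epsilon> i" if "i < n" for i unfolding d_def using that by simp
  have "x \<in> frontier (inside (pbdry v n))" using x jordan(5) by blast
  then have "x \<in> closure (inside (pbdry v n))" by (simp add: frontier_def)
  then obtain z where z: "z \<in> inside (pbdry v n)" "dist z x < d" using d closure_approachable by blast
  have out: "x + \<tau> *\<^sub>R (z - x) \<notin> pbdry v n" if t: "0 < \<tau>" "\<tau> \<le> 1" for \<tau>
  proof
    assume "x + \<tau> *\<^sub>R (z - x) \<in> pbdry v n"
    then obtain i where i: "i < n" "x + \<tau> *\<^sub>R (z - x) \<in> pedge v n i" by (auto simp: pbdry_def)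
    have "z \<in> pedge v n i" by (rule \<epsilon>(2)[OF i(1) _ t i(2)]) (use z(2) d_le[OF i(1)] in \<open>simp add: dist_commute\<close>)
    then have "z \<in> pbdry v n" using i(1) by (auto simp: pbdry_def)
    then show False using z(1) inside_no_overlap by blast
  qed
  show thesis
  proof (rule that[OF z(1)], rule subsetI)
    fix y assume y: "y \<in> closed_segment x z - {x}"
    then have "y \<in> closed_segment x z" by simp
    then obtain \<tau> where t': "0 \<le> \<tau>" "\<tau> \<le> 1" "y = (1 - \<tau>) *\<^sub>R x + \<tau> *\<^sub>R z" unfolding in_segment by blast
    then have t: "0 \<le> \<tau>" "\<tau> \<le> 1" "y = x + \<tau> *\<^sub>R (z - x)" by (simp_all add: algebra_simps)
    have t0: "\<tau> > 0" using t y by (cases "\<tau> = 0") auto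
    have "closed_segment y z \<subseteq> - pbdry v n"
    proof
      fix q assume "q \<in> closed_segment y z"
      then obtain u where u: "0 \<le> u" "u \<le> 1" "q = (1 - u) *\<^sub>R y + u *\<^sub>R z" unfolding in_segment by blast
      define \<rho> where "\<rho> = \<tau> + u * (1 - \<tau>)"
      have "q = x + \<rho> *\<^sub>R (z - x)" unfolding u(3) t(3) by (simp add: \<rho>_def algebra_simps)
      moreover have "0 < \<rho>" using t0 u t by (simp add: \<rho>_def add_pos_nonneg)
      moreover have "\<rho> \<le> 1"
      proof -
        have "u * (1 - \<tau>) \<le> 1 * (1 - \<tau>)" using u t by (intro mult_right_mono) auto
        then show ?thesis by (simp add: \<rho>_def)
      qed
      ultimately show "q \<in> - pbdry v n" using out by simp
    qed
    then have "connected_component (- pbdry v n) z y"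
      unfolding connected_component_def by (intro exI[of _ "closed_segment y z"]) auto
    then show "y \<in> inside (pbdry v n)" using inside_same_component z(1) by blast
  qed
qed

lemma crosscut:
  assumes x: "x \<in> pbdry v n" and y: "y \<in> pbdry v n" and ne: "x \<noteq> y"
  obtains c where "arc c" "pathstart c = x" "pathfinish c = y" "path_image c - {x, y} \<subseteq> inside (pbdry v n)"
proof -
  let ?I = "inside (pbdry v n)"
  obtain z where z: "z \<in> ?I" "closed_segment x z - {x} \<subseteq> ?I" using access[OF x] .
  obtain w where w: "w \<in> ?I" "closed_segment y w - {y} \<subseteq> ?I" using access[OF y] .
  have "path_connected ?I" using connected_open_path_connected jordan(3,4) by blast
  then obtain g where g: "path g" "path_image g \<subseteq> ?I" "pathstart g = z" "pathfinish g = w"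
    using z(1) w(1) unfolding path_connected_def by blast
  define p where "p = linepath x z +++ g +++ linepath w y"
  have "path p" unfolding p_def using g by simp
  moreover have ends: "pathstart p = x" "pathfinish p = y" by (simp_all add: p_def)
  ultimately obtain c where c: "arc c" "path_image c \<subseteq> path_image p" "pathstart c = x" "pathfinish c = y"
    using path_contains_arc[OF _ _ _ ne] by metis
  have "path_image p \<subseteq> closed_segment x z \<union> path_image g \<union> closed_segment w y"
    using g by (auto simp: p_def path_image_join)
  then have "path_image c - {x, y} \<subseteq> ?I" using c(2) z(2) w(2) g(2) closed_segment_commute[of w y] by blast
  then show thesis using that c by blast
qed

end

lemma glue_base_pbdry: "polygon v n \<Longrightarrow> (x, y) \<in> glue_base v n G \<Longrightarrow> x \<in> pbdry v n \<and> y \<in> pbdry v n"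
  unfolding glue_base_def using polygon.bpt_pbdry by blast

lemma glue_eq_sym: "(x, y) \<in> glue_eq v n G \<Longrightarrow> (y, x) \<in> glue_eq v n G"
proof -
  have "sym (glue_base v n G \<union> (glue_base v n G)\<inverse>)" by (auto simp: sym_def)
  then show "(x, y) \<in> glue_eq v n G \<Longrightarrow> (y, x) \<in> glue_eq v n G"
    unfolding glue_eq_def using sym_rtrancl symD by metis
qed

lemma glue_eq_trans: "(x, y) \<in> glue_eq v n G \<Longrightarrow> (y, z) \<in> glue_eq v n G \<Longrightarrow> (x, z) \<in> glue_eq v n G"
  unfolding glue_eq_def by simp

lemma glue_eq_refl: "(x, x) \<in> glue_eq v n G"
  unfolding glue_eq_def by simp

lemma glue_eq_cases:
  assumes "polygon v n" "(x, y) \<in> glue_eq v n G" shows "x = y \<or> x \<in> pbdry v n \<and> y \<in> pbdry v n"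
  using assms(2) unfolding glue_eq_def
proof (induction rule: rtrancl_induct)
  case (step y z) then show ?case using glue_base_pbdry[OF assms(1), of y z G] glue_base_pbdry[OF assms(1), of z y G] by auto
qed simp

text \<open>If two interleaved pairs were glued, the image of a crosscut joining the first pair would be a
  Jordan curve on the sphere whose complement is connected through the second pair.\<close>

lemma (in polygon) noncrossing:
  assumes f: "continuous_on (pregion v n) f" "f ` pregion v n = sphere (0 :: real^3) 1"
      "\<And>x y. x \<in> pregion v n \<Longrightarrow> y \<in> pregion v n \<Longrightarrow> f x = f y \<longleftrightarrow> (x, y) \<in> glue_eq v n G"
    and ord: "p < q" "q < p'" "p' < q'" "q' < p + L"
    and gl: "(bpt v n p, bpt v n p') \<in> glue_eq v n G" "(bpt v n q, bpt v n q') \<in> glue_eq v n G"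
  shows "(bpt v n p, bpt v n q) \<in> glue_eq v n G"
proof (rule ccontr)
  assume neg: "(bpt v n p, bpt v n q) \<notin> glue_eq v n G"
  let ?I = "inside (pbdry v n)"
  note sy = glue_eq_sym and tr = glue_eq_trans
  have pol: "polygon v n" ..
  define a b where "a = bpt v n p" and "b = bpt v n p'"
  have ab: "a \<noteq> b"
  proof
    assume "a = b"
    then have "cong_per L p p'" by (simp add: a_def b_def bpt_eq_iff)
    then show False using cong_per_close_eq[OF L_pos, of p p'] ord by simp
  qed
  have abB: "a \<in> pbdry v n" "b \<in> pbdry v n" by (simp_all add: a_def b_def bpt_pbdry)
  obtain c where c: "arc c" "pathstart c = a" "pathfinish c = b" "path_image c - {a, b} \<subseteq> ?I"
    using crosscut[OF abB ab] .
  define c1 where "c1 = arcp p p'"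
  define c2 where "c2 = reversepath (arcp p' (p + L))"
  have per: "bpt v n (p + L) = a" unfolding a_def by (rule bpt_cong_per[OF cong_per_sym[OF cong_per_plus_period]])
  have arcs: "arc c1" "arc c2" using ord unfolding c1_def c2_def by (auto intro!: arc_reversepath arc_arcp)
  have ends: "pathstart c1 = a" "pathfinish c1 = b" "pathstart c2 = a" "pathfinish c2 = b"
    by (simp_all add: c1_def c2_def arcp_ends per, simp_all add: a_def b_def)
  have im1: "path_image c1 = bpt v n ` {p..p'}" and im2: "path_image c2 = bpt v n ` {p'..p + L}"
    using ord by (simp_all add: c1_def c2_def path_image_arcp)
  have U: "path_image c1 \<union> path_image c2 = pbdry v n"
  proof
    show "path_image c1 \<union> path_image c2 \<subseteq> pbdry v n" unfolding im1 im2 using bpt_pbdry by auto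
    show "pbdry v n \<subseteq> path_image c1 \<union> path_image c2" unfolding im1 im2 pbdry_eq[of p] using ord by (auto simp: image_iff) (metis atLeastAtMost_iff less_eq_real_def linorder_linear)
  qed
  have N: "path_image c1 \<inter> path_image c2 = {a, b}"
  proof
    show "path_image c1 \<inter> path_image c2 \<subseteq> {a, b}"
    proof
      fix x assume "x \<in> path_image c1 \<inter> path_image c2"
      then obtain s t where s: "p \<le> s" "s \<le> p'" "x = bpt v n s" and t: "p' \<le> t" "t \<le> p + L" "x = bpt v n t"
        unfolding im1 im2 by auto
      have cg: "cong_per L s t" using s t by (simp add: bpt_eq_iff[symmetric])
      show "x \<in> {a, b}"
      proof (cases "s = t")
        case True
        then have "s = p'" using s t by simp
        then show ?thesis using s by (simp add: b_def)
      next
        case False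
        then have "s + L \<le> t" using cong_per_L_ge[OF L_pos cg] s t by simp
        then have "s = p" using s t by simp
        then show ?thesis using s by (simp add: a_def)
      qed
    qed
    show "{a, b} \<subseteq> path_image c1 \<inter> path_image c2"
      using ends pathstart_in_path_image[of c1] pathfinish_in_path_image[of c1]
        pathstart_in_path_image[of c2] pathfinish_in_path_image[of c2] by auto
  qed
  have abc: "a \<in> path_image c" "b \<in> path_image c"
    using c pathstart_in_path_image[of c] pathfinish_in_path_image[of c] by auto
  have cB: "path_image c \<inter> pbdry v n = {a, b}" using c(4) abc abB inside_no_overlap[of "pbdry v n"] by blast
  have N1: "path_image c1 \<inter> path_image c = {a, b}" "path_image c2 \<inter> path_image c = {a, b}"
    using cB U N abc by blast+
  have cI: "path_image c \<inter> ?I \<noteq> {}"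
  proof -
    have "c (1 / 2) \<notin> {a, b}"
    proof
      assume "c (1 / 2) \<in> {a, b}"
      then have "c (1 / 2) = c 0 \<or> c (1 / 2) = c 1" using c(2,3) by (auto simp: pathstart_def pathfinish_def)
      then show False using c(1) unfolding arc_def inj_on_def by force
    qed
    moreover have "c (1 / 2) \<in> path_image c" by (auto simp: path_image_def)
    ultimately show ?thesis using c(4) by blast
  qed
  obtain "inside (path_image c1 \<union> path_image c) \<inter> inside (path_image c2 \<union> path_image c) = {}"
    "inside (path_image c1 \<union> path_image c) \<union> inside (path_image c2 \<union> path_image c) \<union> (path_image c - {a, b}) = inside (path_image c1 \<union> path_image c2)"
    by (rule split_inside_simple_closed_curve[OF arc_imp_simple_path[OF arcs(1)] ends(1,2) arc_imp_simple_path[OF arcs(2)] ends(3,4)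
        arc_imp_simple_path[OF c(1)] c(2,3) ab N N1]) (use cI U in auto)
  note split = this
  define H where "H d = inside (path_image d \<union> path_image c)" for d
  have Hd: "connected (H d)" "path_image d \<subseteq> closure (H d)" "H d \<inter> path_image c = {}"
    if d: "arc d" "pathstart d = a" "pathfinish d = b" "path_image d \<inter> path_image c = {a, b}" for d
  proof -
    define l where "l = d +++ reversepath c"
    have sl: "simple_path l" unfolding l_def
      by (rule simple_path_join_loop) (use d c(1-3) in \<open>auto simp: arc_reversepath\<close>)
    have ll: "pathfinish l = pathstart l" using d c by (simp add: l_def)
    have pl: "path_image l = path_image d \<union> path_image c" using d c by (simp add: l_def path_image_join)
    note J = Jordan_inside_outside[OF sl ll, unfolded pl, folded H_def]
    show "connected (H d)" using J by blast
    have "frontier (H d) = path_image d \<union> path_image c" using J by blast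
    then show "path_image d \<subseteq> closure (H d)" unfolding frontier_def by blast
    show "H d \<inter> path_image c = {}" unfolding H_def using inside_no_overlap[of "path_image d \<union> path_image c"] by blast
  qed
  note H1 = Hd[OF arcs(1) ends(1,2) N1(1)] and H2 = Hd[OF arcs(2) ends(3,4) N1(2)]
  have Hu: "H c1 \<union> H c2 \<union> (path_image c - {a, b}) = ?I" using split(2) U by (simp add: H_def)
  define K where "K = {x. (a, x) \<in> glue_eq v n G}"
  have abK: "a \<in> K" "b \<in> K" using gl(1) glue_eq_refl by (auto simp: K_def a_def b_def)
  \<comment> \<open>One side of the crosscut with its boundary arc, without the points glued to a,
    because these are mapped onto the curve. The points q and q' survive since p and q are assumed
    not to be glued.\<close>
  define T where "T d = H d \<union> (path_image d - K)" for d
  have T: "connected (T c1)" "connected (T c2)" unfolding T_def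
    by (rule connected_intermediate_closure[OF H1(1)], use H1(2) closure_subset in blast, use H1(2) closure_subset[of "H c1"] in blast)
       (rule connected_intermediate_closure[OF H2(1)], use H2(2) closure_subset in blast, use H2(2) closure_subset[of "H c2"] in blast)
  have reg: "T c1 \<subseteq> pregion v n" "T c2 \<subseteq> pregion v n" "path_image c \<subseteq> pregion v n"
    using Hu U c(4) abB unfolding T_def pregion_def by blast+
  have qB: "bpt v n q \<in> pregion v n" "bpt v n q' \<in> pregion v n" by (simp_all add: pregion_def bpt_pbdry)
  have qT: "bpt v n q \<in> T c1"
    using neg ord unfolding T_def im1 K_def a_def by auto
  have q'T: "bpt v n q' \<in> T c2"
    using neg ord tr[OF _ sy[OF gl(2)], of "bpt v n p"] unfolding T_def im2 K_def a_def by auto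
  have fq: "f (bpt v n q) = f (bpt v n q')" using f(3)[OF qB] gl(2) by simp
  \<comment> \<open>The images of the two sides meet in the common image of q and q'.\<close>
  have "connected (f ` T c1 \<union> f ` T c2)"
  proof (rule connected_Un)
    show "connected (f ` T c1)" "connected (f ` T c2)"
      using T reg f(1) by (meson connected_continuous_image continuous_on_subset)+
    show "f ` T c1 \<inter> f ` T c2 \<noteq> {}" using qT q'T fq by (metis IntI empty_iff imageI)
  qed
  moreover have "f ` T c1 \<union> f ` T c2 = sphere 0 1 - f ` path_image c"
  proof (intro subset_antisym subsetI)
    fix y assume "y \<in> f ` T c1 \<union> f ` T c2"
    then obtain d z where z: "z \<in> T d" "y = f z" "d = c1 \<or> d = c2" by blast
    have zr: "z \<in> pregion v n" using z reg by blast
    have "y \<notin> f ` path_image c"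
    proof
      assume "y \<in> f ` path_image c"
      then obtain w where "w \<in> path_image c" "y = f w" by blast
      then have w: "w \<in> path_image c" "f z = f w" using z(2) by simp_all
      have g: "(z, w) \<in> glue_eq v n G" using f(3)[OF zr] w reg(3) by blast
      have zc: "z \<notin> path_image c"
      proof
        assume zc: "z \<in> path_image c"
        then have "z \<notin> H d" using z(3) H1(3) H2(3) by blast
        then have zd: "z \<in> path_image d - K" using z(1) by (simp add: T_def)
        have "path_image d \<inter> path_image c = {a, b}" using N1 z(3) by auto
        then have "z \<in> {a, b}" using zd zc by (metis DiffD1 IntI)
        then show False using zd abK by blast
      qed
      then have "z \<in> pbdry v n" "w \<in> pbdry v n" using glue_eq_cases[OF pol g] w(1) by auto
      then have "w \<in> {a, b}" using cB w by blast
      then have "z \<in> K" using tr[OF _ sy[OF g], of a] abK by (auto simp: K_def)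
      moreover have "z \<notin> H d" using \<open>z \<in> pbdry v n\<close> Hu z(3) inside_no_overlap[of "pbdry v n"] by blast
      ultimately show False using z(1) by (simp add: T_def)
    qed
    then show "y \<in> sphere 0 1 - f ` path_image c" using z(2) zr f(2) by blast
  next
    fix y assume y: "y \<in> sphere 0 1 - f ` path_image c"
    then obtain z where z: "z \<in> pregion v n" "y = f z" using f(2) by (metis DiffE imageE)
    have zc: "z \<notin> path_image c" using y z by blast
    have "z \<notin> K"
    proof
      assume "z \<in> K"
      then have "f a = f z" using f(3)[of a z] z abB by (simp add: K_def pregion_def)
      then show False using y z abc by (metis DiffD2 imageI)
    qed
    then have "z \<in> T c1 \<union> T c2" using z(1) zc Hu U unfolding T_def pregion_def by blast
    then show "y \<in> f ` T c1 \<union> f ` T c2" using z(2) by blast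
  qed
  ultimately have conn: "connected (sphere 0 1 - f ` path_image c)" by simp
  have cont: "continuous_on (path_image c) f" by (rule continuous_on_subset[OF f(1) reg(3)])
  have fab: "f a = f b" using f(3)[of a b] abB gl(1) by (simp add: pregion_def a_def b_def)
  have "simple_path (f \<circ> c)" unfolding simple_path_def loop_free_def
  proof (intro conjI ballI impI)
    show "path (f \<circ> c)" by (rule path_continuous_image[OF arc_imp_path[OF c(1)] cont])
    fix s t :: real assume st: "s \<in> {0..1}" "t \<in> {0..1}" "(f \<circ> c) s = (f \<circ> c) t"
    have cst: "c s \<in> path_image c" "c t \<in> path_image c" using st by (auto simp: path_image_def)
    have g: "(c s, c t) \<in> glue_eq v n G" using f(3)[of "c s" "c t"] cst reg(3) st by auto
    have inj: "s = t" if "c s = c t"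
      using c(1) st(1,2) that unfolding arc_def inj_on_def by blast
    have c01: "c 0 = a" "c 1 = b" using c(2,3) by (simp_all add: pathstart_def pathfinish_def)
    have injc: "u = w" if "c u = c w" "u \<in> {0..1}" "w \<in> {0..1}" for u w
      using c(1) that unfolding arc_def inj_on_def by blast
    show "s = t \<or> s = 0 \<and> t = 1 \<or> s = 1 \<and> t = 0"
    proof (cases "c s = c t")
      case False
      then have "c s \<in> {a, b}" "c t \<in> {a, b}" using glue_eq_cases[OF pol g] cst cB by blast+
      then have "c s = a \<and> c t = b \<or> c s = b \<and> c t = a" using False by auto
      then show ?thesis using injc[of s 0] injc[of t 1] injc[of s 1] injc[of t 0] st c01 by auto
    qed (use inj in blast)
  qed
  moreover have "pathfinish (f \<circ> c) = pathstart (f \<circ> c)" using c fab by (simp add: pathfinish_compose pathstart_compose)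
  moreover have "path_image (f \<circ> c) = f ` path_image c" by (simp add: path_image_compose)
  moreover have "f ` path_image c \<subseteq> sphere 0 1" using f(2) reg(3) by blast
  moreover have "f (bpt v n q) \<in> sphere 0 1 - f ` path_image c"
    using \<open>f ` T c1 \<union> f ` T c2 = sphere 0 1 - f ` path_image c\<close> qT by blast
  ultimately show False using sphere_jordan_separates[of "f \<circ> c"] conn by metis
qed

section \<open>From lists of glued arcs to circle gluings\<close>

lemma gluing_arcs_Cons: "gluing_arcs ((s1, s2, l, r) # G) = (s1, l) # (s2, l) # gluing_arcs G"
  by (simp add: gluing_arcs_def)

lemma set_gluing_arcs: "set (gluing_arcs G) = (\<Union>(s1, s2, l, r)\<in>set G. {(s1, l), (s2, l)})"
  by (auto simp: gluing_arcs_def)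

lemma sorted_wrt_gluing_arcs_same:
  "sorted_wrt P (gluing_arcs G) \<Longrightarrow> (s1, s2, l, r) \<in> set G \<Longrightarrow> P (s1, l) (s2, l)"
proof (induction G)
  case (Cons g G)
  obtain t1 t2 k w where g: "g = (t1, t2, k, w)" by (metis prod.exhaust)
  show ?case using Cons unfolding g gluing_arcs_Cons by auto
qed simp

lemma sorted_wrt_gluing_arcs_distinct:
  assumes "sorted_wrt P (gluing_arcs G)" "(s1, s2, l, r) \<in> set G" "(u1, u2, m, q) \<in> set G"
    "(s1, s2, l, r) \<noteq> (u1, u2, m, q)" and ab: "a \<in> {(s1, l), (s2, l)}" "b \<in> {(u1, m), (u2, m)}"
  shows "P a b \<or> P b a"
  using assms(1-4)
proof (induction G)
  case (Cons g G)
  obtain t1 t2 k w where g: "g = (t1, t2, k, w)" by (metis prod.exhaust)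
  have all: "P x y" if "x \<in> {(t1, k), (t2, k)}" "y \<in> set (gluing_arcs G)" for x y
    using Cons.prems(1) that unfolding g gluing_arcs_Cons by auto
  have inG: "a \<in> set (gluing_arcs G)" if "(s1, s2, l, r) \<in> set G" unfolding set_gluing_arcs using that ab(1) by force
  have inG': "b \<in> set (gluing_arcs G)" if "(u1, u2, m, q) \<in> set G" unfolding set_gluing_arcs using that ab(2) by force
  have srt: "sorted_wrt P (gluing_arcs G)" using Cons.prems(1) unfolding g gluing_arcs_Cons by simp
  consider "(s1, s2, l, r) = g" "(u1, u2, m, q) \<in> set G" | "(s1, s2, l, r) \<in> set G" "(u1, u2, m, q) = g"
    | "(s1, s2, l, r) \<in> set G" "(u1, u2, m, q) \<in> set G" using Cons.prems by auto
  then show ?case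
  proof cases
    case 1 then show ?thesis using all[of a b] inG' ab(1) g by auto
  next
    case 2 then show ?thesis using all[of b a] inG ab(2) g by auto
  next
    case 3 then show ?thesis using Cons.IH[OF srt _ _ Cons.prems(4)] by blast
  qed
qed simp

locale glued_polygon = polygon +
  fixes G :: gluing
  assumes al: "aleksandrov_gluing v n G"
begin

abbreviation "R x y \<equiv> (bpt v n x, bpt v n y) \<in> glue_eq v n G"

text \<open>Every glued pair in both directions. The inverse of a reversing pair is reversing and
  that of a preserving pair is preserving, so swapping the starting points is enough.\<close>

definition "Dirs = set G \<union> {(s2, s1, l, r) | s1 s2 l r. (s1, s2, l, r) \<in> set G}"

definition In :: "real \<Rightarrow> real \<Rightarrow> real \<Rightarrow> bool" where
  "In s l x \<longleftrightarrow> (\<exists>u. cong_per L x u \<and> s < u \<and> u < s + l)"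

definition mate :: "real \<Rightarrow> real \<Rightarrow> bool \<Rightarrow> real \<Rightarrow> real" where
  "mate s' l r t = (if r then s' + l - t else s' + t)"

definition E :: "real \<Rightarrow> real \<Rightarrow> bool" where
  "E x y \<longleftrightarrow> (\<exists>s s' l r t. (s, s', l, r) \<in> Dirs \<and> 0 \<le> t \<and> t \<le> l \<and> cong_per L x (s + t) \<and> cong_per L y (mate s' l r t))"

lemma isg: "is_gluing v n G" using al by (simp add: aleksandrov_gluing_def)

lemma oarc_In: "window L 0 x \<in> oarc v n s l \<longleftrightarrow> In s l x"
proof
  assume "window L 0 x \<in> oarc v n s l"
  then obtain t where t: "0 < t" "t < l" "window L 0 x = window L 0 (s + t)" by (auto simp: oarc_def wrap_window)
  then have "cong_per L x (s + t)" using window_eq_iff[OF L_pos] by blast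
  then show "In s l x" unfolding In_def using t by (intro exI[of _ "s + t"]) auto
next
  assume "In s l x"
  then obtain u where u: "cong_per L x u" "s < u" "u < s + l" by (auto simp: In_def)
  have "window L 0 x = window L 0 (s + (u - s))" using u(1) window_eq_iff[OF L_pos, of 0 x u] by simp
  then show "window L 0 x \<in> oarc v n s l" unfolding oarc_def wrap_window using u by (intro CollectI exI[of _ "u - s"]) auto
qed

lemma In_cong_per: "In s l x \<Longrightarrow> cong_per L x y \<Longrightarrow> In s l y"
  unfolding In_def using cong_per_trans cong_per_sym by blast

lemma In_I: "s < x \<Longrightarrow> x < s + l \<Longrightarrow> In s l x"
  unfolding In_def by (intro exI[of _ x]) simp

lemma srt: "sorted_wrt (\<lambda>a b. oarc v n (fst a) (snd a) \<inter> oarc v n (fst b) (snd b) = {}) (gluing_arcs G)"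
  using isg unfolding is_gluing_def sorted_wrt_iff_nth_less by blast

lemma Dirs_swap: "(s, s', l, r) \<in> Dirs \<Longrightarrow> (s', s, l, r) \<in> Dirs"
  by (auto simp: Dirs_def)

lemma Dirs_pos: "(s, s', l, r) \<in> Dirs \<Longrightarrow> l > 0"
  using isg unfolding Dirs_def is_gluing_def by force

lemma disj_In:
  assumes "oarc v n s l \<inter> oarc v n u m = {}" "In s l x" "In u m x" shows False
  using assms oarc_In[of x s l] oarc_In[of x u m] by blast

lemma self_disjoint: "(s, s', l, r) \<in> Dirs \<Longrightarrow> In s l x \<Longrightarrow> In s' l x \<Longrightarrow> False"
  using sorted_wrt_gluing_arcs_same[OF srt, of s s' l r] sorted_wrt_gluing_arcs_same[OF srt, of s' s l r]
    disj_In[of s l s' l x] disj_In[of s' l s l x] unfolding Dirs_def by auto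

lemma Dirs_unique:
  assumes d: "(s, s', l, r) \<in> Dirs" "(u, u', m, q) \<in> Dirs" and x: "In s l x" "In u m x"
  shows "(s, s', l, r) = (u, u', m, q)"
proof (rule ccontr)
  assume n: "(s, s', l, r) \<noteq> (u, u', m, q)"
  obtain s1 s2 where g: "(s1, s2, l, r) \<in> set G" "(s, l) \<in> {(s1, l), (s2, l)}" "(s, s') \<in> {(s1, s2), (s2, s1)}"
    using d(1) unfolding Dirs_def by blast
  obtain u1 u2 where h: "(u1, u2, m, q) \<in> set G" "(u, m) \<in> {(u1, m), (u2, m)}" "(u, u') \<in> {(u1, u2), (u2, u1)}"
    using d(2) unfolding Dirs_def by blast
  show False
  proof (cases "(s1, s2, l, r) = (u1, u2, m, q)")
    case True
    then have "u = s'" "m = l" using n g(3) h(3) by auto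
    then show False using self_disjoint[OF d(1)] x by blast
  next
    case False
    then show False
      using sorted_wrt_gluing_arcs_distinct[OF srt g(1) h(1) False g(2) h(2)] disj_In[of s l u m x] disj_In[of u m s l x] x
      by (auto simp: Int_commute)
  qed
qed

lemma glue_base_E: "(bpt v n x, Y) \<in> glue_base v n G \<union> (glue_base v n G)\<inverse> \<Longrightarrow> \<exists>y. Y = bpt v n y \<and> E x y"
proof -
  assume "(bpt v n x, Y) \<in> glue_base v n G \<union> (glue_base v n G)\<inverse>"
  then consider "(bpt v n x, Y) \<in> glue_base v n G" | "(Y, bpt v n x) \<in> glue_base v n G" by blast
  then show ?thesis
  proof cases
    case 1
    then obtain s s' l r t where d: "(s, s', l, r) \<in> set G" "0 \<le> t" "t \<le> l" "bpt v n x = bpt v n (s + t)"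
      "Y = bpt v n (if r then s' + l - t else s' + t)" unfolding glue_base_def by blast
    have "E x (mate s' l r t)" unfolding E_def
      by (rule exI[of _ s], rule exI[of _ s'], rule exI[of _ l], rule exI[of _ r], rule exI[of _ t])
         (use d in \<open>auto simp: Dirs_def bpt_eq_iff\<close>)
    then show ?thesis using d(5) unfolding mate_def by blast
  next
    case 2
    then obtain s s' l r t where d: "(s, s', l, r) \<in> set G" "0 \<le> t" "t \<le> l" "Y = bpt v n (s + t)"
      "bpt v n x = bpt v n (if r then s' + l - t else s' + t)" unfolding glue_base_def by blast
    define t' where "t' = (if r then l - t else t)"
    have "cong_per L x (s' + t')" using d(5) by (auto simp: bpt_eq_iff t'_def add_diff_eq)
    moreover have "mate s l r t' = s + t" by (simp add: mate_def t'_def)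
    moreover have "0 \<le> t'" "t' \<le> l" using d by (auto simp: t'_def)
    moreover have "(s', s, l, r) \<in> Dirs" using d(1) by (auto simp: Dirs_def)
    ultimately have "E x (s + t)" unfolding E_def by (metis cong_per_refl)
    then show ?thesis using d(4) by blast
  qed
qed

lemma E_R: "E x y \<Longrightarrow> R x y"
proof -
  assume "E x y"
  then obtain s s' l r t where d: "(s, s', l, r) \<in> Dirs" "0 \<le> t" "t \<le> l" "cong_per L x (s + t)" "cong_per L y (mate s' l r t)"
    unfolding E_def by blast
  have e: "bpt v n x = bpt v n (s + t)" "bpt v n y = bpt v n (mate s' l r t)" using d by (simp_all add: bpt_eq_iff)
  have "(bpt v n x, bpt v n y) \<in> glue_base v n G \<or> (bpt v n y, bpt v n x) \<in> glue_base v n G"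
  proof (cases "(s, s', l, r) \<in> set G")
    case True
    then have "(bpt v n x, bpt v n y) \<in> glue_base v n G" unfolding glue_base_def e mate_def using d by blast
    then show ?thesis by blast
  next
    case False
    then have g: "(s', s, l, r) \<in> set G" using d(1) by (auto simp: Dirs_def)
    define t' where "t' = (if r then l - t else t)"
    have 1: "mate s' l r t = s' + t'" "s + t = (if r then s + l - t' else s + t')" by (auto simp: mate_def t'_def)
    have 2: "0 \<le> t'" "t' \<le> l" using d by (auto simp: t'_def)
    have "(bpt v n y, bpt v n x) \<in> glue_base v n G" unfolding glue_base_def e 1 using g 2 by blast
    then show ?thesis by blast
  qed
  then show ?thesis unfolding glue_eq_def by (intro r_into_rtrancl) blast
qed

text \<open>An arc of length L or more covers the circle up to at most one point and would meet the
  arc that it is glued to.\<close>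

lemma arc_less_L: assumes d: "(s, s', l, r) \<in> Dirs" shows "l < L"
proof (rule ccontr)
  assume n: "\<not> l < L"
  have all: "In s l y" if "\<not> cong_per L y s" for y
  proof -
    have "window L s y \<noteq> s" using that window_cong_per[of L y s] by auto
    then show ?thesis unfolding In_def using window_cong_per[of L y s] window_ge[OF L_pos, of s y] window_less[OF L_pos, of s y] n
      by (intro exI[of _ "window L s y"]) auto
  qed
  have p: "In s' l (s' + L / 2)" "In s' l (s' + L / 4)" using n L_pos by (auto intro!: In_I)
  have "\<not> (cong_per L (s' + L / 2) s \<and> cong_per L (s' + L / 4) s)"
  proof
    assume "cong_per L (s' + L / 2) s \<and> cong_per L (s' + L / 4) s"
    then have "cong_per L (s' + L / 2) (s' + L / 4)" using cong_per_trans cong_per_sym by blast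
    then show False using cong_per_close_eq[OF L_pos, of "s' + L / 2" "s' + L / 4"] L_pos by simp
  qed
  then show False using all p self_disjoint[OF d] by blast
qed

text \<open>A point inside one open arc that lies on another closed arc could be moved slightly into
  the interior of both, against disjointness. So only the arc around it can identify it with other
  points.\<close>

lemma closed_in_open:
  assumes d: "(s, s', l, r) \<in> Dirs" "0 < t" "t < l" "cong_per L x (s + t)"
    and d': "(u, u', m, q) \<in> Dirs" "0 \<le> \<tau>" "\<tau> \<le> m" "cong_per L x (u + \<tau>)"
  shows "(u, u', m, q) = (s, s', l, r)" "\<tau> = t"
proof -
  \<comment> \<open>A shift that stays inside the first arc and enters the open second one:
    forwards, or backwards if \<tau> is the right end of the second arc.\<close>
  define h where "h = (if \<tau> < m then min (l - t) (m - \<tau>) / 2 else - min t \<tau> / 2)"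
  have m: "m > 0" by (rule Dirs_pos[OF d'(1)])
  have h: "0 < t + h" "t + h < l" "0 < \<tau> + h" "\<tau> + h < m"
    using d d' m by (auto simp: h_def min_def field_simps)
  have "cong_per L (x + h) (s + (t + h))" "cong_per L (x + h) (u + (\<tau> + h))"
    using cong_per_add_right[OF d(4), of h] cong_per_add_right[OF d'(4), of h] by (simp_all add: add.assoc)
  then have "In s l (x + h)" "In u m (x + h)" unfolding In_def using h
    by (intro exI[of _ "s + (t + h)"] exI[of _ "u + (\<tau> + h)"]; simp)+
  then show e: "(u, u', m, q) = (s, s', l, r)" using Dirs_unique[OF d'(1) d(1)] by blast
  have "cong_per L (s + t) (s + \<tau>)" using cong_per_trans[OF cong_per_sym[OF d(4)]] d'(4) e by blast
  moreover have "\<bar>(s + t) - (s + \<tau>)\<bar> < L" using arc_less_L[OF d(1)] d d' e by auto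
  ultimately show "\<tau> = t" using cong_per_close_eq[OF L_pos, of "s + t" "s + \<tau>"] by simp
qed

lemma E_unique:
  assumes d: "(s, s', l, r) \<in> Dirs" "0 < t" "t < l" "cong_per L x (s + t)" and e: "E x y"
  shows "cong_per L y (mate s' l r t)"
proof -
  obtain u u' m q \<tau> where d': "(u, u', m, q) \<in> Dirs" "0 \<le> \<tau>" "\<tau> \<le> m" "cong_per L x (u + \<tau>)" "cong_per L y (mate u' m q \<tau>)"
    using e unfolding E_def by blast
  show ?thesis using closed_in_open[OF d d'(1-4)] d'(5) by simp
qed

text \<open>By \<open>closed_in_open\<close> a gluing step from x can only lead to its mate, and a
  step from the mate only back to x.\<close>

lemma class_open:
  assumes d: "(s, s', l, r) \<in> Dirs" "0 < t" "t < l" "cong_per L x (s + t)" and R: "R x y"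
  shows "cong_per L x y \<or> cong_per L (mate s' l r t) y"
proof -
  define z where "z = mate s' l r t"
  have "(bpt v n x, Y) \<in> glue_eq v n G \<Longrightarrow> Y = bpt v n x \<or> Y = bpt v n z" for Y
    unfolding glue_eq_def
  proof (induction rule: rtrancl_induct)
    case (step Y Z)
    define t' where "t' = (if r then l - t else t)"
    have z: "cong_per L z (s' + t')" "0 < t'" "t' < l" using d by (auto simp: z_def mate_def t'_def add_diff_eq)
    have mm: "mate s l r t' = s + t" by (simp add: mate_def t'_def)
    from step.IH show ?case
    proof
      assume "Y = bpt v n x"
      then obtain y where "Z = bpt v n y" "E x y" using glue_base_E step(2) by blast
      then show ?thesis using E_unique[OF d, of y] by (auto simp: bpt_eq_iff z_def intro: cong_per_sym)
    next
      assume "Y = bpt v n z"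
      then obtain y where y: "Z = bpt v n y" "E z y" using glue_base_E step(2) by blast
      have "cong_per L y (s + t)" using E_unique[OF Dirs_swap[OF d(1)] z(2,3,1) y(2)] mm by simp
      then have "cong_per L x y" using cong_per_trans[OF d(4) cong_per_sym] by blast
      then show ?thesis using y(1) by (auto simp: bpt_eq_iff intro: cong_per_sym)
    qed
  qed simp
  from this[OF R] show ?thesis unfolding z_def by (auto simp: bpt_eq_iff intro: cong_per_sym)
qed

lemma NC:
  assumes "p < q" "q < p'" "p' < q'" "q' < p + L" "R p p'" "R q q'" shows "R p q"
proof -
  obtain f :: "complex \<Rightarrow> real^3" where f: "continuous_on (pregion v n) f" "f ` pregion v n = sphere 0 1"
    "\<And>x y. x \<in> pregion v n \<Longrightarrow> y \<in> pregion v n \<Longrightarrow> f x = f y \<longleftrightarrow> (x, y) \<in> glue_eq v n G"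
    using al unfolding aleksandrov_gluing_def by blast
  show ?thesis by (rule noncrossing[OF f assms])
qed

lemma R_cong_per: "cong_per L x x' \<Longrightarrow> cong_per L y y' \<Longrightarrow> R x y \<Longrightarrow> R x' y'"
  using bpt_cong_per by metis

lemma R_mate: "(s, s', l, r) \<in> Dirs \<Longrightarrow> 0 \<le> t \<Longrightarrow> t \<le> l \<Longrightarrow> R (s + t) (mate s' l r t)"
  by (rule E_R) (unfold E_def, metis cong_per_refl)

text \<open>Under an orientation-preserving pair, two points of the arc and their mates interleave.
  By \<open>NC\<close> the two points would be glued to each other, although
  \<open>class_open\<close> allows an interior point only itself and its mate.\<close>

lemma reversing: assumes d: "(s, s', l, r) \<in> Dirs" shows "r"
proof (rule ccontr)
  assume r: "\<not> r"
  have l: "l > 0" by (rule Dirs_pos[OF d])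
  define w where "w = window L s s'"
  have w: "s \<le> w" "w < s + L" "cong_per L s' w" using window_ge[OF L_pos, of s s'] window_less[OF L_pos, of s s'] window_cong_per by (auto simp: w_def)
  have shift: "In s' l y" if "w < y" "y < w + l" for y
  proof -
    have "cong_per L y (s' + (y - w))" using cong_per_add_right[OF cong_per_sym[OF w(3)], of "y - w"] by simp
    then show ?thesis unfolding In_def using that by (intro exI[of _ "s' + (y - w)"]) auto
  qed
  have w1: "s + l \<le> w"
  proof (rule ccontr)
    assume n: "\<not> s + l \<le> w"
    define y where "y = w + (s + l - w) / 2"
    have "In s l y" "In s' l y" using n w l by (auto simp: y_def field_simps intro!: In_I shift)
    then show False using self_disjoint[OF d] by blast
  qed
  have w2: "w + l \<le> s + L"
  proof (rule ccontr)
    assume n: "\<not> w + l \<le> s + L"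
    define y where "y = s + L + (w + l - (s + L)) / 2"
    have 1: "In s' l y" using n w by (intro shift) (auto simp: y_def field_simps)
    have "In s l (y - L)" using n w by (intro In_I) (auto simp: y_def field_simps)
    then have "In s l y" by (rule In_cong_per) (use cong_per_plus_period[of L "y - L"] in simp)
    then show False using self_disjoint[OF d] 1 by blast
  qed
  have Rt: "R (s + t) (w + t)" if "0 \<le> t" "t \<le> l" for t
    using R_mate[OF d that] R_cong_per[OF cong_per_refl cong_per_add_right[OF w(3)], of "s + t" t] r by (simp add: mate_def)
  have RR: "R (s + l / 3) (s + 2 * l / 3)"
    by (rule NC[of _ _ "w + l / 3" "w + 2 * l / 3"]) (use l w1 w2 Rt[of "l / 3"] Rt[of "2 * l / 3"] in auto)
  have "cong_per L (s + l / 3) (s + 2 * l / 3) \<or> cong_per L (mate s' l r (l / 3)) (s + 2 * l / 3)"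
    by (rule class_open[OF d _ _ cong_per_refl RR]) (use l in auto)
  moreover have "cong_per L (mate s' l r (l / 3)) (w + l / 3)" using r cong_per_add_right[OF w(3)] by (simp add: mate_def)
  ultimately have "cong_per L (s + l / 3) (s + 2 * l / 3) \<or> cong_per L (w + l / 3) (s + 2 * l / 3)"
    using cong_per_trans cong_per_sym by blast
  then show False
    using cong_per_close_eq[OF L_pos, of "s + l / 3" "s + 2 * l / 3"] cong_per_close_eq[OF L_pos, of "w + l / 3" "s + 2 * l / 3"]
      l w1 w2 by auto
qed

text \<open>By \<open>is_gluing\<close> there are only finitely many of these points per period, and
  every class that is not a pair consists of them.\<close>

definition "Bad = {x. \<forall>s s' l r. (s, s', l, r) \<in> Dirs \<longrightarrow> \<not> In s l x}"

lemma periodic_Bad: "periodic L Bad"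
proof -
  have "In s l (x + L) \<longleftrightarrow> In s l x" for s l x
    using In_cong_per[of s l x "x + L"] In_cong_per[of s l "x + L" x] cong_per_sym[OF cong_per_plus_period] by auto
  then show ?thesis by (simp add: periodic_def Bad_def)
qed

lemma finite_Bad: "finite (Bad \<inter> {0..<L})"
proof -
  have "Bad \<inter> {0..<L} \<subseteq> {0..<L} - (\<Union>(s, l)\<in>set (gluing_arcs G). oarc v n s l)"
  proof
    fix x assume x: "x \<in> Bad \<inter> {0..<L}"
    have "x \<notin> oarc v n s l" if "(s, l) \<in> set (gluing_arcs G)" for s l
    proof -
      have "\<exists>s' r. (s, s', l, r) \<in> Dirs" using that unfolding set_gluing_arcs Dirs_def by force
      then have "\<not> In s l x" using x by (auto simp: Bad_def)
      then show ?thesis using oarc_In[of x s l] window_id[OF L_pos, of 0 x] x by simp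
    qed
    then show "x \<in> {0..<L} - (\<Union>(s, l)\<in>set (gluing_arcs G). oarc v n s l)" using x by auto
  qed
  then show ?thesis using isg finite_subset unfolding is_gluing_def by blast
qed

lemma not_Bad:
  assumes "x \<notin> Bad"
  obtains s s' l t where "(s, s', l, True) \<in> Dirs" "0 < t" "t < l" "cong_per L x (s + t)"
proof -
  obtain s s' l r where d: "(s, s', l, r) \<in> Dirs" "In s l x" using assms by (auto simp: Bad_def)
  obtain u where u: "cong_per L x u" "s < u" "u < s + l" using d(2) by (auto simp: In_def)
  show thesis by (rule that[of s s' l "u - s"]) (use d(1) reversing[OF d(1)] u in auto)
qed

lemma end_Bad:
  assumes d: "(s, s', l, r) \<in> Dirs" and x: "cong_per L x s \<or> cong_per L x (s + l)" shows "x \<in> Bad"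
proof (rule ccontr)
  assume nb: "x \<notin> Bad"
  obtain u u' m t where u: "(u, u', m, True) \<in> Dirs" "0 < t" "t < m" "cong_per L x (u + t)" using not_Bad[OF nb] .
  have l: "l > 0" by (rule Dirs_pos[OF d])
  obtain \<tau> where t: "\<tau> = 0 \<or> \<tau> = l" "cong_per L x (s + \<tau>)" using x by (metis add.right_neutral)
  have "(s, s', l, r) = (u, u', m, True) \<and> \<tau> = t" using closed_in_open[OF u d _ _ t(2)] t(1) l by auto
  then show False using u t by auto
qed

lemma mate_apart:
  assumes d: "(s, s', l, True) \<in> Dirs" "0 < t" "t < l" shows "\<not> cong_per L (s + t) (mate s' l True t)"
proof
  assume c: "cong_per L (s + t) (mate s' l True t)"
  have "In s' l (s' + (l - t))" using d by (intro In_I) auto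
  then have "In s' l (s + t)" by (rule In_cong_per) (use c in \<open>auto simp: mate_def add_diff_eq intro: cong_per_sym\<close>)
  moreover have "In s l (s + t)" using d by (intro In_I) auto
  ultimately show False using self_disjoint[OF d(1)] by blast
qed

lemma class_pair:
  assumes "x \<notin> Bad"
  obtains z where "R x z" "\<not> cong_per L x z" "\<And>y. R x y \<longleftrightarrow> cong_per L x y \<or> cong_per L z y"
proof -
  obtain s s' l t where d: "(s, s', l, True) \<in> Dirs" "0 < t" "t < l" "cong_per L x (s + t)" using not_Bad[OF assms] .
  define z where "z = mate s' l True t"
  have Rz: "R x z" using R_cong_per[OF cong_per_sym[OF d(4)] cong_per_refl R_mate[OF d(1)]] d by (simp add: z_def)
  have "R x y \<longleftrightarrow> cong_per L x y \<or> cong_per L z y" for y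
    using class_open[OF d, of y] R_cong_per[OF cong_per_refl, of z y x] Rz R_cong_per[OF cong_per_refl, of x y x] glue_eq_refl
    unfolding z_def by blast
  moreover have "\<not> cong_per L x z" using mate_apart[OF d(1-3)] cong_per_trans[OF cong_per_sym[OF d(4)]] unfolding z_def by blast
  ultimately show thesis using that Rz by blast
qed

lemma class_pair_window:
  assumes "\<And>y. R x y \<longleftrightarrow> cong_per L x y \<or> cong_per L z y"
  shows "{y. R x y} \<inter> {0..<L} = {window L 0 x, window L 0 z}"
proof (intro subset_antisym subsetI)
  fix y assume y: "y \<in> {y. R x y} \<inter> {0..<L}"
  then have "window L 0 y = y" using window_id[OF L_pos, of 0 y] by simp
  then show "y \<in> {window L 0 x, window L 0 z}" using assms[of y] y window_eq_iff[OF L_pos] by (metis IntD1 insertCI mem_Collect_eq)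
next
  fix y assume "y \<in> {window L 0 x, window L 0 z}"
  then show "y \<in> {y. R x y} \<inter> {0..<L}"
    using assms[of y] window_cong_per[of L x 0] window_cong_per[of L z 0] window_in[OF L_pos, of 0 x] window_in[OF L_pos, of 0 z] by auto
qed

text \<open>Up to the next point of \<open>Bad\<close> or the next copy of p, the side after p lies
  in one glued arc, and q is the partner of p in it. A class member r strictly between p and q would
  make the pairs (p, r) and (p + \<tau>, q - \<tau>) interleave for small \<tau>; then p would be
  glued to p + \<tau>, whose class contains only q - \<tau> besides itself.\<close>

lemma germ_R:
  "\<exists>q e. p < q \<and> q \<le> p + L \<and> R p q \<and> (\<forall>r. p < r \<and> r < q \<longrightarrow> \<not> R p r) \<and>
     0 < e \<and> (\<forall>t. 0 \<le> t \<and> t \<le> e \<longrightarrow> R (p + t) (q - t))"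
proof -
  define X where "X = Bad \<union> {x. cong_per L p x}"
  have pX: "periodic L X"
    unfolding periodic_def X_def using periodic_Bad[unfolded periodic_def]
      cong_per_trans[of L p _ "_ + L"] cong_per_plus_period cong_per_trans[of L p "_ + L"] cong_per_sym[OF cong_per_plus_period] by blast
  have "{x. cong_per L p x} \<inter> {0..<L} \<subseteq> {window L 0 p}"
  proof
    fix x assume x: "x \<in> {x. cong_per L p x} \<inter> {0..<L}"
    then have "window L 0 x = x" "window L 0 p = window L 0 x" using window_eq_iff[OF L_pos, of 0 p x] window_id[OF L_pos, of 0 x] by auto
    then show "x \<in> {window L 0 p}" by simp
  qed
  then have "finite ({x. cong_per L p x} \<inter> {0..<L})" by (rule finite_subset) simp
  then have fX: "finite (X \<inter> {0..<0 + L})" using finite_Bad by (simp add: X_def Int_Un_distrib2)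
  have ne: "X \<noteq> {}" by (auto simp: X_def intro: exI[of _ p])
  note n = next_in[OF L_pos pX fX ne, of p]
  define e where "e = next_in L X p - p"
  have e0: "e > 0" using n by (simp add: e_def)
  have eL: "e \<le> L" using n by (simp add: e_def)
  have free: "y \<notin> Bad" if "p < y" "y < p + e" for y using n(4)[of y] that by (auto simp: e_def X_def)
  have nb: "p + e / 2 \<notin> Bad" using e0 by (intro free) auto
  obtain s s' l t where d: "(s, s', l, True) \<in> Dirs" "0 < t" "t < l" "cong_per L (p + e / 2) (s + t)"
    using not_Bad[OF nb] .
  define c where "c = p + e / 2 - t"
  have cc: "cong_per L s c" using cong_per_add_right[OF cong_per_sym[OF d(4)], of "- t"] by (simp add: c_def)
  have c1: "c \<le> p"
  proof (rule ccontr)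
    assume "\<not> c \<le> p"
    then have "c \<notin> Bad" using d(2) e0 by (intro free) (auto simp: c_def)
    then show False using end_Bad[OF d(1), of c] cong_per_sym[OF cc] by blast
  qed
  have c2: "p + e \<le> c + l"
  proof (rule ccontr)
    assume "\<not> p + e \<le> c + l"
    then have "c + l \<notin> Bad" using d(3) e0 by (intro free) (auto simp: c_def)
    then show False using end_Bad[OF d(1), of "c + l"] cong_per_add_right[OF cong_per_sym[OF cc], of l] by blast
  qed
  define q' where "q' = s' + l - (p - c)"
  define w where "w = window L p q'"
  \<comment> \<open>If p is its own partner, q has to be its next copy p + L, since
    \<open>germ\<close> asks for q > p.\<close>
  define q where "q = (if w = p then p + L else w)"
  have w: "p \<le> w" "w < p + L" "cong_per L q' w" using window_ge[OF L_pos, of p q'] window_less[OF L_pos, of p q'] window_cong_per by (auto simp: w_def)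
  have q: "p < q" "q \<le> p + L" "cong_per L q' q" using w L_pos cong_per_trans[OF w(3) cong_per_plus_period] by (auto simp: q_def)
  have cs: "cong_per L (s + (y - c)) y" for y using cong_per_add_right[OF cc, of "y - c"] by simp
  have Rt: "R (p + \<tau>) (q - \<tau>)" if "0 \<le> \<tau>" "\<tau> \<le> e" for \<tau>
  proof -
    have "R (s + (p + \<tau> - c)) (mate s' l True (p + \<tau> - c))" by (rule R_mate[OF d(1)]) (use that c1 c2 in auto)
    moreover have "mate s' l True (p + \<tau> - c) = q' - \<tau>" by (simp add: mate_def q'_def)
    moreover have "cong_per L (q' - \<tau>) (q - \<tau>)" using cong_per_add_right[OF q(3), of "- \<tau>"] by simp
    ultimately show ?thesis using R_cong_per[OF cs[of "p + \<tau>"]] by simp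
  qed
  have nR: "\<not> R p r" if r: "p < r" "r < q" for r
  proof
    assume Rr: "R p r"
    define \<tau> where "\<tau> = min (e / 2) (min ((r - p) / 2) ((q - r) / 2))"
    have t: "0 < \<tau>" "\<tau> < e" "\<tau> < r - p" "\<tau> < q - r" using r e0 by (auto simp: \<tau>_def min_def)
    have "R p (p + \<tau>)"
      by (rule NC[of p "p + \<tau>" r "q - \<tau>"]) (use t q r Rr Rt[of \<tau>] in auto)
    then have "R (p + \<tau>) p" by (rule glue_eq_sym)
    moreover have "cong_per L (p + \<tau>) (s + (p + \<tau> - c))" by (rule cong_per_sym[OF cs])
    moreover have "0 < p + \<tau> - c" "p + \<tau> - c < l" using c1 c2 t by auto
    ultimately have "cong_per L (p + \<tau>) p \<or> cong_per L (mate s' l True (p + \<tau> - c)) p" using class_open[OF d(1)] by blast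
    moreover have "mate s' l True (p + \<tau> - c) = q' + - \<tau>" by (simp add: mate_def q'_def)
    then have "cong_per L (mate s' l True (p + \<tau> - c)) (q - \<tau>)"
      using cong_per_add_right[OF q(3), of "- \<tau>"] by simp
    ultimately have "cong_per L (p + \<tau>) p \<or> cong_per L (q - \<tau>) p" using cong_per_trans cong_per_sym by blast
    then show False
      using cong_per_close_eq[OF L_pos, of "p + \<tau>" p] cong_per_close_eq[OF L_pos, of "q - \<tau>" p] t q r eL by auto
  qed
  show ?thesis
    by (rule exI[of _ q], rule exI[of _ e]) (use nR q(1,2) Rt[of 0] e0 Rt in auto)
qed

lemma glued_circle: "circle_gluing L R"
proof
  show "0 < L" by (rule L_pos)
  show "R x x" for x by (rule glue_eq_refl)
  show "R x y \<Longrightarrow> R y x" for x y by (rule glue_eq_sym)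
  show "R x y \<Longrightarrow> R y z \<Longrightarrow> R x z" for x y z by (rule glue_eq_trans)
  show "R x (x + L)" for x using R_cong_per[OF cong_per_refl cong_per_plus_period glue_eq_refl] .
  show "finite ({y. R x y} \<inter> {0..<L})" for x
  proof (cases "x \<in> Bad")
    case False
    obtain z where "\<And>y. R x y \<longleftrightarrow> cong_per L x y \<or> cong_per L z y" using class_pair[OF False] by metis
    then show ?thesis using class_pair_window by simp
  next
    case True
    have "y \<in> Bad" if R: "R x y" for y
    proof (rule ccontr)
      assume y: "y \<notin> Bad"
      obtain s s' l t where d: "(s, s', l, True) \<in> Dirs" "0 < t" "t < l" "cong_per L y (s + t)" using not_Bad[OF y] .
      have "cong_per L y x \<or> cong_per L (mate s' l True t) x" by (rule class_open[OF d glue_eq_sym[OF R]])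
      moreover have "In s l y" unfolding In_def using d by (intro exI[of _ "s + t"]) auto
      moreover have "In s' l (mate s' l True t)" using d by (intro In_I) (auto simp: mate_def)
      ultimately have "In s l x \<or> In s' l x" using In_cong_per by blast
      then show False using True d(1) Dirs_swap[OF d(1)] by (auto simp: Bad_def)
    qed
    then have "{y. R x y} \<inter> {0..<L} \<subseteq> Bad \<inter> {0..<L}" by blast
    then show ?thesis using finite_Bad finite_subset by blast
  qed
  show "\<exists>q e. x < q \<and> q \<le> x + L \<and> R x q \<and> (\<forall>r. x < r \<and> r < q \<longrightarrow> \<not> R x r) \<and>
     0 < e \<and> (\<forall>t. 0 \<le> t \<and> t \<le> e \<longrightarrow> R (x + t) (q - t))" for x by (rule germ_R)
  have "class_size L R x = 2" if x: "x \<notin> Bad" for x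
  proof -
    obtain z where z: "\<not> cong_per L x z" "\<And>y. R x y \<longleftrightarrow> cong_per L x y \<or> cong_per L z y" using class_pair[OF x] by metis
    have "window L 0 x \<noteq> window L 0 z" using z(1) window_eq_iff[OF L_pos] by blast
    then show ?thesis unfolding class_size_def using class_pair_window[OF z(2)] by simp
  qed
  then have "{x. class_size L R x \<noteq> 2} \<inter> {0..<L} \<subseteq> Bad \<inter> {0..<L}" by blast
  then show "finite ({x. class_size L R x \<noteq> 2} \<inter> {0..<L})" using finite_Bad finite_subset by blast
qed

end

section \<open>Curvature and gluing trees\<close>

context polygon begin

definition "marks = {x. \<exists>i<n. bpt v n x = v i}"

lemma bpt_eq_v: "i < n \<Longrightarrow> bpt v n x = v i \<longleftrightarrow> cong_per L x (cl i)"
  using bpt_eq_iff[of x "cl i"] bpt_cl[of i] by simp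

lemma cl_window: "i < n \<Longrightarrow> 0 \<le> cl i \<and> cl i < L"
  using cl_le[of 0 i] cl_less[of i n] by (simp add: cl_n)

lemma periodic_marks: "periodic L marks"
proof -
  have "bpt v n (x + L) = bpt v n x" for x by (rule bpt_cong_per[OF cong_per_sym[OF cong_per_plus_period]])
  then show ?thesis by (simp add: periodic_def marks_def)
qed

lemma marks_window: "marks \<inter> {0..<L} = cl ` {..<n}"
proof (intro subset_antisym subsetI)
  fix x assume x: "x \<in> marks \<inter> {0..<L}"
  then obtain i where i: "i < n" "cong_per L x (cl i)" by (auto simp: marks_def bpt_eq_v)
  then have "x = cl i" using cong_per_close_eq[OF L_pos, of x "cl i"] x cl_window[OF i(1)] by auto
  then show "x \<in> cl ` {..<n}" using i(1) by blast
next
  fix x assume "x \<in> cl ` {..<n}"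
  then obtain i where "i < n" "x = cl i" by blast
  then show "x \<in> marks \<inter> {0..<L}" using cl_window[of i] bpt_cl[of i] by (auto simp: marks_def)
qed

lemma inj_cl: "inj_on cl {..<n}"
proof (rule linorder_inj_onI')
  fix i j assume "i \<in> {..<n}" "j \<in> {..<n}" "i < j"
  then show "cl i \<noteq> cl j" using cl_less[of i j] by simp
qed

lemma card_marks: "card (marks \<inter> {0..<L}) = n"
  unfolding marks_window using card_image[OF inj_cl] by simp

lemma finite_marks: "finite (marks \<inter> {0..<L})"
  unfolding marks_window by simp

lemma marks_ne: "marks \<noteq> {}"
  using card_marks n3 by auto

definition "ang x = face_angle v n (bpt v n x)"

lemma ang_mark: assumes "i < n" "bpt v n x = v i" shows "ang x = int_angle v n i"
proof -
  have "(THE j. j < n \<and> v j = v i) = i" by (rule the_equality) (use assms v_inj in auto)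
  moreover have "\<exists>j<n. v j = v i" using assms by blast
  ultimately show ?thesis unfolding ang_def face_angle_def assms(2) by simp
qed

lemma ang_unmarked: "x \<notin> marks \<Longrightarrow> ang x = pi"
  unfolding ang_def face_angle_def marks_def by (auto dest: sym)

lemma ang_marked: assumes "x \<in> marks" shows "0 < ang x" "ang x < 2 * pi" "ang x \<noteq> pi"
proof -
  obtain i where i: "i < n" "bpt v n x = v i" using assms by (auto simp: marks_def)
  show "0 < ang x" "ang x < 2 * pi" "ang x \<noteq> pi" using int_angle_bounds[OF i(1)] ang_mark[OF i] by simp_all
qed

lemma ang_pos: "0 < ang x"
  using ang_marked(1)[of x] ang_unmarked[of x] pi_gt_zero by (cases "x \<in> marks") auto

lemma sum_ang_marks: "(\<Sum>x\<in>marks \<inter> {0..<L}. ang x) \<ge> (real n - 2) * pi"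
proof -
  have "(\<Sum>x\<in>marks \<inter> {0..<L}. ang x) = (\<Sum>i<n. ang (cl i))"
    unfolding marks_window by (rule sum.reindex_cong[OF inj_cl]) auto
  also have "\<dots> = (\<Sum>i<n. int_angle v n i)"
    by (rule sum.cong[OF refl]) (use ang_mark bpt_cl in auto)
  finally show ?thesis using int_angle_sum by simp
qed

lemma inj_bpt: "inj_on (bpt v n) {0..<L}"
proof (rule inj_onI)
  fix x y assume xy: "x \<in> {0..<L}" "y \<in> {0..<L}" "bpt v n x = bpt v n y"
  then have "cong_per L x y" by (simp add: bpt_eq_iff)
  then show "x = y" by (rule cong_per_close_eq[OF L_pos]) (use xy in auto)
qed

lemma open_edge_iff:
  assumes i: "i < n"
  shows "bpt v n y \<in> open_segment (v i) (v (nxt n i)) \<longleftrightarrow> (\<exists>u. cong_per L y u \<and> cl i < u \<and> u < cl (Suc i))"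
proof
  assume "bpt v n y \<in> open_segment (v i) (v (nxt n i))"
  then have o: "bpt v n y \<in> pedge v n i" "bpt v n y \<noteq> v i" "bpt v n y \<noteq> v (nxt n i)"
    by (auto simp: open_segment_def pedge_def)
  then obtain u where u: "bpt v n y = bpt v n u" "cl i \<le> u" "u \<le> cl (Suc i)" using edge_eq_bpt[OF i] by auto
  have "u \<noteq> cl i" "u \<noteq> cl (Suc i)" using o u bpt_cl[OF i] bpt_cl_Suc[OF i] by auto
  then show "\<exists>u. cong_per L y u \<and> cl i < u \<and> u < cl (Suc i)" using u by (intro exI[of _ u]) (auto simp: bpt_eq_iff)
next
  assume "\<exists>u. cong_per L y u \<and> cl i < u \<and> u < cl (Suc i)"
  then obtain u where u: "cong_per L y u" "cl i < u" "u < cl (Suc i)" by blast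
  have e: "bpt v n y = bpt v n u" using u(1) by (rule bpt_cong_per)
  have w: "0 \<le> cl i" "cl (Suc i) \<le> L" using cl_window[OF i] cl_le[of "Suc i" n] i by (auto simp: cl_n)
  have "bpt v n u \<noteq> v i"
    using bpt_eq_v[OF i, of u] cong_per_close_eq[OF L_pos, of u "cl i"] u w by auto
  moreover have "bpt v n u \<noteq> v (nxt n i)"
  proof
    assume "bpt v n u = v (nxt n i)"
    then have "cong_per L u (cl (Suc i))" using bpt_cl_Suc[OF i] bpt_eq_iff by metis
    then show False using cong_per_close_eq[OF L_pos, of u "cl (Suc i)"] u w by auto
  qed
  moreover have "bpt v n u \<in> pedge v n i" using bpt_in_edge[OF i, of u] u by simp
  ultimately show "bpt v n y \<in> open_segment (v i) (v (nxt n i))" unfolding e by (auto simp: open_segment_def pedge_def)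
qed

lemma cl_marks: "i \<le> n \<Longrightarrow> cl i \<in> marks"
proof (cases "i < n")
  case True then show ?thesis using bpt_cl[OF True] by (auto simp: marks_def)
next
  assume "i \<le> n" case False
  then have "i = Suc (n - 1)" "n - 1 < n" using \<open>i \<le> n\<close> n3 by auto
  then have "bpt v n (cl i) = v (nxt n (n - 1))" using bpt_cl_Suc[of "n - 1"] by simp
  then show ?thesis using nxt_less[of "n - 1"] by (auto simp: marks_def)
qed

end

sublocale glued_polygon \<subseteq> C: circle_gluing "perim v n" "\<lambda>x y. (bpt v n x, bpt v n y) \<in> glue_eq v n G"
  by (rule glued_circle)

context glued_polygon begin

abbreviation "csz \<equiv> class_size L R"

definition "cls x = bpt v n ` {y. R x y}"

lemma glue_class_cls: "glue_class v n G (bpt v n x) = cls x"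
  unfolding glue_class_def cls_def pbdry_eq[of 0] using pbdry_eq[of 0] bpt_pbdry by (auto simp: image_iff)

lemma cls_window: "cls x = bpt v n ` ({y. R x y} \<inter> {0..<L})"
proof
  show "cls x \<subseteq> bpt v n ` ({y. R x y} \<inter> {0..<L})"
  proof
    fix p assume "p \<in> cls x"
    then obtain y where y: "p = bpt v n y" "R x y" by (auto simp: cls_def)
    have "p = bpt v n (window L 0 y)" unfolding y(1) by (rule bpt_cong_per[OF window_cong_per])
    then show "p \<in> bpt v n ` ({y. R x y} \<inter> {0..<L})" using y(2) C.window_class[OF y(2), of 0] by auto
  qed
qed (auto simp: cls_def)

lemma card_cls: "card (cls x) = csz x"
  unfolding cls_window class_size_def by (rule card_image) (rule inj_on_subset[OF inj_bpt], blast)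

lemma angle_le: "(\<Sum>y\<in>{y. R x y} \<inter> {0..<L}. ang y) \<le> 2 * pi"
proof -
  have "(\<Sum>p\<in>glue_class v n G (bpt v n x). face_angle v n p) \<le> 2 * pi"
    using al bpt_pbdry unfolding aleksandrov_gluing_def by blast
  moreover have "(\<Sum>p\<in>cls x. face_angle v n p) = (\<Sum>y\<in>{y. R x y} \<inter> {0..<L}. ang y)"
    unfolding cls_window by (rule sum.reindex_cong[where l = "bpt v n"])
      (auto simp: ang_def intro: inj_on_subset[OF inj_bpt])
  ultimately show ?thesis by (simp add: glue_class_cls)
qed

text \<open>Two unmarked points already contribute 2 \<pi>, and a third point of the class has a
  positive angle.\<close>

lemma one_unmarked_R: "one_unmarked L marks R"
  unfolding one_unmarked_def
proof (intro allI impI, rule ccontr)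
  fix x y assume xy: "R x y" "csz x \<ge> 3" "x \<notin> marks" "y \<notin> marks" "\<not> cong_per L x y"
  let ?C = "{y. R x y} \<inter> {0..<L}"
  define a b where "a = window L 0 x" and "b = window L 0 y"
  have ab: "a \<in> ?C" "b \<in> ?C" using C.window_class[OF C.R_refl, of 0 x] C.window_class[OF xy(1), of 0] by (auto simp: a_def b_def)
  have ne: "a \<noteq> b" using xy(5) window_eq_iff[OF L_pos] by (auto simp: a_def b_def)
  have um: "ang a = pi" "ang b = pi" using xy(3,4) window_mem[OF periodic_marks] ang_unmarked by (auto simp: a_def b_def)
  have "\<not> ?C \<subseteq> {a, b}"
  proof
    assume "?C \<subseteq> {a, b}"
    then have "card ?C \<le> card {a, b}" by (intro card_mono) auto
    then show False using xy(2) ne by (simp add: class_size_def)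
  qed
  then obtain c where c: "c \<in> ?C" "c \<notin> {a, b}" by blast
  have "(\<Sum>y\<in>{a, b, c}. ang y) \<le> (\<Sum>y\<in>?C. ang y)"
    by (rule sum_mono2[OF C.fin_class]) (use ab c less_imp_le[OF ang_pos] in auto)
  moreover have "(\<Sum>y\<in>{a, b, c}. ang y) = 2 * pi + ang c" using ne c um by simp
  ultimately show False using angle_le[of x] ang_pos[of c] by linarith
qed

text \<open>The parameters of points in nodes of the gluing tree; see
  \<open>in_nodes_iff\<close>.\<close>

definition "nodal = {x. csz x \<noteq> 2 \<or> (\<exists>m\<in>marks. R m x)}"

lemma nodal_closed: "x \<in> nodal \<Longrightarrow> R x y \<Longrightarrow> y \<in> nodal"
  unfolding nodal_def using C.class_size_R[of x y] C.R_trans[of _ x y] by auto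

lemma periodic_nodal: "periodic L nodal"
  unfolding periodic_def using nodal_closed C.R_period C.R_sym[OF C.R_period] by blast

lemma nodal_I: "csz x \<noteq> 2 \<Longrightarrow> x \<in> nodal" and nodal_mark: "x \<in> marks \<Longrightarrow> x \<in> nodal"
  unfolding nodal_def using C.R_refl by auto

lemma finite_nodal: "finite (nodal \<inter> {0..<L})"
proof -
  have "nodal \<inter> {0..<L} \<subseteq> ({x. csz x \<noteq> 2} \<inter> {0..<L}) \<union> (\<Union>m\<in>marks \<inter> {0..<L}. {y. R m y} \<inter> {0..<L})"
  proof
    fix x assume x: "x \<in> nodal \<inter> {0..<L}"
    show "x \<in> ({x. csz x \<noteq> 2} \<inter> {0..<L}) \<union> (\<Union>m\<in>marks \<inter> {0..<L}. {y. R m y} \<inter> {0..<L})"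
    proof (cases "csz x = 2")
      case True
      then obtain m where m: "m \<in> marks" "R m x" using x by (auto simp: nodal_def)
      have "window L 0 m \<in> marks \<inter> {0..<L}" using m(1) window_mem[OF periodic_marks, of 0 m] window_in[OF L_pos, of 0 m] by simp
      moreover have "R (window L 0 m) x" by (rule C.R_cg[OF m(2) window_cong_per cong_per_refl])
      ultimately show ?thesis using x by blast
    qed (use x in blast)
  qed
  then show ?thesis by (rule finite_subset) (use C.fin_special finite_marks C.fin_class in blast)
qed

text \<open>The curvature of the class of x, divided equally among its points, so that a sum over
  points is a sum over nodes.\<close>

definition "curv x = (2 * pi - (\<Sum>y\<in>{y. R x y} \<inter> {0..<L}. ang y)) / real (csz x)"

lemma curv_nonneg: "0 \<le> curv x"
  unfolding curv_def using angle_le[of x] by simp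

text \<open>For the set X of node points in one period, Euler's formula makes the total curvature 2
  \<pi> + \<pi> |X| minus the sum of the angles. Unmarked points have angle \<pi>, and the n
  vertices together at least (n - 2) \<pi>.\<close>

lemma gauss_bonnet: "(\<Sum>x\<in>nodal \<inter> {0..<L}. curv x) \<le> 4 * pi"
proof -
  let ?X = "nodal \<inter> {0..<L}"
  have e: "(\<Sum>x\<in>?X. 2 / real (csz x) - 1) = 2"
    by (rule C.euler[OF periodic_nodal nodal_closed nodal_I finite_nodal]) (use marks_ne nodal_mark in auto)
  have "(\<Sum>x\<in>?X. curv x) = (\<Sum>x\<in>?X. pi * (2 / real (csz x) - 1) + pi) - (\<Sum>x\<in>?X. (\<Sum>y\<in>{y. R x y} \<inter> {0..<L}. ang y) / real (csz x))"
    unfolding curv_def sum_subtractf[symmetric] by (intro sum.cong refl) (simp add: algebra_simps diff_divide_distrib)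
  also have "(\<Sum>x\<in>?X. (\<Sum>y\<in>{y. R x y} \<inter> {0..<L}. ang y) / real (csz x)) = sum ang ?X"
    by (rule C.sum_class_average[OF nodal_closed finite_nodal])
  also have "(\<Sum>x\<in>?X. pi * (2 / real (csz x) - 1) + pi) = pi * 2 + pi * real (card ?X)"
    unfolding sum.distrib sum_distrib_left[symmetric] e by simp
  finally have s: "(\<Sum>x\<in>?X. curv x) = pi * 2 + pi * real (card ?X) - sum ang ?X" .
  have "sum ang ?X \<ge> pi * real (card ?X) - 2 * pi"
  proof -
    have "?X = (marks \<inter> {0..<L}) \<union> (?X - marks)" using nodal_mark by blast
    then have "sum ang ?X = sum ang (marks \<inter> {0..<L}) + sum ang (?X - marks)"
      using sum.union_disjoint[OF finite_marks, of "?X - marks" ang] finite_nodal by auto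
    moreover have "sum ang (?X - marks) = pi * real (card (?X - marks))"
      by (simp add: ang_unmarked mult.commute)
    moreover have "card ?X = n + card (?X - marks)"
      using \<open>?X = (marks \<inter> {0..<L}) \<union> (?X - marks)\<close> card_Un_disjoint[OF finite_marks, of "?X - marks"] finite_nodal card_marks by auto
    ultimately show ?thesis using sum_ang_marks by (simp add: algebra_simps)
  qed
  then show ?thesis unfolding s by linarith
qed

lemma curv_unmarked_leaf: assumes "x \<in> leaves L R - marks" shows "curv x = pi" "x \<in> nodal \<inter> {0..<L}"
proof -
  have x: "csz x = 1" "x \<in> {0..<L}" "x \<notin> marks" using assms by (auto simp: leaves_def)
  show "x \<in> nodal \<inter> {0..<L}" using x nodal_I[of x] by simp
  have "{y. R x y} \<inter> {0..<L} = {x}"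
  proof (intro subset_antisym subsetI)
    fix y assume y: "y \<in> {y. R x y} \<inter> {0..<L}"
    then have "cong_per L x y" using C.class_size_1[OF x(1)] by blast
    then have "x = y" by (rule cong_per_close_eq[OF L_pos]) (use y x(2) in auto)
    then show "y \<in> {x}" by simp
  qed (use x C.R_refl in auto)
  then show "curv x = pi" using x ang_unmarked by (simp add: curv_def)
qed

text \<open>A leaf interior to an edge has curvature \<pi>, so four of them exhaust the total 4
  \<pi>. A leaf at a vertex would add positive curvature, and in a flat pair a vertex facing an
  unmarked point would have angle \<pi>.\<close>

lemma unmarked_leaves:
  "card (leaves L R - marks) \<le> 3 \<or> card (leaves L R) \<le> 4 \<and> mark_flat L marks R"
proof (cases "card (leaves L R - marks) \<le> 3")
  case False
  let ?U = "leaves L R - marks" and ?X = "nodal \<inter> {0..<L}"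
  have UX: "?U \<subseteq> ?X" using curv_unmarked_leaf(2) by blast
  have fU: "finite ?U" by (simp add: C.finite_leaves)
  have sU: "sum curv ?U = pi * real (card ?U)" using curv_unmarked_leaf(1) by (simp add: mult.commute)
  have "sum curv ?U \<le> sum curv ?X" by (rule sum_mono2[OF finite_nodal UX]) (rule curv_nonneg)
  then have "pi * real (card ?U) \<le> pi * 4" using sU gauss_bonnet by linarith
  then have "real (card ?U) \<le> 4" by (rule mult_left_le_imp_le) (rule pi_gt_zero)
  then have U4: "card ?U = 4" using False by linarith
  have zero: "curv x = 0" if x: "x \<in> ?X" "x \<notin> ?U" for x
  proof -
    have "sum curv (insert x ?U) \<le> sum curv ?X"
      by (rule sum_mono2[OF finite_nodal]) (use UX x curv_nonneg in auto)
    moreover have "sum curv (insert x ?U) = curv x + sum curv ?U" by (rule sum.insert[OF fU x(2)])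
    ultimately have "curv x \<le> 0" using gauss_bonnet sU U4 by simp
    then show ?thesis using curv_nonneg[of x] by simp
  qed
  have "leaves L R \<subseteq> ?U"
  proof
    fix x assume x: "x \<in> leaves L R"
    show "x \<in> ?U"
    proof (rule ccontr)
      assume n: "x \<notin> ?U"
      then have m: "x \<in> marks" using x by blast
      have x1: "csz x = 1" "x \<in> {0..<L}" using x by (auto simp: leaves_def)
      have c0: "curv x = 0" using zero[of x] n x1 nodal_I[of x] by simp
      have "{y. R x y} \<inter> {0..<L} = {x}"
      proof (intro subset_antisym subsetI)
        fix y assume y: "y \<in> {y. R x y} \<inter> {0..<L}"
        then have "cong_per L x y" using C.class_size_1[OF x1(1)] by blast
        then have "x = y" by (rule cong_per_close_eq[OF L_pos]) (use y x1(2) in auto)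
        then show "y \<in> {x}" by simp
      qed (use x1 C.R_refl in auto)
      then show False using c0 x1 ang_marked(2)[OF m] by (simp add: curv_def)
    qed
  qed
  then have "card (leaves L R) \<le> 4" using card_mono[OF fU] U4 by metis
  moreover have "mark_flat L marks R" unfolding mark_flat_def
  proof (intro allI impI, rule ccontr)
    fix x y assume xy: "R x y" "csz x = 2" "x \<in> marks" "y \<notin> marks"
    define a b where "a = window L 0 x" and "b = window L 0 y"
    have ca: "cong_per L x a" "cong_per L y b" by (simp_all add: a_def b_def window_cong_per)
    have ab: "a \<in> marks" "b \<notin> marks" using xy window_mem[OF periodic_marks] by (auto simp: a_def b_def)
    have Rab: "R a b" by (rule C.R_cg[OF xy(1) ca])
    have a2: "csz a = 2" using xy(2) C.class_size_cg[OF ca(1)] by simp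
    have aw: "a \<in> {0..<L}" "b \<in> {0..<L}" using window_in[OF L_pos, of 0] by (auto simp: a_def b_def)
    have sub: "{a, b} \<subseteq> {y. R a y} \<inter> {0..<L}" using aw Rab C.R_refl by simp
    have "card {a, b} = 2" using ab by (metis card_2_iff)
    then have eq: "{a, b} = {y. R a y} \<inter> {0..<L}"
      by (intro card_subset_eq[OF C.fin_class sub]) (use a2 in \<open>simp add: class_size_def\<close>)
    have "a \<noteq> b" using ab by blast
    then have "(\<Sum>y\<in>{y. R a y} \<inter> {0..<L}. ang y) = ang a + ang b" unfolding eq[symmetric] by simp
    moreover have "curv a = 0" by (rule zero) (use nodal_mark[OF ab(1)] aw a2 in \<open>auto simp: leaves_def\<close>)
    ultimately have "ang a = pi" using a2 ang_unmarked[OF ab(2)] by (simp add: curv_def)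
    then show False using ang_marked(3)[OF ab(1)] by simp
  qed
  ultimately show ?thesis by blast
qed blast

lemma R_family: "card (leaves L R) \<le> k \<Longrightarrow> R \<in> family L marks k"
  unfolding family_def using glued_circle one_unmarked_R unmarked_leaves by blast

lemma cls_eq: "cls x = cls y \<longleftrightarrow> R x y"
proof
  assume "cls x = cls y"
  moreover have "bpt v n y \<in> cls y" using C.R_refl by (auto simp: cls_def)
  ultimately obtain z where "bpt v n y = bpt v n z" "R x z" by (auto simp: cls_def)
  then show "R x y" by simp
next
  assume "R x y"
  then show "cls x = cls y" unfolding cls_def using C.class_eq[of x y] by simp
qed

lemma in_cls: "bpt v n y \<in> cls x \<longleftrightarrow> R x y"
proof
  assume "bpt v n y \<in> cls x"
  then obtain z where "bpt v n y = bpt v n z" "R x z" by (auto simp: cls_def)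
  then show "R x y" by simp
qed (auto simp: cls_def)

lemma vertex_in_cls: "i < n \<Longrightarrow> v i \<in> cls x \<longleftrightarrow> R x (cl i)"
  using in_cls[of "cl i" x] bpt_cl[of i] by simp

lemma gt_nodes_cls: "gt_nodes v n G = cls ` nodal"
proof -
  have k: "card (cls x) \<noteq> 2 \<or> (\<exists>i<n. v i \<in> cls x) \<longleftrightarrow> x \<in> nodal" for x
  proof -
    have "(\<exists>i<n. v i \<in> cls x) \<longleftrightarrow> (\<exists>m\<in>marks. R m x)"
    proof
      assume "\<exists>i<n. v i \<in> cls x"
      then obtain i where i: "i < n" "R x (cl i)" using vertex_in_cls by blast
      then show "\<exists>m\<in>marks. R m x" using cl_marks[of i] C.R_sym[OF i(2)] by auto
    next
      assume "\<exists>m\<in>marks. R m x"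
      then obtain m i where m: "R m x" "i < n" "bpt v n m = v i" by (auto simp: marks_def)
      then have "v i \<in> cls x" using in_cls[of m x] C.R_sym[OF m(1)] by simp
      then show "\<exists>i<n. v i \<in> cls x" using m by blast
    qed
    then show ?thesis by (simp add: nodal_def card_cls)
  qed
  show ?thesis
  proof (intro subset_antisym subsetI)
    fix A assume "A \<in> gt_nodes v n G"
    then obtain p where p: "p \<in> pbdry v n" "A = glue_class v n G p" "card A \<noteq> 2 \<or> (\<exists>i<n. v i \<in> A)"
      unfolding gt_nodes_def by blast
    obtain x where x: "p = bpt v n x" using p(1) pbdry_eq[of 0] by auto
    have "A = cls x" using p(2) x glue_class_cls by simp
    then show "A \<in> cls ` nodal" using k[of x] p(3) by blast
  next
    fix A assume "A \<in> cls ` nodal"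
    then obtain x where x: "x \<in> nodal" "A = cls x" by blast
    then have "card A \<noteq> 2 \<or> (\<exists>i<n. v i \<in> A)" using k[of x] by simp
    then show "A \<in> gt_nodes v n G" unfolding gt_nodes_def using glue_class_cls[of x] x(2) bpt_pbdry[of x] by blast
  qed
qed

lemma in_nodes_iff: "bpt v n x \<in> \<Union>(gt_nodes v n G) \<longleftrightarrow> x \<in> nodal"
proof
  assume "bpt v n x \<in> \<Union>(gt_nodes v n G)"
  then obtain y where y: "y \<in> nodal" "bpt v n x \<in> cls y" unfolding gt_nodes_cls by blast
  then show "x \<in> nodal" using nodal_closed[OF y(1)] in_cls by blast
next
  assume "x \<in> nodal"
  then have "cls x \<in> gt_nodes v n G" by (simp add: gt_nodes_cls)
  moreover have "bpt v n x \<in> cls x" using in_cls C.R_refl by blast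
  ultimately show "bpt v n x \<in> \<Union>(gt_nodes v n G)" by blast
qed

text \<open>Adjacency in terms of the order, the period and \<open>R\<close>, which is the form that
  \<open>comb_equiv\<close> preserves. \<open>gt_label_cls\<close> does the same for labels, with
  the vertex parameters as marks.\<close>

lemma gt_adj_cls:
  assumes "x \<in> nodal" "y \<in> nodal"
  shows "(cls x, cls y) \<in> gt_adj v n G \<longleftrightarrow>
    (\<exists>s e. s < e \<and> e \<le> s + L \<and> (R x s \<and> R y e \<or> R y s \<and> R x e) \<and> (\<forall>w. s < w \<and> w < e \<longrightarrow> w \<notin> nodal))"
proof
  assume "(cls x, cls y) \<in> gt_adj v n G"
  then obtain s d where d': "0 < d" "d \<le> L"
    "(bpt v n s \<in> cls x \<and> bpt v n (s + d) \<in> cls y) \<or> (bpt v n s \<in> cls y \<and> bpt v n (s + d) \<in> cls x)"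
    "\<forall>t. 0 < t \<and> t < d \<longrightarrow> bpt v n (s + t) \<notin> \<Union>(gt_nodes v n G)"
    unfolding gt_adj_def by blast
  have d: "0 < d" "d \<le> L" "R x s \<and> R y (s + d) \<or> R y s \<and> R x (s + d)"
    "\<And>t. 0 < t \<Longrightarrow> t < d \<Longrightarrow> s + t \<notin> nodal"
    using d' unfolding in_cls in_nodes_iff by blast+
  show "\<exists>s e. s < e \<and> e \<le> s + L \<and> (R x s \<and> R y e \<or> R y s \<and> R x e) \<and> (\<forall>w. s < w \<and> w < e \<longrightarrow> w \<notin> nodal)"
  proof (rule exI[of _ s], rule exI[of _ "s + d"], intro conjI allI impI)
    fix w assume "s < w \<and> w < s + d" then show "w \<notin> nodal" using d(4)[of "w - s"] by simp
  qed (use d in auto)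
next
  assume "\<exists>s e. s < e \<and> e \<le> s + L \<and> (R x s \<and> R y e \<or> R y s \<and> R x e) \<and> (\<forall>w. s < w \<and> w < e \<longrightarrow> w \<notin> nodal)"
  then obtain s e where e: "s < e" "e \<le> s + L" "R x s \<and> R y e \<or> R y s \<and> R x e" "\<forall>w. s < w \<and> w < e \<longrightarrow> w \<notin> nodal" by blast
  have "cls x \<in> gt_nodes v n G" "cls y \<in> gt_nodes v n G" using assms by (auto simp: gt_nodes_cls)
  moreover have "0 < e - s" "e - s \<le> L" using e by auto
  moreover have "(bpt v n s \<in> cls x \<and> bpt v n (s + (e - s)) \<in> cls y) \<or> (bpt v n s \<in> cls y \<and> bpt v n (s + (e - s)) \<in> cls x)"
    using e(3) by (simp add: in_cls)
  moreover have "\<forall>t. 0 < t \<and> t < e - s \<longrightarrow> bpt v n (s + t) \<notin> \<Union>(gt_nodes v n G)"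
    unfolding in_nodes_iff using e(4) by auto
  ultimately show "(cls x, cls y) \<in> gt_adj v n G" unfolding gt_adj_def by blast
qed

lemma gt_label_cls:
  assumes "x \<in> nodal"
  shows "gt_label v n G (cls x) = {Vtx i | i. i < n \<and> R x (cl i)} \<union>
    {Edg i | i. i < n \<and> (\<exists>u. R x u \<and> cl i < u \<and> u < cl (Suc i))}"
proof -
  have k: "(\<exists>p\<in>cls x. p \<in> open_segment (v i) (v (nxt n i))) \<longleftrightarrow> (\<exists>u. R x u \<and> cl i < u \<and> u < cl (Suc i))" if i: "i < n" for i
  proof
    assume "\<exists>p\<in>cls x. p \<in> open_segment (v i) (v (nxt n i))"
    then obtain y where y: "R x y" "bpt v n y \<in> open_segment (v i) (v (nxt n i))" by (auto simp: cls_def)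
    then obtain u where "cong_per L y u" "cl i < u" "u < cl (Suc i)" using open_edge_iff[OF i] by blast
    then show "\<exists>u. R x u \<and> cl i < u \<and> u < cl (Suc i)" using C.R_cg[OF y(1) cong_per_refl] by blast
  next
    assume "\<exists>u. R x u \<and> cl i < u \<and> u < cl (Suc i)"
    then obtain u where u: "R x u" "cl i < u" "u < cl (Suc i)" by blast
    then have "bpt v n u \<in> open_segment (v i) (v (nxt n i))" using open_edge_iff[OF i, of u] cong_per_refl by blast
    then show "\<exists>p\<in>cls x. p \<in> open_segment (v i) (v (nxt n i))" using in_cls u(1) by blast
  qed
  have nd: "cls x \<in> gt_nodes v n G" using assms by (simp add: gt_nodes_cls)
  have e1: "{Vtx i | i. i < n \<and> v i \<in> cls x} = {Vtx i | i. i < n \<and> R x (cl i)}"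
    using vertex_in_cls by blast
  have e2: "{Edg i | i. i < n \<and> (\<exists>p\<in>cls x. p \<in> open_segment (v i) (v (nxt n i)))} =
      {Edg i | i. i < n \<and> (\<exists>u. R x u \<and> cl i < u \<and> u < cl (Suc i))}"
    using k by blast
  show ?thesis unfolding gt_label_def if_P[OF nd] e1 e2 ..
qed

text \<open>From a leaf both directions along the boundary reach the same next node, because the two
  sides are folded together. This node differs from the leaf since \<rho> < L: there is a mark that
  is not congruent to x.\<close>

lemma leaf_degree:
  assumes x: "csz x = 1"
  shows "card {B \<in> gt_nodes v n G. B \<noteq> cls x \<and> (cls x, B) \<in> gt_adj v n G} = 1"
proof -
  have fX: "finite (nodal \<inter> {0..<0 + L})" using finite_nodal by simp
  have ne: "nodal \<noteq> {}" using marks_ne nodal_mark by blast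
  note nn = next_in[OF L_pos periodic_nodal fX ne, of x]
  define \<rho> where "\<rho> = next_in L nodal x - x"
  have r: "\<rho> > 0" "\<rho> \<le> L" "x + \<rho> \<in> nodal" using nn by (auto simp: \<rho>_def)
  have free: "x + t \<notin> nodal" if "0 < t" "t < \<rho>" for t using nn(4)[of "x + t"] that by (simp add: \<rho>_def)
  have two: "csz (x + t) = 2" if "0 < t" "t < \<rho>" for t using free[OF that] nodal_I by blast
  have fold: "R (x + t) (x - t)" if "0 \<le> t" "t \<le> \<rho>" for t
  proof -
    have "R (x + t) (C.sc x - t)" by (rule C.propagate[OF two that])
    moreover have "C.sc x = x + L" by (rule C.sc_leaf[OF x])
    moreover have "cong_per L (x + L - t) (x - t)" using cong_per_minus_period[of L "x + L - t"] by simp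
    ultimately show ?thesis using C.R_cg[OF _ cong_per_refl] by metis
  qed
  have "\<exists>m\<in>marks. \<not> cong_per L x m"
  proof (rule ccontr)
    assume n: "\<not> ?thesis"
    have "marks \<inter> {0..<L} \<subseteq> {window L 0 x}"
    proof
      fix m assume m: "m \<in> marks \<inter> {0..<L}"
      then have "window L 0 x = window L 0 m" using n window_eq_iff[OF L_pos] by blast
      then show "m \<in> {window L 0 x}" using window_id[OF L_pos, of 0 m] m by simp
    qed
    then have "card (marks \<inter> {0..<L}) \<le> card {window L 0 x}" by (intro card_mono) auto
    then show False using card_marks n3 by simp
  qed
  then obtain m where m: "m \<in> marks" "\<not> cong_per L x m" by blast
  define w where "w = window L x m"
  have w: "w \<in> nodal" "x \<le> w" "w < x + L" "w \<noteq> x"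
    using m window_mem[OF periodic_marks, of x m] nodal_mark window_in[OF L_pos, of x m] cong_per_sym[OF window_cong_per[of L m x]]
    by (auto simp: w_def)
  have rL: "\<rho> < L" using nn(4)[of w] w by (force simp: \<rho>_def)
  have xn: "x \<in> nodal" using x nodal_I[of x] by simp
  have nR: "\<not> R x (x + \<rho>)"
    using C.class_size_1[OF x, of "x + \<rho>"] cong_per_close_eq[OF L_pos, of x "x + \<rho>"] r(1) rL by auto
  have "{B \<in> gt_nodes v n G. B \<noteq> cls x \<and> (cls x, B) \<in> gt_adj v n G} = {cls (x + \<rho>)}"
  proof (intro subset_antisym subsetI)
    fix B assume B: "B \<in> {B \<in> gt_nodes v n G. B \<noteq> cls x \<and> (cls x, B) \<in> gt_adj v n G}"
    then obtain y where y: "y \<in> nodal" "B = cls y" by (auto simp: gt_nodes_cls)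
    obtain s e where e: "s < e" "R x s \<and> R y e \<or> R y s \<and> R x e" "\<And>w. s < w \<Longrightarrow> w < e \<Longrightarrow> w \<notin> nodal"
      using B gt_adj_cls[OF xn y(1)] y(2) by blast
    have sh: "z + of_int k * L \<in> nodal \<longleftrightarrow> z \<in> nodal" for z k by (rule periodic_int[OF periodic_nodal])
    have "R y (x + \<rho>)" using e(2)
    proof
      assume a: "R x s \<and> R y e"
      obtain k where k: "s = x + of_int k * L" using C.class_size_1[OF x, of s] a unfolding cong_per_def by blast
      define d where "d = e - s"
      have ed: "e = (x + d) + of_int k * L" using k by (simp add: d_def)
      have Ry: "R y (x + d)" by (rule C.R_cg[of y e]) (use a ed in \<open>auto intro: cong_per_sym\<close>)
      have "x + d \<in> nodal" using nodal_closed[OF y(1) Ry] .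
      then have "\<not> d < \<rho>" using free[of d] e(1) by (auto simp: d_def)
      moreover have "\<not> \<rho> < d" using e(3)[of "x + \<rho> + of_int k * L"] sh[of "x + \<rho>" k] r k by (auto simp: d_def)
      ultimately show ?thesis using Ry by simp
    next
      assume a: "R y s \<and> R x e"
      obtain k where k: "e = x + of_int k * L" using C.class_size_1[OF x, of e] a unfolding cong_per_def by blast
      define d where "d = e - s"
      have sd: "s = (x - d) + of_int k * L" using k by (simp add: d_def)
      have Ry: "R y (x - d)" by (rule C.R_cg[of y s]) (use a sd in \<open>auto intro: cong_per_sym\<close>)
      have dn: "x - d \<in> nodal" using nodal_closed[OF y(1) Ry] .
      have "\<not> \<rho> < d"
      proof
        assume "\<rho> < d"
        moreover have "x - \<rho> \<in> nodal" using nodal_closed[OF r(3) fold[of \<rho>]] r by simp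
        ultimately show False using e(3)[of "x - \<rho> + of_int k * L"] sh[of "x - \<rho>" k] r k by (auto simp: d_def)
      qed
      moreover have "\<not> d < \<rho>"
      proof
        assume d: "d < \<rho>"
        have d0: "0 < d" using e(1) by (simp add: d_def)
        have "R (x - d) (x + d)" by (rule C.R_sym[OF fold]) (use d d0 in auto)
        then have "x + d \<in> nodal" by (rule nodal_closed[OF dn])
        then show False using free[OF d0 d] by blast
      qed
      ultimately have "d = \<rho>" by simp
      then show ?thesis using C.R_trans[OF Ry, of "x + \<rho>"] C.R_sym[OF fold[of \<rho>]] r by simp
    qed
    then show "B \<in> {cls (x + \<rho>)}" using cls_eq y(2) by simp
  next
    fix B assume "B \<in> {cls (x + \<rho>)}"
    then have B: "B = cls (x + \<rho>)" by simp
    have "(cls x, B) \<in> gt_adj v n G" unfolding B gt_adj_cls[OF xn r(3)]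
    proof (rule exI[of _ x], rule exI[of _ "x + \<rho>"], intro conjI allI impI)
      show "x < x + \<rho>" "x + \<rho> \<le> x + L" using r by auto
      show "R x x \<and> R (x + \<rho>) (x + \<rho>) \<or> R (x + \<rho>) x \<and> R x (x + \<rho>)" using C.R_refl by blast
      fix w assume "x < w \<and> w < x + \<rho>" then show "w \<notin> nodal" using free[of "w - x"] by simp
    qed
    moreover have "B \<noteq> cls x" unfolding B using nR cls_eq by blast
    moreover have "B \<in> gt_nodes v n G" unfolding B gt_nodes_cls using r(3) by blast
    ultimately show "B \<in> {B \<in> gt_nodes v n G. B \<noteq> cls x \<and> (cls x, B) \<in> gt_adj v n G}" by blast
  qed
  then show ?thesis by simp
qed

text \<open>Connects the parameter \<lambda>, a number of nodes of degree 1, with the one-point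
  classes that the circle count is about; \<open>family\<close> asks for an upper bound on the
  latter.\<close>

lemma leaves_le_num_leaves: "card (leaves L R) \<le> num_leaves (gluing_tree v n G)"
proof -
  let ?S = "{A \<in> gt_nodes v n G. card {B \<in> gt_nodes v n G. B \<noteq> A \<and> (A, B) \<in> gt_adj v n G} = 1}"
  have "gt_nodes v n G \<subseteq> cls ` (nodal \<inter> {0..<L})"
  proof
    fix A assume "A \<in> gt_nodes v n G"
    then obtain x where x: "x \<in> nodal" "A = cls x" by (auto simp: gt_nodes_cls)
    have "window L 0 x \<in> nodal \<inter> {0..<L}" using x window_mem[OF periodic_nodal, of 0 x] window_in[OF L_pos, of 0 x] by simp
    moreover have "A = cls (window L 0 x)" unfolding x(2) cls_eq by (rule C.cg_R[OF window_cong_per])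
    ultimately show "A \<in> cls ` (nodal \<inter> {0..<L})" by blast
  qed
  then have "finite (gt_nodes v n G)" by (rule finite_subset) (simp add: finite_nodal)
  then have f: "finite ?S" by simp
  have "card (leaves L R) \<le> card ?S"
  proof (rule card_inj_on_le[OF _ _ f])
    show "inj_on cls (leaves L R)"
    proof (rule inj_onI)
      fix x y assume xy: "x \<in> leaves L R" "y \<in> leaves L R" "cls x = cls y"
      then have "cong_per L x y" using C.class_size_1[of x y] cls_eq by (simp add: leaves_def)
      then show "x = y" by (rule cong_per_close_eq[OF L_pos]) (use xy in \<open>auto simp: leaves_def\<close>)
    qed
    show "cls ` leaves L R \<subseteq> ?S"
    proof (rule image_subsetI)
      fix x assume "x \<in> leaves L R"
      then have x: "csz x = 1" by (simp add: leaves_def)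
      then have "cls x \<in> gt_nodes v n G" using nodal_I[of x] by (simp add: gt_nodes_cls)
      then show "cls x \<in> ?S" using leaf_degree[OF x] by simp
    qed
  qed
  then show ?thesis by (simp add: num_leaves_def gluing_tree_def)
qed

end

section \<open>Equivalent gluings have isomorphic trees\<close>

lemma comb_equiv_ltree_iso:
  assumes g1: "glued_polygon v n G1" and g2: "glued_polygon v n G2"
    and e: "comb_equiv (perim v n) (polygon.marks v n) (\<lambda>x y. (bpt v n x, bpt v n y) \<in> glue_eq v n G1)
      (\<lambda>x y. (bpt v n x, bpt v n y) \<in> glue_eq v n G2)"
  shows "(gluing_tree v n G1, gluing_tree v n G2) \<in> ltree_iso"
proof -
  interpret A: glued_polygon v n G1 by (rule g1)
  interpret B: glued_polygon v n G2 by (rule g2)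
  let ?L = "perim v n"
  obtain \<phi> where p: "strict_mono \<phi>" "surj \<phi>" "\<And>x. \<phi> (x + ?L) = \<phi> x + ?L" "\<And>m. m \<in> A.marks \<Longrightarrow> \<phi> m = m"
    "\<And>x y. A.R x y \<longleftrightarrow> B.R (\<phi> x) (\<phi> y)" using e unfolding comb_equiv_def by blast
  have less: "\<phi> x < \<phi> y \<longleftrightarrow> x < y" and le: "\<phi> x \<le> \<phi> y \<longleftrightarrow> x \<le> y" for x y
    using strict_mono_less[OF p(1)] strict_mono_less_eq[OF p(1)] by blast+
  have ex: "(\<exists>x. P x) \<longleftrightarrow> (\<exists>x. P (\<phi> x))" and all: "(\<forall>x. P x) \<longleftrightarrow> (\<forall>x. P (\<phi> x))" for P
    using p(2) by (metis surjD)+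
  have class_size_eq: "class_size ?L B.R (\<phi> x) = class_size ?L A.R x" for x
  proof -
    have "{y. B.R (\<phi> x) y} \<inter> {\<phi> 0..<\<phi> 0 + ?L} = \<phi> ` ({y. A.R x y} \<inter> {0..<?L})"
    proof (intro subset_antisym subsetI)
      fix z assume z: "z \<in> {y. B.R (\<phi> x) y} \<inter> {\<phi> 0..<\<phi> 0 + ?L}"
      obtain y where y: "z = \<phi> y" using p(2) by (metis surjD)
      show "z \<in> \<phi> ` ({y. A.R x y} \<inter> {0..<?L})" using z p(5)[of x y] le[of 0 y] less[of y ?L] p(3)[of 0] unfolding y by auto
    next
      fix z assume "z \<in> \<phi> ` ({y. A.R x y} \<inter> {0..<?L})"
      then obtain y where y: "z = \<phi> y" "A.R x y" "0 \<le> y" "y < ?L" by auto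
      then show "z \<in> {y. B.R (\<phi> x) y} \<inter> {\<phi> 0..<\<phi> 0 + ?L}"
        using p(5)[of x y] le[of 0 y] less[of y ?L] p(3)[of 0] by auto
    qed
    moreover have "inj_on \<phi> S" for S using strict_mono_imp_inj_on[OF p(1)] inj_on_subset by blast
    ultimately show ?thesis unfolding B.C.class_size_window[of "\<phi> x" "\<phi> 0"] by (simp add: card_image class_size_def)
  qed
  have nodal: "\<phi> x \<in> B.nodal \<longleftrightarrow> x \<in> A.nodal" for x
  proof -
    have "(\<exists>m\<in>A.marks. B.R m (\<phi> x)) \<longleftrightarrow> (\<exists>m\<in>A.marks. A.R m x)" using p(4,5) by metis
    then show ?thesis by (simp add: A.nodal_def B.nodal_def class_size_eq)
  qed
  \<comment> \<open>The map acts on all parameters of a node at once, so that no representative has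
    to be chosen.\<close>
  define f where "f S = bpt v n ` \<phi> ` {s. bpt v n s \<in> S}" for S
  have f: "f (A.cls x) = B.cls (\<phi> x)" for x
  proof -
    have "\<phi> ` {s. A.R x s} = {t. B.R (\<phi> x) t}"
    proof (intro subset_antisym subsetI)
      fix t assume t: "t \<in> {t. B.R (\<phi> x) t}"
      obtain s where "t = \<phi> s" using p(2) by (metis surjD)
      then show "t \<in> \<phi> ` {s. A.R x s}" using t p(5)[of x s] by blast
    next
      fix t assume "t \<in> \<phi> ` {s. A.R x s}"
      then obtain s where "t = \<phi> s" "A.R x s" by blast
      then show "t \<in> {t. B.R (\<phi> x) t}" using p(5)[of x s] by blast
    qed
    then show ?thesis by (simp add: f_def A.in_cls B.cls_def)
  qed
  have "bij_betw f (gt_nodes v n G1) (gt_nodes v n G2)"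
    unfolding bij_betw_def
  proof
    show "inj_on f (gt_nodes v n G1)"
      unfolding A.gt_nodes_cls
    proof (rule inj_onI)
      fix S T assume "S \<in> A.cls ` A.nodal" "T \<in> A.cls ` A.nodal" "f S = f T"
      then obtain x y where xy: "S = A.cls x" "T = A.cls y" "f (A.cls x) = f (A.cls y)" by blast
      then have "B.R (\<phi> x) (\<phi> y)" unfolding f B.cls_eq by blast
      then have "A.R x y" by (simp only: p(5))
      then show "S = T" unfolding xy A.cls_eq by blast
    qed
    have "f ` A.cls ` A.nodal = B.cls ` \<phi> ` A.nodal" by (simp add: image_image f)
    also have "\<phi> ` A.nodal = B.nodal"
    proof (intro subset_antisym subsetI)
      fix t assume t: "t \<in> B.nodal"
      obtain s where "t = \<phi> s" using p(2) by (metis surjD)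
      then show "t \<in> \<phi> ` A.nodal" using t nodal[of s] by blast
    next
      fix t assume "t \<in> \<phi> ` A.nodal"
      then show "t \<in> B.nodal" using nodal by blast
    qed
    finally show "f ` gt_nodes v n G1 = gt_nodes v n G2" unfolding A.gt_nodes_cls B.gt_nodes_cls .
  qed
  moreover have "(S, T) \<in> gt_adj v n G1 \<longleftrightarrow> (f S, f T) \<in> gt_adj v n G2"
    if ST: "S \<in> gt_nodes v n G1" "T \<in> gt_nodes v n G1" for S T
  proof -
    obtain x y where xy: "x \<in> A.nodal" "S = A.cls x" "y \<in> A.nodal" "T = A.cls y"
      using ST unfolding A.gt_nodes_cls by blast
    have n: "\<phi> x \<in> B.nodal" "\<phi> y \<in> B.nodal" using xy nodal by auto
    have fw: "(\<forall>w. \<phi> s < w \<and> w < \<phi> e \<longrightarrow> w \<notin> B.nodal) \<longleftrightarrow> (\<forall>w. s < w \<and> w < e \<longrightarrow> w \<notin> A.nodal)" for s e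
      by (subst all) (simp add: less nodal)
    have ep: "\<phi> e \<le> \<phi> s + ?L \<longleftrightarrow> e \<le> s + ?L" for s e using le[of e "s + ?L"] p(3)[of s] by simp
    have "(B.cls (\<phi> x), B.cls (\<phi> y)) \<in> gt_adj v n G2 \<longleftrightarrow>
      (\<exists>s e. \<phi> s < \<phi> e \<and> \<phi> e \<le> \<phi> s + ?L \<and> (B.R (\<phi> x) (\<phi> s) \<and> B.R (\<phi> y) (\<phi> e) \<or> B.R (\<phi> y) (\<phi> s) \<and> B.R (\<phi> x) (\<phi> e)) \<and>
        (\<forall>w. \<phi> s < w \<and> w < \<phi> e \<longrightarrow> w \<notin> B.nodal))"
      unfolding B.gt_adj_cls[OF n] by (subst ex, subst (2) ex) (rule refl)
    also have "\<dots> \<longleftrightarrow> (A.cls x, A.cls y) \<in> gt_adj v n G1"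
      unfolding A.gt_adj_cls[OF xy(1,3)] fw ep less p(5)[symmetric] ..
    finally show ?thesis by (simp add: xy f)
  qed
  moreover have "gt_label v n G2 (f S) = gt_label v n G1 S" if S: "S \<in> gt_nodes v n G1" for S
  proof -
    obtain x where x: "x \<in> A.nodal" "S = A.cls x" using S unfolding A.gt_nodes_cls by blast
    have n: "\<phi> x \<in> B.nodal" using x nodal by simp
    have fc: "\<phi> (A.cl i) = A.cl i" if "i \<le> n" for i using p(4) A.cl_marks[OF that] by blast
    have 1: "B.R (\<phi> x) (A.cl i) \<longleftrightarrow> A.R x (A.cl i)" if "i < n" for i using p(5)[of x "A.cl i"] fc[of i] that by simp
    have 2: "(\<exists>u. B.R (\<phi> x) u \<and> A.cl i < u \<and> u < A.cl (Suc i)) \<longleftrightarrow> (\<exists>u. A.R x u \<and> A.cl i < u \<and> u < A.cl (Suc i))"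
      if i: "i < n" for i
    proof -
      have "A.cl i < \<phi> u \<longleftrightarrow> A.cl i < u" "\<phi> u < A.cl (Suc i) \<longleftrightarrow> u < A.cl (Suc i)" for u
        using less[of "A.cl i" u] less[of u "A.cl (Suc i)"] fc[of i] fc[of "Suc i"] i by auto
      then show ?thesis by (subst ex) (simp add: p(5)[symmetric])
    qed
    show ?thesis unfolding x(2) f A.gt_label_cls[OF x(1)] B.gt_label_cls[OF n] using 1 2 by blast
  qed
  ultimately have "\<exists>f. bij_betw f (gt_nodes v n G1) (gt_nodes v n G2) \<and>
      (\<forall>S\<in>gt_nodes v n G1. \<forall>T\<in>gt_nodes v n G1. (S, T) \<in> gt_adj v n G1 \<longleftrightarrow> (f S, f T) \<in> gt_adj v n G2) \<and>
      (\<forall>S\<in>gt_nodes v n G1. gt_label v n G2 (f S) = gt_label v n G1 S)"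
    by (intro exI[of _ f] conjI ballI) blast+
  then show ?thesis by (simp add: ltree_iso_def gluing_tree_def)
qed

section \<open>Counting isomorphism classes of trees\<close>

lemma ltree_iso_sym: assumes "(T1, T2) \<in> ltree_iso" shows "(T2, T1) \<in> ltree_iso"
proof -
  obtain N1 E1 l1 N2 E2 l2 f where T: "T1 = (N1, E1, l1)" "T2 = (N2, E2, l2)" and f: "bij_betw f N1 N2"
    "\<forall>A\<in>N1. \<forall>B\<in>N1. (A, B) \<in> E1 \<longleftrightarrow> (f A, f B) \<in> E2" "\<forall>A\<in>N1. l2 (f A) = l1 A"
    using assms unfolding ltree_iso_def by blast
  define g where "g = inv_into N1 f"
  have g: "bij_betw g N2 N1" unfolding g_def by (rule bij_betw_inv_into[OF f(1)])
  have fg: "f (g A) = A" "g A \<in> N1" if "A \<in> N2" for A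
    using bij_betw_inv_into_right[OF f(1) that] bij_betw_apply[OF g that] by (simp_all add: g_def)
  have "\<forall>A\<in>N2. \<forall>B\<in>N2. (A, B) \<in> E2 \<longleftrightarrow> (g A, g B) \<in> E1" using f(2) fg by metis
  moreover have "\<forall>A\<in>N2. l1 (g A) = l2 A" using f(3) fg by metis
  ultimately show ?thesis unfolding ltree_iso_def T using g by blast
qed

lemma ltree_iso_trans: assumes "(T1, T2) \<in> ltree_iso" "(T2, T3) \<in> ltree_iso" shows "(T1, T3) \<in> ltree_iso"
proof -
  obtain N1 E1 l1 N2 E2 l2 f where T: "T1 = (N1, E1, l1)" "T2 = (N2, E2, l2)" and f: "bij_betw f N1 N2"
    "\<forall>A\<in>N1. \<forall>B\<in>N1. (A, B) \<in> E1 \<longleftrightarrow> (f A, f B) \<in> E2" "\<forall>A\<in>N1. l2 (f A) = l1 A"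
    using assms(1) unfolding ltree_iso_def by blast
  obtain N3 E3 l3 g where T3: "T3 = (N3, E3, l3)" and g: "bij_betw g N2 N3"
    "\<forall>A\<in>N2. \<forall>B\<in>N2. (A, B) \<in> E2 \<longleftrightarrow> (g A, g B) \<in> E3" "\<forall>A\<in>N2. l3 (g A) = l2 A"
    using assms(2) unfolding ltree_iso_def T(2) by blast
  have fN: "f A \<in> N2" if "A \<in> N1" for A using bij_betw_apply[OF f(1) that] .
  have "bij_betw (g \<circ> f) N1 N3" by (rule bij_betw_trans[OF f(1) g(1)])
  moreover have "\<forall>A\<in>N1. \<forall>B\<in>N1. (A, B) \<in> E1 \<longleftrightarrow> ((g \<circ> f) A, (g \<circ> f) B) \<in> E3" using f(2) g(2) fN by simp
  moreover have "\<forall>A\<in>N1. l3 ((g \<circ> f) A) = l1 A" using f(3) g(3) fN by simp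
  ultimately show ?thesis unfolding ltree_iso_def T(1) T3 by blast
qed

lemma ltree_iso_class: "(T1, T2) \<in> ltree_iso \<Longrightarrow> ltree_iso `` {T1} = ltree_iso `` {T2}"
  using ltree_iso_sym ltree_iso_trans by blast

theorem theorem7:
  fixes lam :: nat
  shows "\<exists>C :: real. \<forall>(v :: nat \<Rightarrow> complex) (n :: nat).
           simple_polygon v n \<longrightarrow>
             finite (aleks_trees v n lam // ltree_iso) \<and>
             real (num_aleks_trees v n lam) \<le> C * real n ^ (2 * lam - 2)"
proof (intro exI[of _ "20 ^ lam"] allI impI)
  fix v :: "nat \<Rightarrow> complex" and n :: nat
  assume sp: "simple_polygon v n"
  interpret polygon v n by unfold_locales (rule sp)
  define S where "S = {G. aleksandrov_gluing v n G \<and> num_leaves (gluing_tree v n G) = lam}"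
  define h where "h G = ltree_iso `` {gluing_tree v n G}" for G
  have quot: "aleks_trees v n lam // ltree_iso = h ` S"
    unfolding quotient_def aleks_trees_def h_def S_def by blast
  have gp: "glued_polygon v n G" if "G \<in> S" for G
    using that polygon_axioms by (simp add: S_def glued_polygon_def glued_polygon_axioms_def)
  define Rel where "Rel G = (\<lambda>x y. (bpt v n x, bpt v n y) \<in> glue_eq v n G)" for G
  have lam: "2 \<le> card (leaves L (Rel G)) \<and> card (leaves L (Rel G)) \<le> lam" if G: "G \<in> S" for G
  proof -
    interpret g: glued_polygon v n G by (rule gp[OF G])
    show ?thesis using g.C.card_leaves_ge g.leaves_le_num_leaves G by (simp add: Rel_def S_def)
  qed
  show "finite (aleks_trees v n lam // ltree_iso) \<and> real (num_aleks_trees v n lam) \<le> 20 ^ lam * real n ^ (2 * lam - 2)"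
  proof (cases "S = {}")
    case True
    then show ?thesis unfolding num_aleks_trees_def quot by simp
  next
    case False
    \<comment> \<open>Every gluing has at least two leaves. So for lam < 2 the set was empty and the
      truncated subtraction in the exponent does no harm.\<close>
    then have "lam \<ge> 2" using lam by fastforce
    then obtain k where k: "lam = k + 2" by (metis add.commute le_Suc_ex)
    define N where "N = 20 ^ (k + 1) * n ^ (2 * k + 2)"
    have "covered L marks (family L marks (k + 2)) N"
      using circle_count[OF L_pos periodic_marks finite_marks marks_ne] by (simp add: card_marks N_def)
    then obtain c where c: "\<forall>R\<in>family L marks (k + 2). c R < N"
      "\<forall>R\<in>family L marks (k + 2). \<forall>R'\<in>family L marks (k + 2). c R = c R' \<longrightarrow> comb_equiv L marks R R'"
      unfolding covered_def by blast
    have Rf: "Rel G \<in> family L marks (k + 2)" if G: "G \<in> S" for G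
    proof -
      interpret g: glued_polygon v n G by (rule gp[OF G])
      show ?thesis unfolding Rel_def by (rule g.R_family) (use lam[OF G] k in \<open>simp add: Rel_def\<close>)
    qed
    have same: "h G = h G'" if "G \<in> S" "G' \<in> S" "c (Rel G) = c (Rel G')" for G G'
    proof -
      have "comb_equiv L marks (Rel G) (Rel G')" using c(2) Rf that by blast
      then have "(gluing_tree v n G, gluing_tree v n G') \<in> ltree_iso"
        unfolding Rel_def by (rule comb_equiv_ltree_iso[OF gp[OF that(1)] gp[OF that(2)]])
      then show ?thesis unfolding h_def by (rule ltree_iso_class)
    qed
    \<comment> \<open>One representative gluing for each colour that occurs.\<close>
    have sub: "h ` S \<subseteq> (\<lambda>i. h (SOME G. G \<in> S \<and> c (Rel G) = i)) ` {..<N}"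
    proof (rule image_subsetI)
      fix G assume G: "G \<in> S"
      let ?G = "SOME G'. G' \<in> S \<and> c (Rel G') = c (Rel G)"
      have "?G \<in> S \<and> c (Rel ?G) = c (Rel G)" by (rule someI[of _ G]) (use G in simp)
      then have "h G = h ?G" using same[of ?G G] G by simp
      moreover have "c (Rel G) < N" using c(1) Rf[OF G] by blast
      ultimately show "h G \<in> (\<lambda>i. h (SOME G. G \<in> S \<and> c (Rel G) = i)) ` {..<N}" by blast
    qed
    have fin: "finite (h ` S)" by (rule finite_subset[OF sub]) simp
    have "card (h ` S) \<le> card ((\<lambda>i. h (SOME G. G \<in> S \<and> c (Rel G) = i)) ` {..<N})" by (rule card_mono[OF _ sub]) simp
    also have "\<dots> \<le> card {..<N}" by (rule card_image_le) simp
    also have "\<dots> = N" by simp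
    finally have "real (card (h ` S)) \<le> real N" by simp
    also have "\<dots> \<le> 20 ^ lam * real n ^ (2 * lam - 2)" by (simp add: N_def k)
    finally show ?thesis using fin unfolding num_aleks_trees_def quot by simp
  qed
qed

end
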